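(* Let $\lambda,\mu\in P^+$. Then $$\langle m_\lambda,m_\mu\rangle_1=\frac1{|W_\lambda|}\delta_{\lambda\mu},\qquad \langle s_\lambda,s_\mu\rangle_0=\delta_{\lambda\mu},\qquad \langle P_\lambda,P_\mu\rangle_t=\frac1{W_\lambda(t)}\delta_{\lambda\mu},$$ where $P_\lambda=P_\lambda(x;t)$.
   Context: $R$ is a reduced irreducible root system spanning a finite-dimensional real vector space with nondegenerate symmetric bilinear form $\langle\,,\rangle$; $\alpha^\vee=2\alpha/\langle\alpha,\alpha\rangle$; $W$ is the Weyl group, $R^+$ a choice of positive roots, $\ell$ the length function. $P=\{\lambda:\langle\lambda,\alpha^\vee\rangle\in\mathbb Z\ \forall\alpha\in R\}$, $P^+=\{\lambda\in P:\langle\lambda,\alpha^\vee\rangle\ge0\ \forall\alpha\in R^+\}$, $\rho=\frac12\sum_{\alpha\in R^+}\alpha$. $W_\lambda$ is the stabilizer of $\lambda$ in $W$ and $W_\lambda(t)=\sum_{w\in W_\lambda}t^{\ell(w)}$. Let $\mathbb K=\mathbb Z[t]$ and $\mathbb K[P]$ the group algebra of $P$ with basis $x^\lambda$ and $W$-action $wx^\lambda=x^{w\lambda}$. For $f=\sum_\mu f_\mu x^\mu$ put $\bar f=\sum_\mu f_\mu x^{-\mu}$ and $[f]_1=f_0$ (coefficient of $x^0=1$). Define $$\langle f,g\rangle_t=\frac1{|W|}\Big[f\bar g\prod_{\alpha\in R}\frac{1-x^\alpha}{1-tx^\alpha}\Big]_1,\quad \langle f,g\rangle_0=\frac1{|W|}\Big[f\bar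 g\prod_{\alpha\in R}(1-x^\alpha)\Big]_1,\quad \langle f,g\rangle_1=\frac1{|W|}[f\bar g]_1,$$ where $\frac1{1-tx^\alpha}=\sum_{k\ge0}t^kx^{k\alpha}$, so $\langle f,g\rangle_t$ is a power series in $t$. $m_\mu=\sum_{\gamma\in W\mu}x^\gamma$; $a_\mu=\sum_{w\in W}(-1)^{\ell(w)}x^{w\mu}$; $s_\lambda=a_{\lambda+\rho}/a_\rho$ (Weyl character); and $$P_\lambda(x;t)=\frac1{W_\lambda(t)}\sum_{w\in W}w\Big(x^\lambda\prod_{\alpha\in R^+}\frac{1-tx^{-\alpha}}{1-x^{-\alpha}}\Big)$$ (Macdonald spherical function). *)

theory Defs
  imports
    "HOL-Analysis.Analysis"
    "HOL-Library.Poly_Mapping"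
    "HOL-Computational_Algebra.Polynomial_Factorial"
    "HOL-Computational_Algebra.Polynomial_FPS"
begin

subsection \<open>Root systems\<close>

definition nondegenerate_symmetric_bilinear ::
    "('a::real_vector \<Rightarrow> 'a \<Rightarrow> real) \<Rightarrow> bool" where
  "nondegenerate_symmetric_bilinear B \<longleftrightarrow>
     bilinear B \<and>
     (\<forall>x y. B x y = B y x) \<and>
     (\<forall>x. (\<forall>y. B x y = 0) \<longrightarrow> x = 0)"

definition coroot :: "('a::real_vector \<Rightarrow> 'a \<Rightarrow> real) \<Rightarrow> 'a \<Rightarrow> 'a" where
  "coroot B \<alpha> = (2 / B \<alpha> \<alpha>) *\<^sub>R \<alpha>"

definition reflection :: "('a::real_vector \<Rightarrow> 'a \<Rightarrow> real) \<Rightarrow> 'a \<Rightarrow> 'a \<Rightarrow> 'a" where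
  "reflection B \<alpha> v = v - B v (coroot B \<alpha>) *\<^sub>R \<alpha>"

text \<open>
  The ambient space is the whole type; it is finite-dimensional because it is spanned by the
  finite set \<open>R\<close>. The form is not assumed to be positive definite, only nonisotropic
  on the roots, so that the coroots make sense.
\<close>
definition root_system :: "('a::real_vector \<Rightarrow> 'a \<Rightarrow> real) \<Rightarrow> 'a set \<Rightarrow> bool" where
  "root_system B R \<longleftrightarrow>
     finite R \<and> span R = UNIV \<and>
     (\<forall>\<alpha>\<in>R. B \<alpha> \<alpha> \<noteq> 0) \<and>
     (\<forall>\<alpha>\<in>R. \<forall>\<beta>\<in>R. reflection B \<alpha> \<beta> \<in> R) \<and>
     (\<forall>\<alpha>\<in>R. \<forall>\<beta>\<in>R. B \<beta> (coroot B \<alpha>) \<in> \<int>)"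

definition reduced_roots :: "'a::real_vector set \<Rightarrow> bool" where
  "reduced_roots R \<longleftrightarrow> (\<forall>\<alpha>\<in>R. \<forall>c. c *\<^sub>R \<alpha> \<in> R \<longrightarrow> c = 1 \<or> c = -1)"

definition irreducible_roots :: "('a::real_vector \<Rightarrow> 'a \<Rightarrow> real) \<Rightarrow> 'a set \<Rightarrow> bool" where
  "irreducible_roots B R \<longleftrightarrow>
     R \<noteq> {} \<and>
     \<not> (\<exists>S T. S \<noteq> {} \<and> T \<noteq> {} \<and> S \<inter> T = {} \<and> S \<union> T = R \<and> (\<forall>\<alpha>\<in>S. \<forall>\<beta>\<in>T. B \<alpha> \<beta> = 0))"

text \<open>
  A positive system consists of the roots that are positive on a Weyl chamber, here given by
  a regular vector \<open>v\<close> in it. Pairing with coroots rather than roots makes this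
  independent of the sign of the form.
\<close>
definition positive_roots ::
    "('a::real_vector \<Rightarrow> 'a \<Rightarrow> real) \<Rightarrow> 'a set \<Rightarrow> 'a set \<Rightarrow> bool" where
  "positive_roots B R Rp \<longleftrightarrow>
     (\<exists>v. (\<forall>\<alpha>\<in>R. B v (coroot B \<alpha>) \<noteq> 0) \<and> Rp = {\<alpha>\<in>R. B v (coroot B \<alpha>) > 0})"

inductive_set weyl_group :: "('a::real_vector \<Rightarrow> 'a \<Rightarrow> real) \<Rightarrow> 'a set \<Rightarrow> ('a \<Rightarrow> 'a) set"
  for B R where
  weyl_id: "id \<in> weyl_group B R"
| weyl_refl: "w \<in> weyl_group B R \<Longrightarrow> \<alpha> \<in> R \<Longrightarrow> reflection B \<alpha> \<circ> w \<in> weyl_group B R"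

definition simple_roots :: "'a::real_vector set \<Rightarrow> 'a set" where
  "simple_roots Rp = {\<alpha>\<in>Rp. \<not> (\<exists>\<beta>\<in>Rp. \<exists>\<gamma>\<in>Rp. \<alpha> = \<beta> + \<gamma>)}"

definition weyl_length ::
    "('a::real_vector \<Rightarrow> 'a \<Rightarrow> real) \<Rightarrow> 'a set \<Rightarrow> ('a \<Rightarrow> 'a) \<Rightarrow> nat" where
  "weyl_length B Rp w =
     (LEAST n. \<exists>as. length as = n \<and> set as \<subseteq> simple_roots Rp \<and>
                    w = foldr (\<lambda>\<alpha> u. reflection B \<alpha> \<circ> u) as id)"

definition weight_lattice :: "('a::real_vector \<Rightarrow> 'a \<Rightarrow> real) \<Rightarrow> 'a set \<Rightarrow> 'a set" where
  "weight_lattice B R = {\<mu>. \<forall>\<alpha>\<in>R. B \<mu> (coroot B \<alpha>) \<in> \<int>}"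

definition dominant_weights ::
    "('a::real_vector \<Rightarrow> 'a \<Rightarrow> real) \<Rightarrow> 'a set \<Rightarrow> 'a set \<Rightarrow> 'a set" where
  "dominant_weights B R Rp = {\<mu> \<in> weight_lattice B R. \<forall>\<alpha>\<in>Rp. B \<mu> (coroot B \<alpha>) \<ge> 0}"

definition rho :: "'a::real_vector set \<Rightarrow> 'a" where
  "rho Rp = (1/2) *\<^sub>R (\<Sum>\<alpha>\<in>Rp. \<alpha>)"

definition weyl_stabilizer ::
    "('a::real_vector \<Rightarrow> 'a \<Rightarrow> real) \<Rightarrow> 'a set \<Rightarrow> 'a \<Rightarrow> ('a \<Rightarrow> 'a) set" where
  "weyl_stabilizer B R \<mu> = {w \<in> weyl_group B R. w \<mu> = \<mu>}"

definition stabilizer_poly ::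
    "('a::real_vector \<Rightarrow> 'a \<Rightarrow> real) \<Rightarrow> 'a set \<Rightarrow> 'a set \<Rightarrow> 'a \<Rightarrow> int poly" where
  "stabilizer_poly B R Rp \<mu> = (\<Sum>w\<in>weyl_stabilizer B R \<mu>. monom 1 (weyl_length B Rp w))"


subsection \<open>Group algebras\<close>

text \<open>
  \<open>('a, 'k) galg\<close> is the group algebra of the additive group \<open>'a\<close> over
  \<open>'k\<close>, with convolution product. It is a copy of \<open>'a \<Rightarrow>\<^sub>0 'k\<close>,
  because the library makes the latter an integral domain only for linearly ordered
  \<open>'a\<close>, whereas here the exponents lie in a vector space. The integral domain
  property is needed to form the fraction field.
\<close>
typedef (overloaded) ('a, 'k::zero) galg = "UNIV :: ('a \<Rightarrow>\<^sub>0 'k) set"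
  by simp

setup_lifting type_definition_galg

lift_definition galg_coeff :: "('a, 'k::zero) galg \<Rightarrow> 'a \<Rightarrow> 'k" is Poly_Mapping.lookup .

lift_definition galg_monom :: "'a \<Rightarrow> 'k \<Rightarrow> ('a, 'k::zero) galg" is Poly_Mapping.single .

lift_definition galg_supp :: "('a, 'k::zero) galg \<Rightarrow> 'a set" is Poly_Mapping.keys .

instantiation galg :: (comm_monoid_add, comm_ring_1) comm_ring_1
begin
lift_definition zero_galg :: "('a, 'b) galg" is 0 .
lift_definition one_galg :: "('a, 'b) galg" is 1 .
lift_definition plus_galg :: "('a, 'b) galg \<Rightarrow> ('a, 'b) galg \<Rightarrow> ('a, 'b) galg" is "(+)" .
lift_definition minus_galg :: "('a, 'b) galg \<Rightarrow> ('a, 'b) galg \<Rightarrow> ('a, 'b) galg" is "(-)" .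
lift_definition uminus_galg :: "('a, 'b) galg \<Rightarrow> ('a, 'b) galg" is "uminus" .
lift_definition times_galg :: "('a, 'b) galg \<Rightarrow> ('a, 'b) galg \<Rightarrow> ('a, 'b) galg" is "(*)" .
instance
  by standard (transfer; simp add: algebra_simps)+
end

lemma exists_linear_functional_nonzero:
  fixes N :: "'a::real_vector set"
  assumes "finite N" "0 \<notin> N"
  shows "\<exists>f::'a \<Rightarrow> real. linear f \<and> (\<forall>v\<in>N. f v \<noteq> 0)"
  using assms
proof (induction N)
  case empty
  show ?case by (rule exI[of _ "\<lambda>_. 0"]) (simp add: linear_iff)
next
  case (insert v N)
  then obtain f :: "'a \<Rightarrow> real" where f: "linear f" "\<forall>u\<in>N. f u \<noteq> 0" by auto
  have "independent {v}" using insert by simp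
  then obtain g :: "'a \<Rightarrow> real" where g: "linear g" "g v = 1"
    using linear_independent_extend[of "{v}" "\<lambda>_. 1::real"] by auto
  have "finite ((\<lambda>u. - g u / f u) ` insert v N)" using insert by simp
  then obtain c where c: "c \<notin> (\<lambda>u. - g u / f u) ` insert v N"
    using ex_new_if_finite infinite_UNIV_char_0 by blast
  have "linear (\<lambda>x. c * f x + g x)"
    using f(1) g(1) by (auto simp: linear_iff algebra_simps)
  moreover have "c * f u + g u \<noteq> 0" if "u \<in> insert v N" for u
  proof (cases "f u = 0")
    case True
    then have "u = v" using f(2) that by auto
    then show ?thesis using True g(2) by simp
  next
    case False
    have "c \<noteq> - g u / f u" using c(1) that by blast
    then show ?thesis using False by (auto simp: field_simps)
  qed
  ultimately show ?case by blast
qed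

lemma poly_mapping_no_zero_divisors:
  fixes f g :: "'a::real_vector \<Rightarrow>\<^sub>0 'b::idom"
  assumes "f \<noteq> 0" "g \<noteq> 0"
  shows "f * g \<noteq> 0"
proof -
  let ?F = "Poly_Mapping.keys f" and ?G = "Poly_Mapping.keys g"
  define N where "N = (\<lambda>(a, b). a - b) ` ((?F \<union> ?G) \<times> (?F \<union> ?G)) - {0}"
  have "finite N" "0 \<notin> N" by (auto simp: N_def)
  from exists_linear_functional_nonzero[OF this]
  obtain h :: "'a \<Rightarrow> real" where h: "linear h" "\<forall>v\<in>N. h v \<noteq> 0" by blast
  have inj: "a = b" if "a \<in> ?F \<union> ?G" "b \<in> ?F \<union> ?G" "h a = h b" for a b
  proof (rule ccontr)
    assume "a \<noteq> b"
    then have "a - b \<in> N" using that unfolding N_def by force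
    then have "h (a - b) \<noteq> 0" using h by blast
    then show False using that(3) linear_diff[OF h(1), of a b] by simp
  qed
  have ne: "?F \<noteq> {}" "?G \<noteq> {}" using assms by auto
  have maxim: "\<exists>a\<in>A. \<forall>x\<in>A. h x \<le> h a" if "finite A" "A \<noteq> {}" for A
    using arg_min_if_finite[OF that, of "\<lambda>x. - h x"] by (metis neg_less_iff_less not_le)
  obtain a where a: "a \<in> ?F" "\<And>x. x \<in> ?F \<Longrightarrow> h x \<le> h a"
    using maxim[OF _ ne(1)] by auto
  obtain b where b: "b \<in> ?G" "\<And>x. x \<in> ?G \<Longrightarrow> h x \<le> h b"
    using maxim[OF _ ne(2)] by auto
  have uniq: "x = a \<and> y = b" if "x \<in> ?F" "y \<in> ?G" "a + b = x + y" for x y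
  proof -
    have "h a + h b = h x + h y" using that(3) linear_add[OF h(1)] by metis
    then have "h x = h a" "h y = h b" using a(2)[OF that(1)] b(2)[OF that(2)] by auto
    then show ?thesis using inj that a b by blast
  qed
  have inner: "Sum_any (\<lambda>q. Poly_Mapping.lookup g q when a + b = l + q)
      = (Poly_Mapping.lookup g b when l = a)" if "l \<in> ?F" for l
  proof -
    have "(\<lambda>q. Poly_Mapping.lookup g q when a + b = l + q)
        = (\<lambda>q. (Poly_Mapping.lookup g b when l = a) when q = b)"
      using uniq[OF that] by (fastforce simp: when_def in_keys_iff)
    then show ?thesis by (simp only: Sum_any_when_equal)
  qed
  have "(\<lambda>l. Poly_Mapping.lookup f l * Sum_any (\<lambda>q. Poly_Mapping.lookup g q when a + b = l + q))
      = (\<lambda>l. Poly_Mapping.lookup f a * Poly_Mapping.lookup g b when l = a)"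
    using inner by (fastforce simp: when_def in_keys_iff)
  then have "Poly_Mapping.lookup (f * g) (a + b) = Poly_Mapping.lookup f a * Poly_Mapping.lookup g b"
    by (simp only: lookup_mult Sum_any_when_equal)
  moreover have "\<dots> \<noteq> 0" using a(1) b(1) by (simp add: in_keys_iff)
  ultimately show ?thesis by auto
qed

instance galg :: (real_vector, idom) idom
  by standard (transfer; simp add: poly_mapping_no_zero_divisors)

definition galg_on :: "'a set \<Rightarrow> ('a, 'k::zero) galg set" where
  "galg_on L = {f. galg_supp f \<subseteq> L}"

definition galg_map_exp ::
    "('a \<Rightarrow> 'a) \<Rightarrow> ('a::comm_monoid_add, 'k::comm_ring_1) galg \<Rightarrow> ('a, 'k) galg" where
  "galg_map_exp w f = (\<Sum>\<mu>\<in>galg_supp f. galg_monom (w \<mu>) (galg_coeff f \<mu>))"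

definition galg_bar :: "('a::ab_group_add, 'k::comm_ring_1) galg \<Rightarrow> ('a, 'k) galg" where
  "galg_bar f = galg_map_exp uminus f"

definition galg_const :: "'k \<Rightarrow> ('a::zero, 'k::zero) galg" where
  "galg_const c = galg_monom 0 c"

text \<open>The indeterminate \<open>t\<close> of the coefficient ring \<open>\<int>[t]\<close>.\<close>
definition t_poly :: "int poly" where
  "t_poly = monom 1 1"

text \<open>
  For injective additive \<open>w\<close>, the extension of the ring endomorphism
  \<open>galg_map_exp w\<close> to the fraction field, \<open>w(a/b) = w(a)/w(b)\<close>.
\<close>
definition fract_map_exp ::
    "('a \<Rightarrow> 'a) \<Rightarrow> ('a::real_vector, 'k::idom) galg fract \<Rightarrow> ('a, 'k) galg fract" where
  "fract_map_exp w q =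
     (THE r. \<exists>a b. b \<noteq> 0 \<and> q = Fract a b \<and> r = Fract (galg_map_exp w a) (galg_map_exp w b))"

text \<open>The element of the group algebra of \<open>L\<close> equal to a given fraction.\<close>
definition integral_fract :: "'a set \<Rightarrow> ('a::real_vector, 'k::idom) galg fract \<Rightarrow> ('a, 'k) galg" where
  "integral_fract L q = (THE f. f \<in> galg_on L \<and> to_fract f = q)"


subsection \<open>Scalar products\<close>

text \<open>
  The first two forms take values in \<open>\<rat>[t]\<close>, the third one in
  \<open>\<rat>[[t]]\<close>.
\<close>

definition form_1 :: "('a::real_vector \<Rightarrow> 'a \<Rightarrow> real) \<Rightarrow> 'a set \<Rightarrow>
    ('a, int poly) galg \<Rightarrow> ('a, int poly) galg \<Rightarrow> rat poly" where
  "form_1 B R f g =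
     smult (1 / of_nat (card (weyl_group B R)))
       (map_poly of_int (galg_coeff (f * galg_bar g) 0))"

definition form_0 :: "('a::real_vector \<Rightarrow> 'a \<Rightarrow> real) \<Rightarrow> 'a set \<Rightarrow>
    ('a, int poly) galg \<Rightarrow> ('a, int poly) galg \<Rightarrow> rat poly" where
  "form_0 B R f g =
     smult (1 / of_nat (card (weyl_group B R)))
       (map_poly of_int (galg_coeff (f * galg_bar g * (\<Prod>\<alpha>\<in>R. 1 - galg_monom \<alpha> 1)) 0))"

text \<open>
  The form with parameter \<open>t\<close> is computed in the power series ring over the integral
  group algebra, into which the group algebra over \<open>\<int>[t]\<close> embeds by collecting
  powers of \<open>t\<close>.
\<close>

definition galg_to_fps :: "('a::comm_monoid_add, int poly) galg \<Rightarrow> ('a, int) galg fps" where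
  "galg_to_fps f =
     Abs_fps (\<lambda>n. \<Sum>\<mu>\<in>galg_supp f. galg_monom \<mu> (coeff (galg_coeff f \<mu>) n))"

definition geometric_fps :: "'a::real_vector \<Rightarrow> ('a, int) galg fps" where
  "geometric_fps \<alpha> = Abs_fps (\<lambda>k. galg_monom (real k *\<^sub>R \<alpha>) 1)"

definition form_t :: "('a::real_vector \<Rightarrow> 'a \<Rightarrow> real) \<Rightarrow> 'a set \<Rightarrow>
    ('a, int poly) galg \<Rightarrow> ('a, int poly) galg \<Rightarrow> rat fps" where
  "form_t B R f g =
     fps_const (1 / of_nat (card (weyl_group B R))) *
     Abs_fps (\<lambda>n. of_int (galg_coeff
       (fps_nth (galg_to_fps (f * galg_bar g) *
                 (\<Prod>\<alpha>\<in>R. fps_const (1 - galg_monom \<alpha> 1) * geometric_fps \<alpha>)) n) 0))"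


subsection \<open>Monomial symmetric functions, Weyl characters, Macdonald spherical functions\<close>

definition orbit_sum ::
    "('a::real_vector \<Rightarrow> 'a \<Rightarrow> real) \<Rightarrow> 'a set \<Rightarrow> 'a \<Rightarrow> ('a, int poly) galg" where
  "orbit_sum B R \<mu> = (\<Sum>\<gamma>\<in>(\<lambda>w. w \<mu>) ` weyl_group B R. galg_monom \<gamma> 1)"

definition alternating_sum ::
    "('a::real_vector \<Rightarrow> 'a \<Rightarrow> real) \<Rightarrow> 'a set \<Rightarrow> 'a set \<Rightarrow> 'a \<Rightarrow> ('a, int poly) galg" where
  "alternating_sum B R Rp \<mu> =
     (\<Sum>w\<in>weyl_group B R. (- 1) ^ weyl_length B Rp w * galg_monom (w \<mu>) 1)"

definition weyl_character ::
    "('a::real_vector \<Rightarrow> 'a \<Rightarrow> real) \<Rightarrow> 'a set \<Rightarrow> 'a set \<Rightarrow> 'a \<Rightarrow> ('a, int poly) galg" where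
  "weyl_character B R Rp lam =
     integral_fract (weight_lattice B R)
       (to_fract (alternating_sum B R Rp (lam + rho Rp)) /
        to_fract (alternating_sum B R Rp (rho Rp)))"

definition macdonald_spherical ::
    "('a::real_vector \<Rightarrow> 'a \<Rightarrow> real) \<Rightarrow> 'a set \<Rightarrow> 'a set \<Rightarrow> 'a \<Rightarrow> ('a, int poly) galg" where
  "macdonald_spherical B R Rp lam =
     integral_fract (weight_lattice B R)
       (1 / to_fract (galg_const (stabilizer_poly B R Rp lam)) *
        (\<Sum>w\<in>weyl_group B R. fract_map_exp w
          (to_fract (galg_monom lam 1) *
           (\<Prod>\<alpha>\<in>Rp. to_fract (1 - galg_monom (- \<alpha>) t_poly) /
                     to_fract (1 - galg_monom (- \<alpha>) 1)))))"

end

theory Submission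
  imports Defs
begin

text \<open>
  Expanding \<open>\<Sum>\<^sub>w sgn(w) w(x\<^sup>\<rho> \<Prod> (1 - t x\<^sup>-\<^sup>\<alpha>))\<close> only produces exponents of
  the form \<open>\<rho> - \<Sum>S\<close> with \<open>S\<close> a set of positive roots, and the only strictly dominant one among them
  is \<open>\<rho>\<close> itself. As an antisymmetric element is determined by its strictly dominant coefficients,
  this yields the Weyl denominator formula and Macdonald's formula for \<open>W(t)\<close>. Applied to the root
  system of the stabilizer of \<open>\<lambda>\<close>, the latter shows that \<open>W\<^sub>\<lambda>(t)\<close> can be divided out; together with
  the divisibility of antisymmetric elements by \<open>a\<^sub>\<rho>\<close> it places \<open>P\<^sub>\<lambda>\<close> in the group algebra.

  For \<open>s\<^sub>\<lambda>\<close> the weight function is \<open>a\<^sub>\<rho>\<close> times its conjugate, so orthogonality is that of the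
  \<open>a\<^sub>\<lambda>\<^sub>+\<^sub>\<rho>\<close>. For \<open>P\<^sub>\<lambda>\<close> one expands only the first argument by its definition. The weight function
  and the second argument being invariant, all \<open>w\<close> contribute equally, and what remains is the
  constant term of a product whose exponents all lie in \<open>\<mu> - \<lambda>\<close> minus the cone of positive roots:
  it is \<open>0\<close> unless \<open>\<lambda> \<le> \<mu>\<close>, and is read off the leading coefficient if \<open>\<lambda> = \<mu>\<close>. The symmetry of the form does
  the rest.
\<close>

subsection \<open>Arithmetic in group algebras\<close>

text \<open>Two obstacles shape the development. Both \<open>s_\<lambda>\<close> and
  \<open>P_\<lambda>\<close> are defined as THE element of the group algebra equal to a fraction, so
  nothing is known about them until a quotient is exhibited; every fact comes from an identity in
  which \<open>a_\<rho>\<close> and \<open>W_\<lambda>(t)\<close> have been cleared. Averaging also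
  brings in the factors |W| and |W_\<lambda>|, not invertible in \<int>[t] in general; they are
  cancelled, the group algebra being a domain of characteristic 0. That
  \<open>\<rho> - \<Sum>S\<close> is strictly dominant only for empty S rests on definiteness:
  integrality makes \<open>- \<Sum>S\<close> dominant, and pairing it with \<open>\<Sum>S\<close>
  bounds the norm of \<open>\<Sum>S\<close> by 0. The given form may fail to be positive definite,
  so the theory is developed for a positive definite one and transferred at the end. The product in
  \<open>P_\<lambda>\<close> cancels half of the series \<open>1 / (1 - t x^\<alpha>)\<close> in the
  weight function, and the other half has exponents on one side only. Hence leading terms decide the
  constant term.\<close>

lemma galg_eqI: "(\<And>\<mu>. galg_coeff f \<mu> = galg_coeff g \<mu>) \<Longrightarrow> f = g"
  by (transfer; rule poly_mapping_eqI)

lemma finite_galg_supp [simp]: "finite (galg_supp f)"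
  by transfer simp

lemma in_galg_supp: "\<mu> \<in> galg_supp f \<longleftrightarrow> galg_coeff f \<mu> \<noteq> 0"
  by transfer (simp add: in_keys_iff)

lemma galg_coeff_arith [simp]:
  fixes f g :: "('a::comm_monoid_add, 'k::comm_ring_1) galg"
  shows "galg_coeff (f + g) \<mu> = galg_coeff f \<mu> + galg_coeff g \<mu>"
    "galg_coeff (f - g) \<mu> = galg_coeff f \<mu> - galg_coeff g \<mu>"
    "galg_coeff (- f) \<mu> = - galg_coeff f \<mu>"
    "galg_coeff (0 :: ('a, 'k) galg) \<mu> = 0"
  by (transfer; simp add: lookup_add lookup_minus)+

lemma galg_coeff_sum [simp]:
  fixes f :: "'i \<Rightarrow> ('a::comm_monoid_add, 'k::comm_ring_1) galg"
  shows "galg_coeff (sum f A) \<mu> = (\<Sum>i\<in>A. galg_coeff (f i) \<mu>)"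
  by (induction A rule: infinite_finite_induct) auto

lemma galg_coeff_monom: "galg_coeff (galg_monom a c) \<mu> = (if \<mu> = a then c else 0)"
  by transfer (auto simp: lookup_single when_def)

lemma galg_monom_mult:
  fixes c d :: "'k::comm_ring_1"
  shows "galg_monom a c * galg_monom b d = galg_monom (a + b) (c * d)"
  by transfer (rule Poly_Mapping.mult_single)

lemma galg_one: "(1 :: ('a::comm_monoid_add, 'k::comm_ring_1) galg) = galg_monom 0 1"
  by transfer (rule single_one[symmetric])

lemma galg_coeff_one:
  "galg_coeff (1 :: ('a::comm_monoid_add, 'k::comm_ring_1) galg) \<mu> = (if \<mu> = 0 then 1 else 0)"
  by (simp add: galg_one galg_coeff_monom)

lemma galg_monom_0 [simp]: "galg_monom a (0 :: 'k::comm_ring_1) = (0 :: ('a::comm_monoid_add, 'k) galg)"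
  by (rule galg_eqI) (simp add: galg_coeff_monom)

lemma galg_monom_add:
  "galg_monom a (c + d) = (galg_monom a c + galg_monom a d :: ('a::comm_monoid_add, 'k::comm_ring_1) galg)"
  by (rule galg_eqI) (simp add: galg_coeff_monom)

lemma galg_monom_uminus:
  "galg_monom a (- c) = (- galg_monom a c :: ('a::comm_monoid_add, 'k::comm_ring_1) galg)"
  by (rule galg_eqI) (simp add: galg_coeff_monom)

lemma galg_monom_prod:
  "finite A \<Longrightarrow> (\<Prod>i\<in>A. galg_monom (a i) (c i :: 'k::comm_ring_1)) = galg_monom (\<Sum>i\<in>A. a i) (\<Prod>i\<in>A. c i)"
  by (induction A rule: finite_induct) (simp_all add: galg_one galg_monom_mult)

lemma galg_decomp:
  fixes f :: "('a::comm_monoid_add, 'k::comm_ring_1) galg"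
  assumes "finite A" "galg_supp f \<subseteq> A"
  shows "f = (\<Sum>\<mu>\<in>A. galg_monom \<mu> (galg_coeff f \<mu>))"
proof (rule galg_eqI)
  fix \<nu>
  have "galg_coeff f \<nu> = (if \<nu> \<in> A then galg_coeff f \<nu> else 0)"
    using assms in_galg_supp[of \<nu> f] by auto
  then show "galg_coeff f \<nu> = galg_coeff (\<Sum>\<mu>\<in>A. galg_monom \<mu> (galg_coeff f \<mu>)) \<nu>"
    using assms(1) by (simp add: galg_coeff_monom)
qed

lemma galg_coeff_monom_mult:
  fixes f :: "('a::ab_group_add, 'k::comm_ring_1) galg"
  shows "galg_coeff (galg_monom a c * f) \<nu> = c * galg_coeff f (\<nu> - a)"
proof -
  have "galg_monom a c * f = (\<Sum>\<mu>\<in>galg_supp f. galg_monom (a + \<mu>) (c * galg_coeff f \<mu>))"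
    by (subst galg_decomp[of "galg_supp f" f]) (simp_all add: sum_distrib_left galg_monom_mult)
  also have "galg_coeff \<dots> \<nu> =
      (\<Sum>\<mu>\<in>galg_supp f. if \<mu> = \<nu> - a then c * galg_coeff f (\<nu> - a) else 0)"
    unfolding galg_coeff_sum by (rule sum.cong) (auto simp: galg_coeff_monom algebra_simps)
  also have "\<dots> = c * galg_coeff f (\<nu> - a)"
    by (simp add: in_galg_supp)
  finally show ?thesis .
qed

lemma galg_coeff_mult:
  fixes f g :: "('a::ab_group_add, 'k::comm_ring_1) galg"
  shows "galg_coeff (f * g) \<nu> = (\<Sum>\<mu>\<in>galg_supp f. galg_coeff f \<mu> * galg_coeff g (\<nu> - \<mu>))"
proof -
  have "f * g = (\<Sum>\<mu>\<in>galg_supp f. galg_monom \<mu> (galg_coeff f \<mu>) * g)"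
    by (subst galg_decomp[of "galg_supp f" f]) (simp_all add: sum_distrib_right)
  then show ?thesis by (simp add: galg_coeff_monom_mult)
qed

lemma galg_supp_mult:
  fixes f g :: "('a::ab_group_add, 'k::comm_ring_1) galg"
  assumes "galg_coeff (f * g) \<nu> \<noteq> 0"
  obtains \<mu> where "galg_coeff f \<mu> \<noteq> 0" "galg_coeff g (\<nu> - \<mu>) \<noteq> 0"
proof -
  obtain \<mu> where "galg_coeff f \<mu> * galg_coeff g (\<nu> - \<mu>) \<noteq> 0"
    using assms unfolding galg_coeff_mult by (meson sum.not_neutral_contains_not_neutral)
  then show ?thesis by (metis mult_zero_left mult_zero_right that)
qed

lemma galg_coeff_const_mult:
  fixes f :: "('a::ab_group_add, 'k::comm_ring_1) galg"
  shows "galg_coeff (galg_const c * f) \<nu> = c * galg_coeff f \<nu>"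
  by (simp add: galg_const_def galg_coeff_monom_mult)

lemma galg_const_hom:
  fixes a b :: "'k::comm_ring_1"
  shows "galg_const (a + b) = (galg_const a + galg_const b :: ('a::ab_group_add, 'k) galg)"
    "galg_const (a * b) = (galg_const a * galg_const b :: ('a, 'k) galg)"
    "galg_const (- a) = (- galg_const a :: ('a, 'k) galg)"
    "galg_const 1 = (1 :: ('a, 'k) galg)" "galg_const 0 = (0 :: ('a, 'k) galg)"
  by (simp_all add: galg_const_def galg_monom_add galg_monom_mult galg_monom_uminus galg_one)

lemma galg_const_of_nat: "galg_const (of_nat n) = (of_nat n :: ('a::ab_group_add, 'k::comm_ring_1) galg)"
  by (induction n) (simp_all add: galg_const_hom)

lemma galg_const_eq_0: "galg_const c = (0 :: ('a::ab_group_add, 'k::comm_ring_1) galg) \<longleftrightarrow> c = 0"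
proof
  assume "galg_const c = (0 :: ('a, 'k) galg)"
  then have "galg_coeff (galg_const c :: ('a, 'k) galg) 0 = 0" by simp
  then show "c = 0" by (simp add: galg_const_def galg_coeff_monom)
qed (simp add: galg_const_hom)

lemma galg_coeff_sign:
  fixes f :: "('a::ab_group_add, 'k::comm_ring_1) galg"
  shows "galg_coeff ((- 1) ^ n * f) \<nu> = (- 1) ^ n * galg_coeff f \<nu>"
  by (induction n) auto

text \<open>Constants embed injectively and the group algebra is a domain. This replaces division by
  group orders, which the coefficient ring does not allow.\<close>

lemma galg_of_nat_mult_eq_0:
  fixes f :: "('a::real_vector, 'k::{idom, ring_char_0}) galg"
  assumes "of_nat n * f = 0" "n \<noteq> 0" shows "f = 0"
proof -
  have "(of_nat n :: ('a, 'k) galg) \<noteq> 0"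
    using assms(2) by (simp add: galg_const_of_nat[symmetric] galg_const_eq_0)
  then show ?thesis using assms(1) by simp
qed

text \<open>Source of all exponents of the form \<open>- \<Sum>S\<close>. Both coefficients depend
  on the root because applying \<open>w\<close> interchanges them at the roots whose sign it
  changes.\<close>

lemma galg_prod_binomial:
  fixes u v :: "'a::ab_group_add \<Rightarrow> 'k::comm_ring_1"
  assumes "finite A"
  shows "(\<Prod>\<beta>\<in>A. galg_monom 0 (u \<beta>) + galg_monom (- \<beta>) (v \<beta>)) =
    (\<Sum>S\<in>Pow A. galg_monom (- \<Sum>S) ((\<Prod>\<beta>\<in>A - S. u \<beta>) * (\<Prod>\<beta>\<in>S. v \<beta>)))"
proof -
  have "(\<Prod>\<beta>\<in>A. galg_monom 0 (u \<beta>) + galg_monom (- \<beta>) (v \<beta>)) =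
      (\<Prod>\<beta>\<in>A. galg_monom (- \<beta>) (v \<beta>) + galg_monom 0 (u \<beta>))"
    by (simp add: add.commute)
  also have "\<dots> = (\<Sum>S\<in>Pow A. (\<Prod>\<beta>\<in>S. galg_monom (- \<beta>) (v \<beta>)) * (\<Prod>\<beta>\<in>A - S. galg_monom 0 (u \<beta>)))"
    by (rule prod_add[OF assms])
  also have "\<dots> = (\<Sum>S\<in>Pow A. galg_monom (- \<Sum>S) ((\<Prod>\<beta>\<in>A - S. u \<beta>) * (\<Prod>\<beta>\<in>S. v \<beta>)))"
  proof (rule sum.cong[OF refl])
    fix S assume "S \<in> Pow A"
    then have "finite S" "finite (A - S)" using assms finite_subset by auto
    then show "(\<Prod>\<beta>\<in>S. galg_monom (- \<beta>) (v \<beta>)) * (\<Prod>\<beta>\<in>A - S. galg_monom 0 (u \<beta>)) =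
        galg_monom (- \<Sum>S) ((\<Prod>\<beta>\<in>A - S. u \<beta>) * (\<Prod>\<beta>\<in>S. v \<beta>))"
      by (simp add: galg_monom_prod galg_monom_mult sum_negf mult.commute)
  qed
  finally show ?thesis .
qed


subsection \<open>Substitutions in the exponents\<close>

lemma galg_map_exp_superset:
  fixes f :: "('a::comm_monoid_add, 'k::comm_ring_1) galg"
  assumes "finite A" "galg_supp f \<subseteq> A"
  shows "galg_map_exp w f = (\<Sum>\<mu>\<in>A. galg_monom (w \<mu>) (galg_coeff f \<mu>))"
  unfolding galg_map_exp_def using assms
  by (intro sum.mono_neutral_left) (auto simp: in_galg_supp)

lemma galg_map_exp_monom:
  "galg_map_exp w (galg_monom a c) = (galg_monom (w a) c :: ('a::comm_monoid_add, 'k::comm_ring_1) galg)"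
  by (subst galg_map_exp_superset[of "{a}"]) (auto simp: in_galg_supp galg_coeff_monom split: if_splits)

lemma galg_map_exp_add:
  fixes f g :: "('a::comm_monoid_add, 'k::comm_ring_1) galg"
  shows "galg_map_exp w (f + g) = galg_map_exp w f + galg_map_exp w g"
proof -
  let ?A = "galg_supp f \<union> galg_supp g"
  have "galg_supp (f + g) \<subseteq> ?A" by (auto simp: in_galg_supp)
  then show ?thesis
    by (simp add: galg_map_exp_superset[of ?A] galg_monom_add sum.distrib)
qed

lemma galg_map_exp_0 [simp]: "galg_map_exp w (0 :: ('a::comm_monoid_add, 'k::comm_ring_1) galg) = 0"
  by (subst galg_map_exp_superset[of "{}"]) (auto simp: in_galg_supp)

lemma galg_map_exp_uminus:
  fixes f :: "('a::comm_monoid_add, 'k::comm_ring_1) galg"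
  shows "galg_map_exp w (- f) = - galg_map_exp w f"
  using galg_map_exp_add[of w f "- f"] by (simp add: eq_neg_iff_add_eq_0 add.commute)

lemma galg_map_exp_diff:
  fixes f :: "('a::comm_monoid_add, 'k::comm_ring_1) galg"
  shows "galg_map_exp w (f - g) = galg_map_exp w f - galg_map_exp w g"
  using galg_map_exp_add[of w f "- g"] by (simp add: galg_map_exp_uminus)

lemma galg_map_exp_sum:
  fixes f :: "'i \<Rightarrow> ('a::comm_monoid_add, 'k::comm_ring_1) galg"
  shows "galg_map_exp w (sum f A) = (\<Sum>i\<in>A. galg_map_exp w (f i))"
  by (induction A rule: infinite_finite_induct) (auto simp: galg_map_exp_add)

lemma galg_map_exp_mult:
  fixes f g :: "('a::comm_monoid_add, 'k::comm_ring_1) galg"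
  assumes "\<And>x y. w (x + y) = w x + w y"
  shows "galg_map_exp w (f * g) = galg_map_exp w f * galg_map_exp w g"
proof -
  let ?m = "\<lambda>f \<mu>. galg_monom \<mu> (galg_coeff f \<mu>) :: ('a, 'k) galg"
  have "galg_map_exp w (f * g) = galg_map_exp w ((\<Sum>\<mu>\<in>galg_supp f. ?m f \<mu>) * (\<Sum>\<nu>\<in>galg_supp g. ?m g \<nu>))"
    using galg_decomp[of "galg_supp f" f] galg_decomp[of "galg_supp g" g] by simp
  also have "\<dots> = (\<Sum>\<mu>\<in>galg_supp f. \<Sum>\<nu>\<in>galg_supp g.
      galg_monom (w \<mu>) (galg_coeff f \<mu>) * galg_monom (w \<nu>) (galg_coeff g \<nu>))"
    by (simp add: sum_product galg_map_exp_sum galg_monom_mult galg_map_exp_monom assms)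
  also have "\<dots> = galg_map_exp w f * galg_map_exp w g"
    by (simp add: galg_map_exp_def sum_product)
  finally show ?thesis .
qed

lemma galg_map_exp_prod:
  fixes f :: "'i \<Rightarrow> ('a::comm_monoid_add, 'k::comm_ring_1) galg"
  assumes "\<And>x y. w (x + y) = w x + w y" "w 0 = 0"
  shows "galg_map_exp w (prod f A) = (\<Prod>i\<in>A. galg_map_exp w (f i))"
  by (induction A rule: infinite_finite_induct)
    (auto simp: galg_map_exp_mult[OF assms(1)] galg_one galg_map_exp_monom assms(2))

lemma galg_map_exp_one:
  "w 0 = 0 \<Longrightarrow> galg_map_exp w (1 :: ('a::comm_monoid_add, 'k::comm_ring_1) galg) = 1"
  by (simp add: galg_one galg_map_exp_monom)

lemma galg_map_exp_const:
  "w 0 = 0 \<Longrightarrow> galg_map_exp w (galg_const c :: ('a::comm_monoid_add, 'k::comm_ring_1) galg) = galg_const c"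
  by (simp add: galg_const_def galg_map_exp_monom)

lemma galg_coeff_map_exp:
  fixes f :: "('a::comm_monoid_add, 'k::comm_ring_1) galg"
  assumes "inj w"
  shows "galg_coeff (galg_map_exp w f) (w \<mu>) = galg_coeff f \<mu>"
proof -
  have "galg_coeff (galg_map_exp w f) (w \<mu>) = (\<Sum>\<nu>\<in>galg_supp f. if \<nu> = \<mu> then galg_coeff f \<mu> else 0)"
    using inj_eq[OF assms] by (auto simp: galg_map_exp_def galg_coeff_monom intro!: sum.cong)
  then show ?thesis by (simp add: in_galg_supp)
qed

lemma galg_map_exp_comp:
  fixes f :: "('a::comm_monoid_add, 'k::comm_ring_1) galg"
  shows "galg_map_exp u (galg_map_exp w f) = galg_map_exp (u \<circ> w) f"
  unfolding galg_map_exp_def[of w] by (simp add: galg_map_exp_sum galg_map_exp_monom galg_map_exp_def[of "u \<circ> w"])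

lemma galg_map_exp_id: "galg_map_exp id f = (f :: ('a::comm_monoid_add, 'k::comm_ring_1) galg)"
  using galg_decomp[of "galg_supp f" f] by (simp add: galg_map_exp_def)

lemma galg_map_exp_eq_0:
  fixes f :: "('a::comm_monoid_add, 'k::comm_ring_1) galg"
  assumes "inj w" "galg_map_exp w f = 0" shows "f = 0"
  using galg_coeff_map_exp[OF assms(1), of f] assms(2) by (intro galg_eqI) simp

section \<open>Elements with exponents in a given set\<close>

lemma galg_on_iff: "f \<in> galg_on L \<longleftrightarrow> (\<forall>\<mu>. galg_coeff f \<mu> \<noteq> 0 \<longrightarrow> \<mu> \<in> L)"
  by (auto simp: galg_on_def in_galg_supp)


lemma galg_on_add: "f \<in> galg_on L \<Longrightarrow> g \<in> galg_on L \<Longrightarrow> f + g \<in> galg_on L"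
  for f g :: "('a::ab_group_add, 'k::comm_ring_1) galg"
  unfolding galg_on_iff by (metis add_0 galg_coeff_arith(1))

lemma galg_on_diff: "f \<in> galg_on L \<Longrightarrow> g \<in> galg_on L \<Longrightarrow> f - g \<in> galg_on L"
  for f g :: "('a::ab_group_add, 'k::comm_ring_1) galg"
  unfolding galg_on_iff by (metis diff_0_right galg_coeff_arith(2))

lemma galg_on_const_mult: "f \<in> galg_on L \<Longrightarrow> galg_const c * f \<in> galg_on L"
  for f :: "('a::ab_group_add, 'k::comm_ring_1) galg"
  unfolding galg_on_iff by (metis galg_coeff_const_mult mult_zero_right)

lemma galg_on_monom: "a \<in> L \<Longrightarrow> galg_monom a c \<in> galg_on L"
  by (simp add: galg_on_iff galg_coeff_monom)

lemma galg_on_0: "(0 :: ('a::ab_group_add, 'k::comm_ring_1) galg) \<in> galg_on L"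
  by (simp add: galg_on_iff)

lemma galg_on_sum:
  fixes f :: "'i \<Rightarrow> ('a::ab_group_add, 'k::comm_ring_1) galg"
  shows "(\<And>i. i \<in> A \<Longrightarrow> f i \<in> galg_on L) \<Longrightarrow> sum f A \<in> galg_on L"
  by (induction A rule: infinite_finite_induct) (auto intro: galg_on_0 galg_on_add)

lemma galg_on_mult:
  fixes f g :: "('a::ab_group_add, 'k::comm_ring_1) galg"
  assumes "\<And>x y. x \<in> L \<Longrightarrow> y \<in> L \<Longrightarrow> x + y \<in> L" "f \<in> galg_on L" "g \<in> galg_on L"
  shows "f * g \<in> galg_on L"
  unfolding galg_on_iff
proof (intro allI impI)
  fix \<nu> assume "galg_coeff (f * g) \<nu> \<noteq> 0"
  then obtain \<mu> where "galg_coeff f \<mu> \<noteq> 0" "galg_coeff g (\<nu> - \<mu>) \<noteq> 0" by (rule galg_supp_mult)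
  then have "\<mu> + (\<nu> - \<mu>) \<in> L" using assms unfolding galg_on_iff by blast
  then show "\<nu> \<in> L" by simp
qed

lemma galg_on_prod:
  fixes f :: "'i \<Rightarrow> ('a::ab_group_add, 'k::comm_ring_1) galg"
  assumes "0 \<in> L" "\<And>x y. x \<in> L \<Longrightarrow> y \<in> L \<Longrightarrow> x + y \<in> L" "\<And>i. i \<in> A \<Longrightarrow> f i \<in> galg_on L"
  shows "prod f A \<in> galg_on L"
  using assms(3)
  by (induction A rule: infinite_finite_induct)
    (auto simp: galg_one intro: galg_on_monom[OF assms(1)] galg_on_mult[OF assms(2)])

text \<open>At \<open>c = t_poly\<close> this is the numerator in the spherical function; at
  \<open>c = 1\<close> it is the Weyl denominator up to the factor \<open>x^\<rho>\<close>.\<close>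

definition euler_prod :: "'a set \<Rightarrow> int poly \<Rightarrow> ('a::real_vector, int poly) galg" where
  "euler_prod A c = (\<Prod>\<beta>\<in>A. 1 - galg_monom (- \<beta>) c)"


subsection \<open>Quotients in the group algebra\<close>

text \<open>The definite description is independent of the representing pair: a ring endomorphism
  preserves cross-multiplied equations, and injectivity of \<open>w\<close> keeps denominators
  nonzero.\<close>

lemma fract_map_exp_Fract:
  fixes a b :: "('a::real_vector, 'k::idom) galg"
  assumes w: "\<And>x y. w (x + y) = w x + w y" "inj w" and b: "b \<noteq> 0"
  shows "fract_map_exp w (Fract a b) = Fract (galg_map_exp w a) (galg_map_exp w b)"
  unfolding fract_map_exp_def
proof (rule the_equality)
  show "\<exists>c d. d \<noteq> 0 \<and> Fract a b = Fract c d \<and>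
      Fract (galg_map_exp w a) (galg_map_exp w b) = Fract (galg_map_exp w c) (galg_map_exp w d)"
    using b by blast
next
  fix r assume "\<exists>c d. d \<noteq> 0 \<and> Fract a b = Fract c d \<and> r = Fract (galg_map_exp w c) (galg_map_exp w d)"
  then obtain c d where cd: "d \<noteq> 0" "Fract a b = Fract c d"
    "r = Fract (galg_map_exp w c) (galg_map_exp w d)" by blast
  then have "galg_map_exp w (a * d) = galg_map_exp w (c * b)" using b by (simp add: eq_fract)
  then have "galg_map_exp w a * galg_map_exp w d = galg_map_exp w c * galg_map_exp w b"
    by (simp add: galg_map_exp_mult[OF w(1)])
  moreover have "galg_map_exp w b \<noteq> 0" "galg_map_exp w d \<noteq> 0"
    using galg_map_exp_eq_0[OF w(2)] b cd by blast+
  ultimately show "r = Fract (galg_map_exp w a) (galg_map_exp w b)"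
    using cd by (simp add: eq_fract)
qed

lemma fract_map_exp_divide:
  fixes a b :: "('a::real_vector, 'k::idom) galg"
  assumes "\<And>x y. w (x + y) = w x + w y" "inj w" "b \<noteq> 0"
  shows "fract_map_exp w (to_fract a / to_fract b) =
    to_fract (galg_map_exp w a) / to_fract (galg_map_exp w b)"
  using fract_map_exp_Fract[OF assms] by (simp add: to_fract_def)

text \<open>Uniqueness is injectivity of \<open>to_fract\<close>; existence has to be supplied as
  the quotient \<open>f\<close>, which is what the divisibility results are for.\<close>

lemma integral_fract_eqI:
  assumes "f \<in> galg_on L" "to_fract f * to_fract d = to_fract g" "d \<noteq> 0"
  shows "integral_fract L (to_fract g / to_fract d) = f"
  unfolding integral_fract_def
proof (rule the_equality)
  have q: "to_fract f = to_fract g / to_fract d" using assms(2,3) by (simp add: field_simps)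
  then show "f \<in> galg_on L \<and> to_fract f = to_fract g / to_fract d" using assms(1) by simp
  show "e = f" if "e \<in> galg_on L \<and> to_fract e = to_fract g / to_fract d" for e
    using that q by (metis to_fract_eq_iff)
qed

lemma to_fract_sum: "to_fract (sum f A) = (\<Sum>i\<in>A. to_fract (f i))"
  by (induction A rule: infinite_finite_induct) auto

lemma to_fract_prod: "to_fract (prod f A) = (\<Prod>i\<in>A. to_fract (f i))"
  by (induction A rule: infinite_finite_induct) auto


subsection \<open>Roots\<close>

text \<open>The roots need not span the space, so that the locale also applies to the roots
  orthogonal to a given vector. The functional \<open>h\<close> selects the positive roots.\<close>

locale euclidean_root_system =
  fixes B :: "'a::real_vector \<Rightarrow> 'a \<Rightarrow> real" and R :: "'a set" and h :: "'a \<Rightarrow> real"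
  assumes bilinear: "bilinear B"
    and sym: "B x y = B y x"
    and pos: "x \<noteq> 0 \<Longrightarrow> B x x > 0"
    and finite_R: "finite R"
    and zero_notin_R: "0 \<notin> R"
    and refl_closed: "\<alpha> \<in> R \<Longrightarrow> \<beta> \<in> R \<Longrightarrow> reflection B \<alpha> \<beta> \<in> R"
    and integral: "\<alpha> \<in> R \<Longrightarrow> \<beta> \<in> R \<Longrightarrow> B \<beta> (coroot B \<alpha>) \<in> \<int>"
    and reduced: "reduced_roots R"
    and lin_h: "linear h"
    and h_nonzero: "\<alpha> \<in> R \<Longrightarrow> h \<alpha> \<noteq> 0"
begin

abbreviation "W \<equiv> weyl_group B R"

definition Rp :: "'a set" where "Rp = {\<alpha>\<in>R. h \<alpha> > 0}"

abbreviation "pair x \<alpha> \<equiv> B x (coroot B \<alpha>)"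

abbreviation "rf \<equiv> reflection B"

lemmas B_simps = bilinear_ladd[OF bilinear] bilinear_radd[OF bilinear]
  bilinear_lsub[OF bilinear] bilinear_rsub[OF bilinear]
  bilinear_lmul[OF bilinear] bilinear_rmul[OF bilinear]
  bilinear_lzero[OF bilinear] bilinear_rzero[OF bilinear]
  bilinear_lneg[OF bilinear] bilinear_rneg[OF bilinear]

lemmas h_simps = linear_add[OF lin_h] linear_diff[OF lin_h] linear_scale[OF lin_h]
  linear_0[OF lin_h] linear_neg[OF lin_h]

lemma linear_B: "linear (\<lambda>x. B x y)"
  using bilinear by (simp add: bilinear_def)

lemma B_sum_left: "B (sum f A) y = (\<Sum>a\<in>A. B (f a) y)"
  using linear_sum[OF linear_B] by simp

lemma h_sum: "h (sum f A) = (\<Sum>a\<in>A. h (f a))"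
  using linear_sum[OF lin_h] by simp

lemma root_nonzero: "\<alpha> \<in> R \<Longrightarrow> \<alpha> \<noteq> 0"
  using zero_notin_R by auto

lemma root_norm_pos: "\<alpha> \<in> R \<Longrightarrow> B \<alpha> \<alpha> > 0"
  using pos root_nonzero by auto

lemma pair_eq: "pair x \<alpha> = 2 * B x \<alpha> / B \<alpha> \<alpha>"
  by (simp add: coroot_def B_simps)

lemma pair_self: "\<alpha> \<in> R \<Longrightarrow> pair \<alpha> \<alpha> = 2"
  using root_norm_pos[of \<alpha>] by (simp add: pair_eq)

lemma pair_simps:
  "pair (x + y) \<alpha> = pair x \<alpha> + pair y \<alpha>" "pair (x - y) \<alpha> = pair x \<alpha> - pair y \<alpha>"
  "pair (- x) \<alpha> = - pair x \<alpha>" "pair (c *\<^sub>R x) \<alpha> = c * pair x \<alpha>" "pair 0 \<alpha> = 0"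
  by (simp_all add: B_simps)

lemma pair_uminus_right: "pair x (- \<alpha>) = - pair x \<alpha>"
  by (simp add: pair_eq B_simps)

lemma pair_sum: "pair (sum f A) \<alpha> = (\<Sum>a\<in>A. pair (f a) \<alpha>)"
  by (rule B_sum_left)

lemma pair_pos_iff: "\<alpha> \<in> R \<Longrightarrow> pair x \<alpha> > 0 \<longleftrightarrow> B x \<alpha> > 0"
  and pair_nonneg_iff: "\<alpha> \<in> R \<Longrightarrow> pair x \<alpha> \<ge> 0 \<longleftrightarrow> B x \<alpha> \<ge> 0"
  and pair_eq_0_iff: "\<alpha> \<in> R \<Longrightarrow> pair x \<alpha> = 0 \<longleftrightarrow> B x \<alpha> = 0"
  using root_norm_pos[of \<alpha>]
  by (auto simp: pair_eq zero_less_divide_iff zero_le_divide_iff)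

lemma refl_self: "\<alpha> \<in> R \<Longrightarrow> rf \<alpha> \<alpha> = - \<alpha>"
  using pair_self[of \<alpha>] by (simp add: reflection_def scaleR_2)

lemma linear_refl: "linear (rf \<alpha>)"
  by (auto simp: linear_iff reflection_def pair_simps algebra_simps)

lemma refl_refl: "\<alpha> \<in> R \<Longrightarrow> rf \<alpha> (rf \<alpha> x) = x"
  using pair_self[of \<alpha>] by (simp add: reflection_def pair_simps algebra_simps flip: scaleR_2)

lemma refl_isometry: "\<alpha> \<in> R \<Longrightarrow> B (rf \<alpha> x) (rf \<alpha> y) = B x y"
  using root_norm_pos[of \<alpha>]
  by (simp add: reflection_def B_simps pair_eq sym[of \<alpha> y] sym[of \<alpha> x] field_simps)

lemma uminus_R: "\<alpha> \<in> R \<Longrightarrow> - \<alpha> \<in> R"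
  using refl_closed[of \<alpha> \<alpha>] refl_self[of \<alpha>] by simp

lemma uminus_R_iff: "- \<alpha> \<in> R \<longleftrightarrow> \<alpha> \<in> R"
  using uminus_R[of \<alpha>] uminus_R[of "- \<alpha>"] by auto

lemma Rp_subset: "Rp \<subseteq> R"
  by (auto simp: Rp_def)

lemma finite_Rp: "finite Rp"
  using finite_R Rp_subset finite_subset by blast

lemma Rp_pos: "\<alpha> \<in> Rp \<Longrightarrow> h \<alpha> > 0"
  by (simp add: Rp_def)

lemma Rp_R: "\<alpha> \<in> Rp \<Longrightarrow> \<alpha> \<in> R"
  by (simp add: Rp_def)

lemma uminus_in_Rp: "\<alpha> \<in> R \<Longrightarrow> - \<alpha> \<in> Rp \<longleftrightarrow> \<alpha> \<notin> Rp"
  using h_nonzero[of \<alpha>] by (auto simp: Rp_def h_simps uminus_R_iff)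

lemma Rp_cases:
  assumes "\<alpha> \<in> R" obtains "\<alpha> \<in> Rp" "- \<alpha> \<notin> Rp" | "- \<alpha> \<in> Rp" "\<alpha> \<notin> Rp"
  using uminus_in_Rp[OF assms] by blast

lemma Rp_disjoint_uminus: "Rp \<inter> uminus ` Rp = {}"
  by (auto simp: Rp_def h_simps)

lemma R_eq_Rp_Un: "R = Rp \<union> uminus ` Rp"
proof
  show "R \<subseteq> Rp \<union> uminus ` Rp"
  proof
    fix \<alpha> assume a: "\<alpha> \<in> R"
    then show "\<alpha> \<in> Rp \<union> uminus ` Rp"
      by (rule Rp_cases) (auto intro: image_eqI[of _ _ "- \<alpha>"])
  qed
  show "Rp \<union> uminus ` Rp \<subseteq> R" using Rp_R uminus_R by auto
qed


subsection \<open>The Weyl group\<close>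

lemma refl_in_W: "\<alpha> \<in> R \<Longrightarrow> rf \<alpha> \<in> W"
  using weyl_refl[OF weyl_id, of \<alpha> R B] by simp

lemma id_in_W: "id \<in> W"
  by (rule weyl_id)

lemma comp_in_W: "u \<in> W \<Longrightarrow> w \<in> W \<Longrightarrow> u \<circ> w \<in> W"
  by (induction rule: weyl_group.induct) (auto simp: o_assoc[symmetric] intro: weyl_group.intros)

lemma linear_W: "w \<in> W \<Longrightarrow> linear w"
  by (induction rule: weyl_group.induct) (rule linear_id, rule linear_compose[OF _ linear_refl])

lemma W_isometry: "w \<in> W \<Longrightarrow> B (w x) (w y) = B x y"
  by (induction arbitrary: x y rule: weyl_group.induct) (auto simp: refl_isometry)

lemma W_R: "w \<in> W \<Longrightarrow> \<alpha> \<in> R \<Longrightarrow> w \<alpha> \<in> R"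
  by (induction arbitrary: \<alpha> rule: weyl_group.induct) (auto intro: refl_closed)

lemma refl_comp_refl: "\<alpha> \<in> R \<Longrightarrow> rf \<alpha> \<circ> rf \<alpha> = id"
  by (auto simp: refl_refl)

lemma W_inverse_ex: "w \<in> W \<Longrightarrow> \<exists>u\<in>W. u \<circ> w = id \<and> w \<circ> u = id"
proof (induction rule: weyl_group.induct)
  case weyl_id
  show ?case by (rule bexI[OF _ id_in_W]) simp
next
  case (weyl_refl w \<alpha>)
  then obtain u where u: "u \<in> W" "u \<circ> w = id" "w \<circ> u = id" by blast
  have "u \<circ> rf \<alpha> \<in> W" using u weyl_refl comp_in_W refl_in_W by blast
  moreover have "(u \<circ> rf \<alpha>) \<circ> (rf \<alpha> \<circ> w) = id"
    using u refl_refl[OF weyl_refl(2)] by (auto simp: fun_eq_iff)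
  moreover have "(rf \<alpha> \<circ> w) \<circ> (u \<circ> rf \<alpha>) = id"
    using u refl_refl[OF weyl_refl(2)] by (auto simp: fun_eq_iff)
  ultimately show ?case by blast
qed

lemma bij_W: "w \<in> W \<Longrightarrow> bij w"
  using W_inverse_ex[of w] o_bij by blast

lemma inv_in_W: "w \<in> W \<Longrightarrow> inv w \<in> W"
  using W_inverse_ex[of w] by (metis inv_unique_comp)

lemma inv_W_eq: "w \<in> W \<Longrightarrow> inv w (w x) = x" "w \<in> W \<Longrightarrow> w (inv w x) = x"
  using bij_W[of w] by (auto simp: bij_is_inj bij_is_surj surj_f_inv_f)

lemma inv_inv_W: "w \<in> W \<Longrightarrow> inv (inv w) = w"
  using bij_W inv_inv_eq by blast

lemma inj_W: "w \<in> W \<Longrightarrow> inj_on w A"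
  using bij_W[of w] by (meson bij_is_inj inj_on_subset subset_UNIV)

lemma W_image_R: "w \<in> W \<Longrightarrow> w ` R = R"
proof
  assume w: "w \<in> W"
  show "w ` R \<subseteq> R" using W_R[OF w] by auto
  show "R \<subseteq> w ` R"
    using W_R[OF inv_in_W[OF w]] inv_W_eq(2)[OF w] by (metis image_eqI subsetI)
qed

lemma W_simps:
  assumes "w \<in> W"
  shows "w (x + y) = w x + w y" "w (x - y) = w x - w y" "w (- x) = - w x"
    "w (c *\<^sub>R x) = c *\<^sub>R w x" "w 0 = 0" "w (sum f A) = (\<Sum>a\<in>A. w (f a))"
  using linear_W[OF assms]
  by (simp_all add: linear_add linear_diff linear_neg linear_scale linear_0 linear_sum)

lemma pair_W: "w \<in> W \<Longrightarrow> pair (w x) (w \<alpha>) = pair x \<alpha>"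
  by (simp add: pair_eq W_isometry)

lemma pair_W': "w \<in> W \<Longrightarrow> pair (w x) \<alpha> = pair x (inv w \<alpha>)"
  using pair_W[of w x "inv w \<alpha>"] by (simp add: inv_W_eq)

lemma B_W': "w \<in> W \<Longrightarrow> B (w x) y = B x (inv w y)"
  using W_isometry[of w x "inv w y"] by (simp add: inv_W_eq)

lemma refl_conj: "w \<in> W \<Longrightarrow> w \<circ> rf \<alpha> = rf (w \<alpha>) \<circ> w"
  by (auto simp: fun_eq_iff reflection_def W_simps pair_W)


subsection \<open>Simple roots\<close>

abbreviation "\<Delta> \<equiv> simple_roots Rp"

lemma simple_Rp: "\<alpha> \<in> \<Delta> \<Longrightarrow> \<alpha> \<in> Rp"
  by (simp add: simple_roots_def)

lemma simple_R: "\<alpha> \<in> \<Delta> \<Longrightarrow> \<alpha> \<in> R"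
  using simple_Rp Rp_R by auto

lemma finite_simple: "finite \<Delta>"
  using finite_Rp by (simp add: simple_roots_def)

text \<open>The values of \<open>h\<close> are real, so the well-founded measure is the number of
  positive roots on which \<open>h\<close> is smaller.\<close>

lemma Rp_h_induct [consumes 1, case_names less]:
  assumes "\<beta> \<in> Rp"
    and "\<And>\<beta>. \<beta> \<in> Rp \<Longrightarrow> (\<And>\<gamma>. \<gamma> \<in> Rp \<Longrightarrow> h \<gamma> < h \<beta> \<Longrightarrow> P \<gamma>) \<Longrightarrow> P \<beta>"
  shows "P \<beta>"
  using assms(1)
proof (induction "card {\<gamma>\<in>Rp. h \<gamma> < h \<beta>}" arbitrary: \<beta> rule: less_induct)
  case less
  show ?case
  proof (rule assms(2)[OF less.prems])
    fix \<gamma> assume g: "\<gamma> \<in> Rp" "h \<gamma> < h \<beta>"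
    have "{\<delta>\<in>Rp. h \<delta> < h \<gamma>} \<subset> {\<delta>\<in>Rp. h \<delta> < h \<beta>}" using g by auto
    then show "P \<gamma>" using less.hyps g finite_Rp by (simp add: psubset_card_mono)
  qed
qed

lemma Rp_simple_combination:
  assumes "\<beta> \<in> Rp"
  shows "\<exists>c. (\<forall>\<alpha>. c \<alpha> \<ge> (0::real)) \<and> \<beta> = (\<Sum>\<alpha>\<in>\<Delta>. c \<alpha> *\<^sub>R \<alpha>)"
  using assms
proof (induction rule: Rp_h_induct)
  case (less \<beta>)
  show ?case
  proof (cases "\<beta> \<in> \<Delta>")
    case True
    have "\<beta> = (\<Sum>\<alpha>\<in>\<Delta>. (if \<alpha> = \<beta> then 1 else 0) *\<^sub>R \<alpha>)"
      using True finite_simple by (simp add: if_distrib[of "\<lambda>c. c *\<^sub>R _"] sum.delta cong: if_cong)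
    then show ?thesis by (intro exI[of _ "\<lambda>\<alpha>. if \<alpha> = \<beta> then 1 else 0"]) auto
  next
    case False
    then obtain \<gamma> \<delta> where gd: "\<gamma> \<in> Rp" "\<delta> \<in> Rp" "\<beta> = \<gamma> + \<delta>"
      using less by (auto simp: simple_roots_def)
    then have "h \<gamma> < h \<beta>" "h \<delta> < h \<beta>" using Rp_pos by (auto simp: h_simps)
    then obtain c d where "\<forall>\<alpha>. c \<alpha> \<ge> (0::real)" "\<gamma> = (\<Sum>\<alpha>\<in>\<Delta>. c \<alpha> *\<^sub>R \<alpha>)"
        "\<forall>\<alpha>. d \<alpha> \<ge> (0::real)" "\<delta> = (\<Sum>\<alpha>\<in>\<Delta>. d \<alpha> *\<^sub>R \<alpha>)"
      using less(2)[OF gd(1)] less(2)[OF gd(2)] by auto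
    then show ?thesis using gd
      by (intro exI[of _ "\<lambda>\<alpha>. c \<alpha> + d \<alpha>"]) (auto simp: scaleR_left_distrib sum.distrib)
  qed
qed

text \<open>Strict because distinct positive roots of a reduced system are not proportional;
  \<open>v\<close> is the component of \<open>\<alpha>\<close> orthogonal to
  \<open>\<beta>\<close>.\<close>

lemma cauchy_schwarz_strict:
  assumes "\<alpha> \<in> Rp" "\<beta> \<in> Rp" "\<alpha> \<noteq> \<beta>"
  shows "(B \<alpha> \<beta>)\<^sup>2 < B \<alpha> \<alpha> * B \<beta> \<beta>"
proof -
  define v where "v = \<alpha> - (B \<alpha> \<beta> / B \<beta> \<beta>) *\<^sub>R \<beta>"
  have b: "B \<beta> \<beta> > 0" using assms Rp_R root_norm_pos by auto
  have "v \<noteq> 0"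
  proof
    assume "v = 0"
    then have e: "\<alpha> = (B \<alpha> \<beta> / B \<beta> \<beta>) *\<^sub>R \<beta>" by (simp add: v_def)
    then have "(B \<alpha> \<beta> / B \<beta> \<beta>) *\<^sub>R \<beta> \<in> R" using assms Rp_R by auto
    then have "B \<alpha> \<beta> / B \<beta> \<beta> = 1 \<or> B \<alpha> \<beta> / B \<beta> \<beta> = -1"
      using reduced assms Rp_R unfolding reduced_roots_def by blast
    then have "\<alpha> = \<beta> \<or> \<alpha> = - \<beta>" using e by (metis scaleR_one scaleR_minus1_left)
    then show False using assms Rp_disjoint_uminus by blast
  qed
  then have "B v v > 0" by (rule pos)
  also have "B v v = B \<alpha> \<alpha> - (B \<alpha> \<beta>)\<^sup>2 / B \<beta> \<beta>"
    using b by (simp add: v_def B_simps sym[of \<beta> \<alpha>] field_simps power2_eq_square)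
  finally show ?thesis using b by (simp add: field_simps)
qed

text \<open>The two Cartan integers are positive with product \<open>4 cos^2 < 4\<close>, so one of
  them is 1, and the corresponding reflection subtracts one root from the other exactly
  once.\<close>

lemma root_diff:
  assumes "\<alpha> \<in> Rp" "\<beta> \<in> Rp" "\<alpha> \<noteq> \<beta>" "B \<alpha> \<beta> > 0"
  shows "\<alpha> - \<beta> \<in> R"
proof -
  have R: "\<alpha> \<in> R" "\<beta> \<in> R" using assms Rp_R by auto
  obtain m where m: "pair \<alpha> \<beta> = of_int m" using integral[OF R(2,1)] by (auto elim: Ints_cases)
  obtain n where n: "pair \<beta> \<alpha> = of_int n" using integral[OF R] by (auto elim: Ints_cases)
  have a: "B \<alpha> \<alpha> > 0" and b: "B \<beta> \<beta> > 0" using R root_norm_pos by auto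
  have "pair \<alpha> \<beta> * pair \<beta> \<alpha> = 4 * (B \<alpha> \<beta>)\<^sup>2 / (B \<alpha> \<alpha> * B \<beta> \<beta>)"
    by (simp add: pair_eq sym[of \<beta> \<alpha>] power2_eq_square)
  also have "\<dots> < 4" using cauchy_schwarz_strict[OF assms(1-3)] a b by (simp add: field_simps)
  finally have "of_int (m * n) < (4::real)" using m n by simp
  then have mn: "m * n < 4" by linarith
  have "pair \<alpha> \<beta> > 0" "pair \<beta> \<alpha> > 0"
    using assms R by (simp_all add: pair_pos_iff sym[of \<beta> \<alpha>])
  then have mp: "m \<ge> 1" "n \<ge> 1" using m n by auto
  have "m = 1 \<or> n = 1"
  proof (rule ccontr)
    assume "\<not> ?thesis"
    then have "m \<ge> 2" "n \<ge> 2" using mp by auto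
    then have "2 * 2 \<le> m * n" by (intro mult_mono) auto
    then show False using mn by simp
  qed
  then show ?thesis
  proof
    assume "m = 1"
    then show ?thesis using refl_closed[OF R(2,1)] m by (simp add: reflection_def)
  next
    assume "n = 1"
    then have "\<beta> - \<alpha> \<in> R" using refl_closed[OF R] n by (simp add: reflection_def)
    then show ?thesis using uminus_R[of "\<beta> - \<alpha>"] by simp
  qed
qed

lemma simple_obtuse:
  assumes "\<alpha> \<in> \<Delta>" "\<beta> \<in> \<Delta>" "\<alpha> \<noteq> \<beta>"
  shows "B \<alpha> \<beta> \<le> 0"
proof (rule ccontr)
  assume "\<not> B \<alpha> \<beta> \<le> 0"
  then have "\<alpha> - \<beta> \<in> R" using root_diff assms simple_Rp by force
  then show False
  proof (rule Rp_cases)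
    assume "\<alpha> - \<beta> \<in> Rp"
    moreover have "\<alpha> = (\<alpha> - \<beta>) + \<beta>" by simp
    ultimately show False using assms simple_Rp unfolding simple_roots_def by blast
  next
    assume "- (\<alpha> - \<beta>) \<in> Rp"
    moreover have "\<beta> = - (\<alpha> - \<beta>) + \<alpha>" by simp
    ultimately show False using assms simple_Rp unfolding simple_roots_def by blast
  qed
qed

text \<open>Argues without linear independence of the simple roots. If
  \<open>\<gamma> = - rf \<alpha> \<beta>\<close> were positive, then
  \<open>\<beta> + \<gamma>\<close> would be a multiple of \<open>\<alpha>\<close>, so the part of
  its expansion away from \<open>\<alpha>\<close> is some \<open>k *\<^sub>R \<alpha>\<close>.
  Obtuse angles give k \<le> 0, while \<open>h\<close> is nonnegative on that part; hence it
  vanishes and \<open>\<beta>\<close> is proportional to \<open>\<alpha>\<close>.\<close>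

lemma simple_refl_Rp:
  assumes "\<alpha> \<in> \<Delta>" "\<beta> \<in> Rp" "\<beta> \<noteq> \<alpha>"
  shows "rf \<alpha> \<beta> \<in> Rp"
proof (rule ccontr)
  assume neg: "rf \<alpha> \<beta> \<notin> Rp"
  define \<gamma> where "\<gamma> = - rf \<alpha> \<beta>"
  have aR: "\<alpha> \<in> R" "\<beta> \<in> R" using assms simple_R Rp_R by auto
  then have "\<gamma> \<in> Rp" using neg refl_closed[OF aR] uminus_in_Rp by (simp add: \<gamma>_def)
  then obtain c where c: "\<And>\<delta>. c \<delta> \<ge> (0::real)" "\<gamma> = (\<Sum>\<delta>\<in>\<Delta>. c \<delta> *\<^sub>R \<delta>)"
    using Rp_simple_combination by blast
  obtain b where b: "\<And>\<delta>. b \<delta> \<ge> (0::real)" "\<beta> = (\<Sum>\<delta>\<in>\<Delta>. b \<delta> *\<^sub>R \<delta>)"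
    using Rp_simple_combination assms by blast
  define n where "n = pair \<beta> \<alpha>"
  have sum: "\<beta> + \<gamma> = n *\<^sub>R \<alpha>" by (simp add: \<gamma>_def n_def reflection_def)
  define d where "d \<delta> = b \<delta> + c \<delta>" for \<delta>
  have d0: "d \<delta> \<ge> 0" for \<delta> using b c by (simp add: d_def)
  have "\<beta> + \<gamma> = (\<Sum>\<delta>\<in>\<Delta>. d \<delta> *\<^sub>R \<delta>)"
    by (subst b(2), subst c(2)) (simp add: d_def scaleR_left_distrib sum.distrib)
  also have "\<dots> = d \<alpha> *\<^sub>R \<alpha> + (\<Sum>\<delta>\<in>\<Delta>-{\<alpha>}. d \<delta> *\<^sub>R \<delta>)"
    using assms(1) finite_simple by (simp add: sum.remove)
  finally have rest: "(\<Sum>\<delta>\<in>\<Delta>-{\<alpha>}. d \<delta> *\<^sub>R \<delta>) = (n - d \<alpha>) *\<^sub>R \<alpha>"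
    using sum by (simp add: algebra_simps)
  have h_rest: "(\<Sum>\<delta>\<in>\<Delta>-{\<alpha>}. d \<delta> * h \<delta>) = (n - d \<alpha>) * h \<alpha>"
    using arg_cong[OF rest, of h] by (simp add: h_sum h_simps)
  have hp: "h \<delta> > 0" if "\<delta> \<in> \<Delta>" for \<delta> using that simple_Rp Rp_pos by auto
  have nn: "(\<Sum>\<delta>\<in>\<Delta>-{\<alpha>}. d \<delta> * h \<delta>) \<ge> 0"
    using d0 hp by (intro sum_nonneg) (auto simp: less_imp_le)
  have "(\<Sum>\<delta>\<in>\<Delta>-{\<alpha>}. d \<delta> * B \<delta> \<alpha>) = (n - d \<alpha>) * B \<alpha> \<alpha>"
    using arg_cong[OF rest, of "\<lambda>x. B x \<alpha>"] by (simp add: B_sum_left B_simps)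
  moreover have "(\<Sum>\<delta>\<in>\<Delta>-{\<alpha>}. d \<delta> * B \<delta> \<alpha>) \<le> 0"
    using d0 simple_obtuse[OF _ assms(1)] by (intro sum_nonpos) (auto simp: mult_nonneg_nonpos)
  ultimately have "n - d \<alpha> \<le> 0" using root_norm_pos[OF aR(1)]
    by (simp add: mult_le_0_iff)
  then have "(n - d \<alpha>) * h \<alpha> \<le> 0" using hp[OF assms(1)] by (simp add: mult_le_0_iff)
  then have "(\<Sum>\<delta>\<in>\<Delta>-{\<alpha>}. d \<delta> * h \<delta>) = 0" using h_rest nn by simp
  then have "\<forall>\<delta>\<in>\<Delta>-{\<alpha>}. d \<delta> * h \<delta> = 0"
    using d0 hp finite_simple by (subst (asm) sum_nonneg_eq_0_iff) (auto simp: less_imp_le)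
  then have "\<forall>\<delta>\<in>\<Delta>-{\<alpha>}. b \<delta> = 0"
    using hp d0 b c unfolding d_def by (metis DiffD1 add_nonneg_eq_0_iff mult_eq_0_iff order_less_irrefl)
  then have "\<beta> = b \<alpha> *\<^sub>R \<alpha>"
    using b(2) assms(1) finite_simple by (simp add: sum.remove[of _ \<alpha>])
  then have "b \<alpha> = 1 \<or> b \<alpha> = -1"
    using reduced aR unfolding reduced_roots_def by metis
  then have "\<beta> = \<alpha>" using b(1)[of \<alpha>] \<open>\<beta> = b \<alpha> *\<^sub>R \<alpha>\<close> by auto
  then show False using assms by simp
qed

text \<open>Otherwise expanding one argument of \<open>B \<beta> \<beta>\<close> in simple roots
  would make it nonpositive. The simple reflection found here lowers \<open>h \<beta>\<close>, which
  drives the inductions on positive roots.\<close>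

lemma ex_simple_pair_pos:
  assumes "\<beta> \<in> Rp"
  shows "\<exists>\<alpha>\<in>\<Delta>. B \<beta> \<alpha> > 0"
proof (rule ccontr)
  assume c: "\<not> ?thesis"
  obtain b where b: "\<And>\<delta>. b \<delta> \<ge> (0::real)" "\<beta> = (\<Sum>\<delta>\<in>\<Delta>. b \<delta> *\<^sub>R \<delta>)"
    using Rp_simple_combination assms by blast
  have "B \<beta> \<beta> = (\<Sum>\<delta>\<in>\<Delta>. b \<delta> * B \<delta> \<beta>)"
    using arg_cong[OF b(2), of "\<lambda>x. B x \<beta>"] by (simp add: B_sum_left B_simps)
  also have "\<dots> \<le> 0" using b(1) c by (intro sum_nonpos) (auto simp: mult_nonneg_nonpos not_less sym[of _ \<beta>])
  finally show False using root_norm_pos assms Rp_R by fastforce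
qed


subsection \<open>Words in simple reflections\<close>

definition word :: "'a list \<Rightarrow> 'a \<Rightarrow> 'a" where
  "word as = foldr (\<lambda>\<alpha> u. rf \<alpha> \<circ> u) as id"

lemma word_simps [simp]: "word [] = id" "word (\<alpha> # as) = rf \<alpha> \<circ> word as"
  by (simp_all add: word_def)

lemma word_in_W: "set as \<subseteq> \<Delta> \<Longrightarrow> word as \<in> W"
  by (induction as) (auto intro: weyl_group.intros simple_R simp: id_in_W)

lemma word_append: "word (as @ bs) = word as \<circ> word bs"
  by (induction as) (auto simp: o_assoc)

text \<open>Conjugation by a simple reflection that lowers \<open>h \<beta>\<close> reduces to a
  smaller root, until the root is simple.\<close>

lemma refl_is_word:
  assumes "\<beta> \<in> Rp" shows "\<exists>as. set as \<subseteq> \<Delta> \<and> rf \<beta> = word as"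
  using assms
proof (induction rule: Rp_h_induct)
  case (less \<beta>)
  obtain \<alpha> where a: "\<alpha> \<in> \<Delta>" "B \<beta> \<alpha> > 0" using ex_simple_pair_pos less(1) by blast
  show ?case
  proof (cases "\<beta> = \<alpha>")
    case True
    then show ?thesis using a by (intro exI[of _ "[\<alpha>]"]) auto
  next
    case False
    have aR: "\<alpha> \<in> R" using a simple_R by auto
    have g: "rf \<alpha> \<beta> \<in> Rp" using simple_refl_Rp a less False by auto
    have "h (rf \<alpha> \<beta>) < h \<beta>"
      using a(2) Rp_pos[OF simple_Rp[OF a(1)]] pair_pos_iff[OF aR] by (simp add: reflection_def h_simps)
    then obtain as where as: "set as \<subseteq> \<Delta>" "rf (rf \<alpha> \<beta>) = word as" using less(2) g by blast
    have "rf \<alpha> \<circ> rf (rf \<alpha> \<beta>) = rf \<beta> \<circ> rf \<alpha>"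
      using refl_conj[OF refl_in_W[OF aR], of "rf \<alpha> \<beta>"] refl_refl[OF aR] by simp
    then have "rf \<beta> = rf \<alpha> \<circ> rf (rf \<alpha> \<beta>) \<circ> rf \<alpha>"
      using refl_comp_refl[OF aR] by (simp add: o_assoc[symmetric])
    also have "\<dots> = word (\<alpha> # as @ [\<alpha>])" using as by (simp add: word_append o_assoc)
    finally show ?thesis using as a by (intro exI[of _ "\<alpha> # as @ [\<alpha>]"]) auto
  qed
qed

lemma refl_uminus: "rf (- \<alpha>) = rf \<alpha>"
  by (auto simp: fun_eq_iff reflection_def pair_uminus_right)

lemma W_word: "w \<in> W \<Longrightarrow> \<exists>as. set as \<subseteq> \<Delta> \<and> w = word as"
proof (induction rule: weyl_group.induct)
  case weyl_id
  then show ?case by (auto intro!: exI[of _ "[]"])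
next
  case (weyl_refl w \<alpha>)
  then obtain as where as: "set as \<subseteq> \<Delta>" "w = word as" by auto
  have "\<exists>bs. set bs \<subseteq> \<Delta> \<and> rf \<alpha> = word bs"
    using weyl_refl(2) by (rule Rp_cases) (use refl_is_word refl_uminus in metis)+
  then obtain bs where "set bs \<subseteq> \<Delta>" "rf \<alpha> = word bs" by auto
  then show ?case using as by (intro exI[of _ "bs @ as"]) (auto simp: word_append)
qed

text \<open>Follow \<open>\<beta>\<close> through the letters: a simple reflection keeps a positive
  root positive unless that root is its own. Since the root ends up negative, it meets its own
  letter on the way, and that letter is the one deleted.\<close>

lemma exchange_condition:
  assumes "set as \<subseteq> \<Delta>" "\<beta> \<in> Rp" "inv (word as) \<beta> \<notin> Rp"
  shows "\<exists>bs. set bs \<subseteq> \<Delta> \<and> length bs + 1 = length as \<and> rf \<beta> \<circ> word as = word bs"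
  using assms
proof (induction as arbitrary: \<beta>)
  case Nil
  then show ?case by simp
next
  case (Cons \<alpha> as)
  have a: "\<alpha> \<in> \<Delta>" "\<alpha> \<in> R" "set as \<subseteq> \<Delta>" using Cons.prems simple_R by auto
  show ?case
  proof (cases "\<beta> = \<alpha>")
    case True
    then have e: "rf \<beta> \<circ> word (\<alpha> # as) = word as"
      using refl_comp_refl[OF a(2)] by (simp add: o_assoc)
    show ?thesis by (intro exI[of _ as] conjI a(3) e) simp
  next
    case False
    have "inv (word (\<alpha> # as)) = inv (word as) \<circ> inv (rf \<alpha>)"
      using o_inv_distrib[OF bij_W bij_W] a word_in_W refl_in_W by simp
    moreover have "inv (rf \<alpha>) = rf \<alpha>"
      using refl_comp_refl[OF a(2)] inv_unique_comp by blast
    ultimately have "inv (word as) (rf \<alpha> \<beta>) \<notin> Rp" using Cons.prems(3) by (metis comp_apply)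
    moreover have "rf \<alpha> \<beta> \<in> Rp" using simple_refl_Rp a Cons.prems False by blast
    ultimately obtain bs where bs: "set bs \<subseteq> \<Delta>" "length bs + 1 = length as"
        "rf (rf \<alpha> \<beta>) \<circ> word as = word bs"
      using Cons.IH[OF a(3)] by blast
    have "rf \<alpha> \<circ> rf (rf \<alpha> \<beta>) = rf \<beta> \<circ> rf \<alpha>"
      using refl_conj[OF refl_in_W[OF a(2)], of "rf \<alpha> \<beta>"] refl_refl[OF a(2)] by simp
    then have "rf \<beta> \<circ> word (\<alpha> # as) = rf \<alpha> \<circ> (rf (rf \<alpha> \<beta>) \<circ> word as)"
      by (simp add: o_assoc)
    also have "\<dots> = word (\<alpha> # bs)" using bs by simp
    finally have e: "rf \<beta> \<circ> word (\<alpha> # as) = word (\<alpha> # bs)" .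
    show ?thesis by (intro exI[of _ "\<alpha> # bs"] conjI e) (use bs a in simp_all)
  qed
qed

section \<open>Inversions, the length function and the sign character\<close>

definition inversions :: "('a \<Rightarrow> 'a) \<Rightarrow> 'a set" where
  "inversions w = {\<beta>\<in>Rp. w \<beta> \<notin> Rp}"

text \<open>A simple reflection permutes the positive roots other than \<open>\<alpha>\<close>, so
  only the status of \<open>\<alpha>\<close> itself changes. The second claim ensures that the
  subtraction in the first is not truncated.\<close>

lemma card_inversions_refl:
  assumes w: "w \<in> W" and a: "\<alpha> \<in> \<Delta>"
  shows "card (inversions (w \<circ> rf \<alpha>)) =
    (if w \<alpha> \<in> Rp then card (inversions w) + 1 else card (inversions w) - 1)"
    "w \<alpha> \<notin> Rp \<Longrightarrow> card (inversions w) \<ge> 1"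
proof -
  have aR: "\<alpha> \<in> R" "\<alpha> \<in> Rp" using a simple_R simple_Rp by auto
  define I where "I = {\<beta>\<in>Rp - {\<alpha>}. w \<beta> \<notin> Rp}"
  have fI: "finite I" "\<alpha> \<notin> I" using finite_Rp by (auto simp: I_def)
  have perm: "rf \<alpha> \<beta> \<in> Rp - {\<alpha>}" if "\<beta> \<in> Rp - {\<alpha>}" for \<beta>
  proof -
    have "rf \<alpha> \<beta> \<noteq> \<alpha>"
    proof
      assume "rf \<alpha> \<beta> = \<alpha>"
      then have "\<beta> = - \<alpha>" using refl_refl[OF aR(1), of \<beta>] refl_self[OF aR(1)] by simp
      then show False using that uminus_in_Rp aR by auto
    qed
    then show ?thesis using simple_refl_Rp a that by auto
  qed
  have "inversions w = I \<union> (if w \<alpha> \<in> Rp then {} else {\<alpha>})"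
    using aR by (auto simp: inversions_def I_def)
  then have 1: "card (inversions w) = card I + (if w \<alpha> \<in> Rp then 0 else 1)"
    using fI by auto
  have wa: "w (rf \<alpha> \<alpha>) \<in> Rp \<longleftrightarrow> w \<alpha> \<notin> Rp"
    using refl_self[OF aR(1)] W_simps(3)[OF w] uminus_in_Rp W_R[OF w aR(1)] by simp
  have "inversions (w \<circ> rf \<alpha>) = rf \<alpha> ` I \<union> (if w \<alpha> \<in> Rp then {\<alpha>} else {})"
  proof (intro set_eqI iffI)
    fix \<beta> assume b: "\<beta> \<in> inversions (w \<circ> rf \<alpha>)"
    show "\<beta> \<in> rf \<alpha> ` I \<union> (if w \<alpha> \<in> Rp then {\<alpha>} else {})"
    proof (cases "\<beta> = \<alpha>")
      case True
      then show ?thesis using b wa by (auto simp: inversions_def)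
    next
      case False
      then have "rf \<alpha> \<beta> \<in> I" using b perm[of \<beta>] by (auto simp: inversions_def I_def)
      then show ?thesis using refl_refl[OF aR(1), of \<beta>] by (metis UnI1 image_eqI)
    qed
  next
    fix \<beta> assume "\<beta> \<in> rf \<alpha> ` I \<union> (if w \<alpha> \<in> Rp then {\<alpha>} else {})"
    then consider \<gamma> where "\<gamma> \<in> I" "\<beta> = rf \<alpha> \<gamma>" | "w \<alpha> \<in> Rp" "\<beta> = \<alpha>"
      by (auto split: if_splits)
    then show "\<beta> \<in> inversions (w \<circ> rf \<alpha>)"
    proof cases
      case 1
      then show ?thesis using perm[of \<gamma>] refl_refl[OF aR(1), of \<gamma>] by (simp add: inversions_def I_def)
    next
      case 2
      then show ?thesis using aR wa by (simp add: inversions_def)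
    qed
  qed
  moreover have "\<alpha> \<notin> rf \<alpha> ` I"
  proof
    assume "\<alpha> \<in> rf \<alpha> ` I"
    then obtain x where "x \<in> I" "\<alpha> = rf \<alpha> x" by (rule imageE)
    then show False using perm[of x] by (simp add: I_def)
  qed
  moreover have "card (rf \<alpha> ` I) = card I"
    by (intro card_image inj_W refl_in_W aR)
  ultimately have 2: "card (inversions (w \<circ> rf \<alpha>)) = card I + (if w \<alpha> \<in> Rp then 1 else 0)"
    using fI by auto
  show "card (inversions (w \<circ> rf \<alpha>)) =
    (if w \<alpha> \<in> Rp then card (inversions w) + 1 else card (inversions w) - 1)"
    using 1 2 by auto
  show "w \<alpha> \<notin> Rp \<Longrightarrow> card (inversions w) \<ge> 1" using 1 by auto
qed

lemma inversions_inv: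
  assumes w: "w \<in> W" shows "bij_betw (\<lambda>\<beta>. - w \<beta>) (inversions w) (inversions (inv w))"
proof (rule bij_betw_byWitness[where f' = "\<lambda>\<beta>. - inv w \<beta>"])
  show "\<forall>\<beta>\<in>inversions w. - inv w (- w \<beta>) = \<beta>"
    using W_simps(3)[OF inv_in_W[OF w]] inv_W_eq[OF w] by simp
  show "\<forall>\<beta>\<in>inversions (inv w). - w (- inv w \<beta>) = \<beta>"
    using W_simps(3)[OF w] inv_W_eq[OF w] by simp
  show "(\<lambda>\<beta>. - w \<beta>) ` inversions w \<subseteq> inversions (inv w)"
    using W_R[OF w] Rp_R uminus_in_Rp W_simps(3)[OF inv_in_W[OF w]] inv_W_eq[OF w]
    by (auto simp: inversions_def)
  show "(\<lambda>\<beta>. - inv w \<beta>) ` inversions (inv w) \<subseteq> inversions w"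
    using W_R[OF inv_in_W[OF w]] Rp_R uminus_in_Rp W_simps(3)[OF w] inv_W_eq[OF w]
    by (auto simp: inversions_def)
qed

lemma card_inversions_inv: "w \<in> W \<Longrightarrow> card (inversions (inv w)) = card (inversions w)"
  using bij_betw_same_card[OF inversions_inv] by simp

lemma card_inversions_refl_left:
  assumes w: "w \<in> W" and a: "\<alpha> \<in> \<Delta>"
  shows "card (inversions (rf \<alpha> \<circ> w)) =
    (if inv w \<alpha> \<in> Rp then card (inversions w) + 1 else card (inversions w) - 1)"
    "inv w \<alpha> \<notin> Rp \<Longrightarrow> card (inversions w) \<ge> 1"
proof -
  have aR: "\<alpha> \<in> R" using a simple_R by auto
  have "inv (rf \<alpha> \<circ> w) = inv w \<circ> rf \<alpha>"
    using o_inv_distrib[OF bij_W[OF refl_in_W[OF aR]] bij_W[OF w]]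
      inv_unique_comp[OF refl_comp_refl[OF aR] refl_comp_refl[OF aR]] by simp
  then have "card (inversions (rf \<alpha> \<circ> w)) = card (inversions (inv w \<circ> rf \<alpha>))"
    using card_inversions_inv[OF comp_in_W[OF refl_in_W[OF aR] w]] by simp
  then show "card (inversions (rf \<alpha> \<circ> w)) =
    (if inv w \<alpha> \<in> Rp then card (inversions w) + 1 else card (inversions w) - 1)"
    using card_inversions_refl(1)[OF inv_in_W[OF w] a] card_inversions_inv[OF w] by simp
  show "inv w \<alpha> \<notin> Rp \<Longrightarrow> card (inversions w) \<ge> 1"
    using card_inversions_refl(2)[OF inv_in_W[OF w] a] card_inversions_inv[OF w] by simp
qed

lemma card_inversions_word_le: "set as \<subseteq> \<Delta> \<Longrightarrow> card (inversions (word as)) \<le> length as"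
proof (induction as)
  case Nil
  then show ?case by (simp add: inversions_def)
next
  case (Cons \<alpha> as)
  then have "card (inversions (rf \<alpha> \<circ> word as)) \<le> card (inversions (word as)) + 1"
    using card_inversions_refl_left(1)[OF word_in_W, of as \<alpha>]
      by (cases "inv (word as) \<alpha> \<in> Rp") (simp_all add: le_diff_conv)
  moreover have "card (inversions (word as)) \<le> length as" using Cons by simp
  ultimately show ?case unfolding word_simps list.size by linarith
qed

text \<open>Built letter by letter: a letter that creates an inversion is kept, and otherwise the
  exchange condition shortens the word found so far.\<close>

lemma ex_reduced_word:
  "set as \<subseteq> \<Delta> \<Longrightarrow> \<exists>bs. set bs \<subseteq> \<Delta> \<and> length bs = card (inversions (word as)) \<and> word as = word bs"
proof (induction as)
  case Nil
  then show ?case by (auto simp: inversions_def)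
next
  case (Cons \<alpha> as)
  then obtain bs where bs: "set bs \<subseteq> \<Delta>" "length bs = card (inversions (word as))"
      "word as = word bs" by (metis set_subset_Cons subset_trans)
  have a: "\<alpha> \<in> \<Delta>" and w: "word as \<in> W" using Cons.prems word_in_W by auto
  show ?case
  proof (cases "inv (word as) \<alpha> \<in> Rp")
    case True
    then have l: "card (inversions (rf \<alpha> \<circ> word as)) = card (inversions (word as)) + 1"
      using card_inversions_refl_left(1)[OF w a] by simp
    show ?thesis unfolding word_simps l using bs a
      by (intro exI[of _ "\<alpha> # bs"] conjI) (simp_all only: word_simps set_simps, simp_all)
  next
    case False
    then obtain cs where cs: "set cs \<subseteq> \<Delta>" "length cs + 1 = length bs" "rf \<alpha> \<circ> word bs = word cs"
      using exchange_condition[OF bs(1) simple_Rp[OF a]] bs(3) by metis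
    have "length cs = card (inversions (rf \<alpha> \<circ> word as))"
      using card_inversions_refl_left[OF w a] bs False cs(2) by simp
    then show ?thesis unfolding word_simps using cs bs(3) by (intro exI[of _ cs] conjI) simp_all
  qed
qed

lemma weyl_length_eq: "w \<in> W \<Longrightarrow> weyl_length B Rp w = card (inversions w)"
proof -
  assume "w \<in> W"
  then obtain as where "set as \<subseteq> \<Delta>" "w = word as" using W_word by blast
  then obtain bs where bs: "set bs \<subseteq> \<Delta>" "length bs = card (inversions w)" "w = word bs"
    using ex_reduced_word by metis
  show ?thesis unfolding weyl_length_def word_def[symmetric]
  proof (rule Least_equality)
    show "\<exists>as. length as = card (inversions w) \<and> set as \<subseteq> \<Delta> \<and> w = word as" using bs by blast
    show "card (inversions w) \<le> n"
      if "\<exists>as. length as = n \<and> set as \<subseteq> \<Delta> \<and> w = word as" for n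
      using that card_inversions_word_le by blast
  qed
qed

lemma inversions_empty: "w \<in> W \<Longrightarrow> inversions w = {} \<Longrightarrow> w = id"
  using W_word[of w] ex_reduced_word by (metis card.empty word_simps(1) length_0_conv)

text \<open>Every element has a reduced word, whose length is a number of inversions and hence at
  most the number of positive roots.\<close>

lemma finite_W: "finite W"
proof -
  have "W \<subseteq> word ` {as. set as \<subseteq> \<Delta> \<and> length as \<le> card Rp}"
  proof
    fix w assume "w \<in> W"
    then obtain as where "set as \<subseteq> \<Delta>" "w = word as" using W_word by blast
    then obtain bs where bs: "set bs \<subseteq> \<Delta>" "length bs = card (inversions w)" "w = word bs"
      using ex_reduced_word by metis
    moreover have "card (inversions w) \<le> card Rp"
      using finite_Rp by (intro card_mono) (auto simp: inversions_def)
    ultimately show "w \<in> word ` {as. set as \<subseteq> \<Delta> \<and> length as \<le> card Rp}" by auto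
  qed
  then show ?thesis
    using finite_lists_length_le[OF finite_simple] by (meson finite_imageI finite_subset)
qed

lemma ex_simple_descent:
  assumes "w \<in> W" "inversions w \<noteq> {}"
  shows "\<exists>\<alpha>\<in>\<Delta>. w \<alpha> \<notin> Rp"
proof (rule ccontr)
  assume c: "\<not> ?thesis"
  obtain \<beta> where b: "\<beta> \<in> Rp" "w \<beta> \<notin> Rp" using assms by (auto simp: inversions_def)
  obtain b where bb: "\<And>\<delta>. b \<delta> \<ge> (0::real)" "\<beta> = (\<Sum>\<delta>\<in>\<Delta>. b \<delta> *\<^sub>R \<delta>)"
    using Rp_simple_combination b by blast
  have "h (w \<beta>) = (\<Sum>\<delta>\<in>\<Delta>. b \<delta> * h (w \<delta>))"
    by (subst bb(2)) (simp add: W_simps[OF assms(1)] h_sum h_simps)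
  also have "\<dots> \<ge> 0" using bb(1) c Rp_pos by (intro sum_nonneg) (auto simp: less_imp_le)
  finally show False
    using b W_R[OF assms(1) Rp_R[OF b(1)]] h_nonzero[of "w \<beta>"] by (auto simp: Rp_def)
qed

text \<open>An element with an inversion makes some simple root negative; splitting off that simple
  reflection on the right leaves fewer inversions.\<close>

lemma W_descent_induct [consumes 1, case_names id step]:
  assumes "w \<in> W" "P id"
    and "\<And>w \<alpha>. w \<in> W \<Longrightarrow> \<alpha> \<in> \<Delta> \<Longrightarrow> w \<alpha> \<in> Rp \<Longrightarrow> P w \<Longrightarrow> P (w \<circ> rf \<alpha>)"
  shows "P w"
  using assms(1)
proof (induction "card (inversions w)" arbitrary: w rule: less_induct)
  case less
  show ?case
  proof (cases "inversions w = {}")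
    case True
    then show ?thesis using inversions_empty less.prems assms(2) by auto
  next
    case False
    then obtain \<alpha> where a: "\<alpha> \<in> \<Delta>" "w \<alpha> \<notin> Rp" using ex_simple_descent less by blast
    have aR: "\<alpha> \<in> R" using a simple_R by auto
    define u where "u = w \<circ> rf \<alpha>"
    have u: "u \<in> W" using less.prems aR by (simp add: u_def comp_in_W refl_in_W)
    have "card (inversions u) < card (inversions w)"
      using card_inversions_refl[OF less.prems a(1)] a(2) by (simp add: u_def)
    then have "P u" using less.hyps u by blast
    moreover have "u \<alpha> \<in> Rp"
      using refl_self[OF aR] W_simps(3)[OF less.prems] uminus_in_Rp W_R[OF less.prems aR] a(2)
      by (simp add: u_def)
    ultimately have "P (u \<circ> rf \<alpha>)" using assms(3) u a by blast
    moreover have "u \<circ> rf \<alpha> = w" using refl_comp_refl[OF aR] by (simp add: u_def o_assoc[symmetric])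
    ultimately show ?thesis by simp
  qed
qed

text \<open>The target ring is left open because signs multiply polynomial coefficients as well as
  elements of the group algebra.\<close>

definition sgn_W :: "('a \<Rightarrow> 'a) \<Rightarrow> 'b::comm_ring_1" where
  "sgn_W w = (-1) ^ card (inversions w)"

lemma sgn_id: "sgn_W id = 1"
  by (simp add: sgn_W_def inversions_def)

lemma sgn_simple:
  assumes "w \<in> W" "\<alpha> \<in> \<Delta>" shows "sgn_W (w \<circ> rf \<alpha>) = - sgn_W w"
proof (cases "w \<alpha> \<in> Rp")
  case True
  then show ?thesis using card_inversions_refl[OF assms] by (simp add: sgn_W_def)
next
  case False
  then obtain k where "card (inversions w) = Suc k"
    using card_inversions_refl(2)[OF assms] by (cases "card (inversions w)") auto
  then show ?thesis using card_inversions_refl(1)[OF assms] False by (simp add: sgn_W_def)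
qed

lemma sgn_comp:
  assumes "u \<in> W" "w \<in> W" shows "(sgn_W (u \<circ> w) :: 'b::comm_ring_1) = sgn_W u * sgn_W w"
  using assms(2)
proof (induction rule: W_descent_induct)
  case id
  show ?case unfolding comp_id sgn_id by simp
next
  case (step w \<alpha>)
  have IH: "(sgn_W (u \<circ> w) :: 'b) = sgn_W u * sgn_W w" using step(4) by (simp add: comp_def)
  have "(sgn_W (u \<circ> (w \<circ> rf \<alpha>)) :: 'b) = sgn_W ((u \<circ> w) \<circ> rf \<alpha>)" by (simp add: o_assoc)
  also have "\<dots> = - sgn_W (u \<circ> w)" using step assms comp_in_W by (intro sgn_simple) auto
  also have "\<dots> = sgn_W u * sgn_W (w \<circ> rf \<alpha>)" unfolding IH sgn_simple[OF step(1,2)] by simp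
  finally show ?case .
qed

lemma sgn_square: "sgn_W w * sgn_W w = 1"
  by (simp add: sgn_W_def flip: power_mult_distrib)

lemma sgn_refl_simple: "\<alpha> \<in> \<Delta> \<Longrightarrow> sgn_W (rf \<alpha>) = - 1"
  using sgn_simple[OF id_in_W, of \<alpha>] by (simp add: sgn_id)

lemma sgn_inv: "w \<in> W \<Longrightarrow> sgn_W (inv w) = sgn_W w"
  by (simp add: sgn_W_def card_inversions_inv)


subsection \<open>Dominance\<close>

lemma B_sum_right: "B x (sum f A) = (\<Sum>a\<in>A. B x (f a))"
  by (simp add: sym[of x] B_sum_left)

text \<open>The order on exponents is \<open>\<kappa> - \<nu> \<in> poscone\<close>. Real
  coefficients let \<open>dom_diff\<close> hold for every dominant vector, not only for
  weights.\<close>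

definition poscone :: "'a set" where
  "poscone = {\<Sum>\<alpha>\<in>Rp. c \<alpha> *\<^sub>R \<alpha> |c. \<forall>\<alpha>. c \<alpha> \<ge> (0::real)}"

lemma poscone_0: "0 \<in> poscone"
  unfolding poscone_def by (intro CollectI exI[of _ "\<lambda>_. 0"]) simp

lemma poscone_add: "x \<in> poscone \<Longrightarrow> y \<in> poscone \<Longrightarrow> x + y \<in> poscone"
proof -
  assume "x \<in> poscone" "y \<in> poscone"
  then obtain c d where "\<forall>\<alpha>. c \<alpha> \<ge> (0::real)" "\<forall>\<alpha>. d \<alpha> \<ge> (0::real)"
    "x = (\<Sum>\<alpha>\<in>Rp. c \<alpha> *\<^sub>R \<alpha>)" "y = (\<Sum>\<alpha>\<in>Rp. d \<alpha> *\<^sub>R \<alpha>)" by (auto simp: poscone_def)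
  then show ?thesis unfolding poscone_def
    by (intro CollectI exI[of _ "\<lambda>\<alpha>. c \<alpha> + d \<alpha>"]) (auto simp: scaleR_left_distrib sum.distrib)
qed

lemma poscone_root: "\<beta> \<in> Rp \<Longrightarrow> c \<ge> 0 \<Longrightarrow> c *\<^sub>R \<beta> \<in> poscone"
  unfolding poscone_def using finite_Rp
  by (intro CollectI exI[of _ "\<lambda>\<alpha>. if \<alpha> = \<beta> then c else 0"])
    (auto simp: if_distrib[of "\<lambda>c. c *\<^sub>R _"] sum.delta cong: if_cong)

lemma poscone_sum: "(\<And>i. i \<in> A \<Longrightarrow> f i \<in> poscone) \<Longrightarrow> sum f A \<in> poscone"
  by (induction A rule: infinite_finite_induct) (auto intro: poscone_0 poscone_add)

lemma poscone_sum_roots: "S \<subseteq> Rp \<Longrightarrow> \<Sum>S \<in> poscone"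
  using poscone_root[of _ 1] by (intro poscone_sum) auto

lemma poscone_pointed: "x \<in> poscone \<Longrightarrow> h x \<le> 0 \<Longrightarrow> x = 0"
proof -
  assume "x \<in> poscone" "h x \<le> 0"
  then obtain c where c: "\<forall>\<alpha>. c \<alpha> \<ge> (0::real)" "x = (\<Sum>\<alpha>\<in>Rp. c \<alpha> *\<^sub>R \<alpha>)"
    by (auto simp: poscone_def)
  have n: "c \<alpha> * h \<alpha> \<ge> 0" if "\<alpha> \<in> Rp" for \<alpha> using c(1) Rp_pos[OF that] by simp
  have "(\<Sum>\<alpha>\<in>Rp. c \<alpha> * h \<alpha>) \<le> 0" using c \<open>h x \<le> 0\<close> by (simp add: h_sum h_simps)
  then have "(\<Sum>\<alpha>\<in>Rp. c \<alpha> * h \<alpha>) = 0" using sum_nonneg[of Rp "\<lambda>\<alpha>. c \<alpha> * h \<alpha>"] n by force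
  then have "\<forall>\<alpha>\<in>Rp. c \<alpha> * h \<alpha> = 0"
    using n finite_Rp by (subst (asm) sum_nonneg_eq_0_iff) auto
  then have "\<forall>\<alpha>\<in>Rp. c \<alpha> = 0" using Rp_pos by force
  then show ?thesis using c(2) by simp
qed

lemma poscone_uminus: "x \<in> poscone \<Longrightarrow> - x \<in> poscone \<Longrightarrow> x = 0"
  using poscone_pointed[of x] poscone_pointed[of "- x"] by (cases "h x \<le> 0") (auto simp: h_simps)

lemma sum_roots_eq_0: "S \<subseteq> Rp \<Longrightarrow> \<Sum>S = 0 \<Longrightarrow> S = {}"
proof (rule ccontr)
  assume S: "S \<subseteq> Rp" "\<Sum>S = 0" "S \<noteq> {}"
  then have "0 < (\<Sum>\<alpha>\<in>S. h \<alpha>)"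
    using finite_subset[OF S(1) finite_Rp] Rp_pos by (intro sum_pos) auto
  also have "\<dots> = h (\<Sum>S)" by (simp add: h_sum)
  finally show False using S by (simp add: h_simps)
qed

definition dom :: "'a \<Rightarrow> bool" where "dom x \<longleftrightarrow> (\<forall>\<alpha>\<in>Rp. B x \<alpha> \<ge> 0)"

definition sdom :: "'a \<Rightarrow> bool" where "sdom x \<longleftrightarrow> (\<forall>\<alpha>\<in>Rp. B x \<alpha> > 0)"

lemma sdom_dom: "sdom x \<Longrightarrow> dom x"
  by (auto simp: dom_def sdom_def less_imp_le)

lemma dom_sdom_add: "dom x \<Longrightarrow> sdom y \<Longrightarrow> sdom (x + y)"
  by (auto simp: dom_def sdom_def B_simps add_nonneg_pos)

lemma dom_poscone: "dom x \<Longrightarrow> y \<in> poscone \<Longrightarrow> B x y \<ge> 0"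
  unfolding poscone_def dom_def
  by (auto simp: sym[of x] B_sum_left B_simps intro!: sum_nonneg)

lemma dom_simple:
  assumes "\<And>\<alpha>. \<alpha> \<in> \<Delta> \<Longrightarrow> B x \<alpha> \<ge> 0"
  shows "dom x"
  unfolding dom_def
proof
  fix \<beta> assume "\<beta> \<in> Rp"
  then obtain c where c: "\<And>\<delta>. c \<delta> \<ge> (0::real)" "\<beta> = (\<Sum>\<delta>\<in>\<Delta>. c \<delta> *\<^sub>R \<delta>)"
    using Rp_simple_combination by blast
  have "B x \<beta> = (\<Sum>\<delta>\<in>\<Delta>. c \<delta> * B x \<delta>)"
    by (subst c(2)) (simp add: B_sum_right B_simps)
  then show "B x \<beta> \<ge> 0" using c(1) assms by (auto intro!: sum_nonneg)
qed

lemma sdom_simple: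
  assumes "\<And>\<alpha>. \<alpha> \<in> \<Delta> \<Longrightarrow> B x \<alpha> > 0"
  shows "sdom x"
  unfolding sdom_def
proof
  fix \<beta> assume b: "\<beta> \<in> Rp"
  then obtain c where c: "\<And>\<delta>. c \<delta> \<ge> (0::real)" "\<beta> = (\<Sum>\<delta>\<in>\<Delta>. c \<delta> *\<^sub>R \<delta>)"
    using Rp_simple_combination by blast
  obtain \<gamma> where g: "\<gamma> \<in> \<Delta>" "c \<gamma> \<noteq> 0"
    using c(2) root_nonzero[OF Rp_R[OF b]] by (metis (no_types, lifting) scaleR_zero_left sum.neutral)
  have "B x \<beta> = (\<Sum>\<delta>\<in>\<Delta>. c \<delta> * B x \<delta>)"
    by (subst c(2)) (simp add: B_sum_right B_simps)
  also have "\<dots> > 0"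
  proof (rule sum_pos2[OF finite_simple g(1)])
    show "0 < c \<gamma> * B x \<gamma>" using c(1)[of \<gamma>] g assms by simp
    show "0 \<le> c i * B x i" if "i \<in> \<Delta>" for i using c(1) assms[OF that] by simp
  qed
  finally show "B x \<beta> > 0" .
qed

text \<open>Each step of the descent induction adds
  \<open>pair x \<alpha> *\<^sub>R w \<alpha>\<close>, a nonnegative multiple of a positive
  root.\<close>

lemma dom_diff:
  assumes "dom x" "w \<in> W" shows "x - w x \<in> poscone"
  using assms(2)
proof (induction rule: W_descent_induct)
  case id
  show ?case by (simp add: poscone_0)
next
  case (step w \<alpha>)
  have "x - (w \<circ> rf \<alpha>) x = (x - w x) + pair x \<alpha> *\<^sub>R w \<alpha>"
    by (simp add: reflection_def W_simps[OF step(1)])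
  moreover have "pair x \<alpha> \<ge> 0"
    using assms(1) step pair_nonneg_iff simple_Rp Rp_R by (auto simp: dom_def)
  ultimately show ?case using poscone_add[OF step(4) poscone_root[OF step(3)]] by metis
qed

lemma dom_unique:
  assumes "dom x" "dom (w x)" "w \<in> W" shows "w x = x"
proof -
  have "x - w x \<in> poscone" by (rule dom_diff[OF assms(1,3)])
  moreover have "w x - inv w (w x) \<in> poscone" by (rule dom_diff[OF assms(2) inv_in_W[OF assms(3)]])
  then have "- (x - w x) \<in> poscone" using inv_W_eq(1)[OF assms(3)] by simp
  ultimately show ?thesis using poscone_uminus by fastforce
qed

text \<open>As \<open>w\<close> fixes \<open>x\<close>, the roots \<open>\<beta>\<close> and
  \<open>w \<beta>\<close> pair equally with \<open>x\<close>, but one is positive and the other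
  negative.\<close>

lemma inversions_stabilizer:
  assumes "dom x" "w \<in> W" "w x = x" "\<beta> \<in> inversions w"
  shows "B x \<beta> = 0"
proof -
  have b: "\<beta> \<in> Rp" "w \<beta> \<notin> Rp" using assms by (auto simp: inversions_def)
  then have "- w \<beta> \<in> Rp" using uminus_in_Rp W_R[OF assms(2)] Rp_R by auto
  then have "B x (w \<beta>) \<le> 0" using assms(1) by (force simp: dom_def B_simps)
  moreover have "B x (w \<beta>) = B x \<beta>" using W_isometry[OF assms(2), of x \<beta>] assms(3) by simp
  moreover have "B x \<beta> \<ge> 0" using assms(1) b by (auto simp: dom_def)
  ultimately show ?thesis by simp
qed

lemma sdom_free:
  assumes "sdom x" "w \<in> W" "w x = x" shows "w = id"
proof (rule inversions_empty[OF assms(2)])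
  show "inversions w = {}"
    using inversions_stabilizer[OF sdom_dom[OF assms(1)] assms(2,3)] assms(1)
    by (fastforce simp: sdom_def inversions_def)
qed

text \<open>The point of the orbit with the largest \<open>h\<close> is dominant, because a positive
  root pairing negatively with it would give a reflection that raises \<open>h\<close>.\<close>

lemma ex_dom: "\<exists>w\<in>W. dom (w x)"
proof -
  have "finite ((\<lambda>w. h (w x)) ` W)" "(\<lambda>w. h (w x)) ` W \<noteq> {}" using finite_W id_in_W by auto
  then obtain w where w: "w \<in> W" "\<And>u. u \<in> W \<Longrightarrow> h (u x) \<le> h (w x)"
    using Max_in[of "(\<lambda>w. h (w x)) ` W"] Max_ge[of "(\<lambda>w. h (w x)) ` W"] by fastforce
  have "dom (w x)" unfolding dom_def
  proof (rule ballI, rule ccontr)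
    fix \<alpha> assume a: "\<alpha> \<in> Rp" "\<not> 0 \<le> B (w x) \<alpha>"
    then have "pair (w x) \<alpha> < 0" using pair_nonneg_iff[OF Rp_R] by (simp add: not_le[symmetric])
    then have "h (w x) < h ((rf \<alpha> \<circ> w) x)"
      using Rp_pos[OF a(1)] by (simp add: reflection_def h_simps mult_neg_pos)
    moreover have "rf \<alpha> \<circ> w \<in> W" using w a Rp_R by (intro weyl_refl) auto
    ultimately show False using w(2) by fastforce
  qed
  then show ?thesis using w by blast
qed


subsection \<open>Weights and the half sum of positive roots\<close>

abbreviation "\<Lambda> \<equiv> weight_lattice B R"

abbreviation "\<rho> \<equiv> rho Rp"

lemma weights_0: "0 \<in> \<Lambda>" and weights_add: "x \<in> \<Lambda> \<Longrightarrow> y \<in> \<Lambda> \<Longrightarrow> x + y \<in> \<Lambda>"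
  and weights_diff: "x \<in> \<Lambda> \<Longrightarrow> y \<in> \<Lambda> \<Longrightarrow> x - y \<in> \<Lambda>"
  by (auto simp: weight_lattice_def pair_simps)

lemma weights_root: "\<alpha> \<in> R \<Longrightarrow> \<alpha> \<in> \<Lambda>"
  using integral by (auto simp: weight_lattice_def)

lemma weights_sum: "(\<And>i. i \<in> A \<Longrightarrow> f i \<in> \<Lambda>) \<Longrightarrow> sum f A \<in> \<Lambda>"
  by (induction A rule: infinite_finite_induct) (auto intro: weights_0 weights_add)

lemma weights_W: "w \<in> W \<Longrightarrow> x \<in> \<Lambda> \<Longrightarrow> w x \<in> \<Lambda>"
  using W_R[OF inv_in_W] by (auto simp: weight_lattice_def pair_W')

text \<open>The permutation of the positive roots that \<open>inv w\<close> induces up to sign. It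
  reindexes sums and products over the image of \<open>Rp\<close> under \<open>w\<close> by
  \<open>Rp\<close> itself, with a sign change exactly at the inversions of
  \<open>inv w\<close>.\<close>

definition signed_perm :: "('a \<Rightarrow> 'a) \<Rightarrow> 'a \<Rightarrow> 'a" where
  "signed_perm w \<beta> = (if inv w \<beta> \<in> Rp then inv w \<beta> else - inv w \<beta>)"

lemma W_signed_perm:
  "w \<in> W \<Longrightarrow> w (signed_perm w \<beta>) = (if inv w \<beta> \<in> Rp then \<beta> else - \<beta>)"
  by (simp add: signed_perm_def inv_W_eq W_simps)

lemma bij_signed_perm: assumes w: "w \<in> W" shows "bij_betw (signed_perm w) Rp Rp"
proof -
  have sub: "signed_perm w ` Rp \<subseteq> Rp"
    using W_R[OF inv_in_W[OF w]] Rp_R uminus_in_Rp by (auto simp: signed_perm_def)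
  moreover have "inj_on (signed_perm w) Rp"
  proof (rule inj_onI)
    fix \<alpha> \<beta> assume ab: "\<alpha> \<in> Rp" "\<beta> \<in> Rp" "signed_perm w \<alpha> = signed_perm w \<beta>"
    then have "w (signed_perm w \<alpha>) = w (signed_perm w \<beta>)" by simp
    then have "\<alpha> = \<beta> \<or> \<alpha> = - \<beta>" by (auto simp: W_signed_perm[OF w] split: if_splits)
    then show "\<alpha> = \<beta>" using ab uminus_in_Rp Rp_R by auto
  qed
  ultimately show ?thesis using endo_inj_surj[OF finite_Rp] by (auto simp: bij_betw_def)
qed

lemma W_rho:
  assumes w: "w \<in> W"
  shows "w \<rho> = \<rho> - \<Sum>(inversions (inv w))"
proof -
  have "w (\<Sum>Rp) = (\<Sum>\<alpha>\<in>Rp. w \<alpha>)" by (simp add: W_simps[OF w])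
  also have "\<dots> = (\<Sum>\<beta>\<in>Rp. w (signed_perm w \<beta>))"
    by (rule sum.reindex_bij_betw[OF bij_signed_perm[OF w], symmetric])
  also have "\<dots> = (\<Sum>\<beta>\<in>Rp. \<beta> - (if inv w \<beta> \<notin> Rp then 2 *\<^sub>R \<beta> else 0))"
    by (intro sum.cong) (auto simp: W_signed_perm[OF w] scaleR_2)
  also have "\<dots> = \<Sum>Rp - (\<Sum>\<beta>\<in>Rp. if inv w \<beta> \<notin> Rp then 2 *\<^sub>R \<beta> else 0)"
    by (simp add: sum_subtractf)
  also have "(\<Sum>\<beta>\<in>Rp. if inv w \<beta> \<notin> Rp then 2 *\<^sub>R \<beta> else 0) = (\<Sum>\<beta>\<in>inversions (inv w). 2 *\<^sub>R \<beta>)"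
    unfolding inversions_def using finite_Rp by (rule sum.inter_filter[symmetric])
  also have "\<dots> = 2 *\<^sub>R \<Sum>(inversions (inv w))" by (simp add: scaleR_sum_right)
  finally show ?thesis by (simp add: rho_def W_simps[OF w] scaleR_diff_right)
qed

lemma inversions_simple: assumes "\<alpha> \<in> \<Delta>" shows "inversions (rf \<alpha>) = {\<alpha>}"
proof -
  have "\<alpha> \<in> R" using assms simple_R by auto
  then show ?thesis using simple_refl_Rp[OF assms] simple_Rp[OF assms] refl_self[of \<alpha>] uminus_in_Rp[of \<alpha>]
    by (auto simp: inversions_def)
qed

lemma inv_refl: "\<alpha> \<in> R \<Longrightarrow> inv (rf \<alpha>) = rf \<alpha>"
  using inv_unique_comp[OF refl_comp_refl refl_comp_refl] .

text \<open>A simple reflection inverts only its own root, so \<open>W_rho\<close> gives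
  \<open>rf \<alpha> \<rho> = \<rho> - \<alpha>\<close>; comparison with the definition of the
  reflection yields the pairing.\<close>

lemma rho_simple: assumes "\<alpha> \<in> \<Delta>" shows "pair \<rho> \<alpha> = 1"
proof -
  have a: "\<alpha> \<in> R" using assms simple_R by auto
  have "rf \<alpha> \<rho> = \<rho> - \<alpha>"
    using W_rho[OF refl_in_W[OF a]] inversions_simple[OF assms] inv_refl[OF a] by simp
  then have "(pair \<rho> \<alpha> - 1) *\<^sub>R \<alpha> = 0" by (simp add: reflection_def algebra_simps)
  then show ?thesis using root_nonzero[OF a] by simp
qed

lemma sdom_rho: "sdom \<rho>"
  using rho_simple pair_pos_iff[OF simple_R] by (intro sdom_simple) (metis zero_less_one)

lemma Rp_conj_simple: "\<beta> \<in> Rp \<Longrightarrow> \<exists>w\<in>W. \<exists>\<alpha>\<in>\<Delta>. \<beta> = w \<alpha>"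
proof (induction rule: Rp_h_induct)
  case (less \<beta>)
  obtain \<alpha> where a: "\<alpha> \<in> \<Delta>" "B \<beta> \<alpha> > 0" using ex_simple_pair_pos less(1) by blast
  have aR: "\<alpha> \<in> R" using a simple_R by auto
  show ?case
  proof (cases "\<beta> = \<alpha>")
    case True
    then show ?thesis by (intro bexI[OF _ id_in_W] bexI[OF _ a(1)]) simp
  next
    case False
    have "rf \<alpha> \<beta> \<in> Rp" using simple_refl_Rp a less False by auto
    moreover have "h (rf \<alpha> \<beta>) < h \<beta>"
      using a(2) Rp_pos[OF simple_Rp[OF a(1)]] pair_pos_iff[OF aR] by (simp add: reflection_def h_simps)
    ultimately obtain w \<delta> where w: "w \<in> W" "\<delta> \<in> \<Delta>" "rf \<alpha> \<beta> = w \<delta>" using less(2) by blast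
    then have "\<beta> = (rf \<alpha> \<circ> w) \<delta>" using refl_refl[OF aR, of \<beta>] by simp
    then show ?thesis using w weyl_refl[OF w(1) aR] by blast
  qed
qed

text \<open>A positive root is \<open>w \<alpha>\<close> with \<open>\<alpha>\<close> simple; moving
  \<open>w\<close> to the other side replaces \<open>\<rho>\<close> by \<open>\<rho>\<close> minus a
  sum of roots, whose pairing with \<open>\<alpha>\<close> is 1 minus an integer.\<close>

lemma rho_weight: "\<rho> \<in> \<Lambda>"
proof -
  have p: "pair \<rho> \<beta> \<in> \<int>" if b: "\<beta> \<in> Rp" for \<beta>
  proof -
    obtain w \<alpha> where w: "w \<in> W" "\<alpha> \<in> \<Delta>" "\<beta> = w \<alpha>" using Rp_conj_simple[OF b] by blast
    have "pair \<rho> \<beta> = pair (inv w \<rho>) \<alpha>" using pair_W'[OF inv_in_W[OF w(1)]] w inv_inv_W by simp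
    also have "\<dots> = 1 - pair (\<Sum>(inversions w)) \<alpha>"
      using W_rho[OF inv_in_W[OF w(1)]] w(1) rho_simple[OF w(2)] by (simp add: inv_inv_W pair_simps)
    also have "\<dots> \<in> \<int>"
      using w(2) simple_R integral Rp_R by (intro Ints_diff) (auto simp: pair_sum inversions_def intro!: Ints_sum)
    finally show ?thesis .
  qed
  show ?thesis unfolding weight_lattice_def
  proof (intro CollectI ballI)
    fix \<alpha> assume "\<alpha> \<in> R"
    then show "pair \<rho> \<alpha> \<in> \<int>"
      by (rule Rp_cases) (use p in \<open>force simp: pair_uminus_right\<close>)+
  qed
qed

text \<open>Integrality sharpens a positive pairing with a simple coroot to at least 1, which is the
  pairing of \<open>\<rho>\<close>.\<close>

lemma sdom_minus_rho:
  assumes "x \<in> \<Lambda>" "sdom x" shows "dom (x - \<rho>)"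
proof (rule dom_simple)
  fix \<alpha> assume a: "\<alpha> \<in> \<Delta>"
  then have aR: "\<alpha> \<in> R" by (rule simple_R)
  have "pair x \<alpha> \<in> \<int>" using assms(1) aR by (simp add: weight_lattice_def)
  moreover have "pair x \<alpha> > 0" using assms(2) pair_pos_iff[OF aR] simple_Rp[OF a] by (simp add: sdom_def)
  ultimately have "pair x \<alpha> \<ge> 1" by (auto elim!: Ints_cases)
  then have "pair (x - \<rho>) \<alpha> \<ge> 0" by (simp add: pair_simps rho_simple[OF a])
  then show "B (x - \<rho>) \<alpha> \<ge> 0" using pair_nonneg_iff[OF aR] by blast
qed

lemma dom_not_sdom:
  assumes "dom x" "\<not> sdom x" shows "\<exists>\<alpha>\<in>\<Delta>. rf \<alpha> x = x"
proof -
  obtain \<alpha> where "\<alpha> \<in> \<Delta>" "\<not> B x \<alpha> > 0" using sdom_simple assms(2) by blast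
  moreover then have "B x \<alpha> = 0" using assms(1) simple_Rp by (force simp: dom_def)
  ultimately show ?thesis using pair_eq_0_iff[OF simple_R] by (auto simp: reflection_def)
qed

text \<open>Here definiteness enters: \<open>- \<Sum>S\<close> is dominant and
  \<open>\<Sum>S\<close> lies in the cone, so the norm of \<open>\<Sum>S\<close> is at most 0. A sum
  of positive roots vanishes only if it is empty.\<close>

lemma sdom_rho_minus_sum:
  assumes "S \<subseteq> Rp" "sdom (\<rho> - \<Sum>S)" shows "S = {}"
proof -
  have "\<rho> - \<Sum>S \<in> \<Lambda>" using assms(1) Rp_R by (intro weights_diff rho_weight weights_sum weights_root) auto
  then have "dom (- \<Sum>S)" using sdom_minus_rho[OF _ assms(2)] by simp
  then have "B (- \<Sum>S) (\<Sum>S) \<ge> 0" by (rule dom_poscone[OF _ poscone_sum_roots[OF assms(1)]])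
  then have "B (\<Sum>S) (\<Sum>S) \<le> 0" by (simp add: B_simps)
  then have "\<Sum>S = 0" using pos[of "\<Sum>S"] by force
  then show ?thesis using sum_roots_eq_0 assms(1) by blast
qed


subsection \<open>Stabilizers of dominant vectors\<close>

definition R_perp :: "'a \<Rightarrow> 'a set" where "R_perp x = {\<alpha>\<in>R. B x \<alpha> = 0}"

lemma R_perp_root_system: "euclidean_root_system B (R_perp x) h"
proof
  show "rf \<alpha> \<beta> \<in> R_perp x" if "\<alpha> \<in> R_perp x" "\<beta> \<in> R_perp x" for \<alpha> \<beta>
    using that refl_closed by (auto simp: R_perp_def reflection_def B_simps)
  show "reduced_roots (R_perp x)" using reduced by (auto simp: R_perp_def reduced_roots_def)
qed (use bilinear sym pos finite_R zero_notin_R integral lin_h h_nonzero in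
    \<open>auto simp: R_perp_def linear_add linear_scale\<close>)

text \<open>For the inclusion of the stabilizer, strip a simple descent \<open>\<alpha>\<close> from
  an element fixing \<open>x\<close>. The inverted root is orthogonal to \<open>x\<close>, so its
  reflection belongs to the subsystem and the remaining factor still fixes \<open>x\<close>.\<close>

lemma weyl_group_R_perp:
  assumes "dom x"
  shows "weyl_group B (R_perp x) = weyl_stabilizer B R x"
proof
  interpret S: euclidean_root_system B "R_perp x" h by (rule R_perp_root_system)
  have fixed: "rf \<alpha> x = x" if "\<alpha> \<in> R_perp x" for \<alpha>
    using that pair_eq_0_iff by (auto simp: R_perp_def reflection_def)
  have "w \<in> W \<and> w x = x" if "w \<in> weyl_group B (R_perp x)" for w
    using that
  proof (induction rule: weyl_group.induct)
    case weyl_id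
    show ?case using id_in_W by (simp add: id_def)
  next
    case (weyl_refl w \<alpha>)
    then show ?case using fixed weyl_group.weyl_refl[of w B R \<alpha>] by (simp add: R_perp_def comp_def)
  qed
  then show "weyl_group B (R_perp x) \<subseteq> weyl_stabilizer B R x" by (auto simp: weyl_stabilizer_def)
  have "w x = x \<longrightarrow> w \<in> weyl_group B (R_perp x)" if "w \<in> W" for w
    using that
  proof (induction rule: W_descent_induct)
    case id
    show ?case using S.id_in_W by (simp add: id_def)
  next
    case (step w \<alpha>)
    have aR: "\<alpha> \<in> R" using step simple_R by auto
    have ws: "w \<circ> rf \<alpha> \<in> W" using step aR comp_in_W refl_in_W by auto
    show ?case
    proof
      assume wx: "(w \<circ> rf \<alpha>) x = x"
      have "\<alpha> \<in> inversions (w \<circ> rf \<alpha>)"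
        using step simple_Rp refl_self[OF aR] uminus_in_Rp[OF W_R[OF step(1) aR]]
        by (auto simp: inversions_def W_simps)
      then have "B x \<alpha> = 0" using inversions_stabilizer[OF assms ws wx] by blast
      then have a: "\<alpha> \<in> R_perp x" using aR by (simp add: R_perp_def)
      then have "w x = x" using wx fixed by simp
      then have "w \<in> weyl_group B (R_perp x)" using step(4) by (simp add: eta_contract_eq)
      then show "w \<circ> rf \<alpha> \<in> weyl_group B (R_perp x)" using S.comp_in_W S.refl_in_W a by blast
    qed
  qed
  then show "weyl_stabilizer B R x \<subseteq> weyl_group B (R_perp x)" by (auto simp: weyl_stabilizer_def)
qed

lemma Rp_R_perp: "euclidean_root_system.Rp (R_perp x) h = {\<alpha>\<in>Rp. B x \<alpha> = 0}"
proof -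
  interpret S: euclidean_root_system B "R_perp x" h by (rule R_perp_root_system)
  show ?thesis unfolding S.Rp_def by (auto simp: Rp_def R_perp_def)
qed

text \<open>Elements of the stabilizer invert only roots orthogonal to \<open>x\<close>. Hence
  length in the subsystem agrees with length in \<open>W\<close>, and \<open>W_x(t)\<close> is the
  length polynomial of a Weyl group in its own right.\<close>

lemma inversions_R_perp:
  assumes "dom x" "w \<in> weyl_stabilizer B R x"
  shows "euclidean_root_system.inversions (R_perp x) h w = inversions w"
proof -
  interpret S: euclidean_root_system B "R_perp x" h by (rule R_perp_root_system)
  have w: "w \<in> W" "w x = x" using assms(2) by (auto simp: weyl_stabilizer_def)
  have "B x (w \<beta>) = B x \<beta>" for \<beta> using W_isometry[OF w(1), of x \<beta>] w(2) by simp
  then show ?thesis using inversions_stabilizer[OF assms(1) w]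
    unfolding S.inversions_def Rp_R_perp by (auto simp: inversions_def)
qed

lemma stabilizer_image_non_perp:
  assumes "dom x" "w \<in> weyl_stabilizer B R x"
  shows "w ` {\<alpha>\<in>Rp. B x \<alpha> \<noteq> 0} = {\<alpha>\<in>Rp. B x \<alpha> \<noteq> 0}"
proof -
  have w: "w \<in> W" "w x = x" using assms(2) by (auto simp: weyl_stabilizer_def)
  have B: "B x (w \<beta>) = B x \<beta>" for \<beta> using W_isometry[OF w(1), of x \<beta>] w(2) by simp
  have "w \<alpha> \<in> Rp" if "\<alpha> \<in> Rp" "B x \<alpha> \<noteq> 0" for \<alpha>
    using inversions_stabilizer[OF assms(1) w, of \<alpha>] that by (auto simp: inversions_def)
  then have "w ` {\<alpha>\<in>Rp. B x \<alpha> \<noteq> 0} \<subseteq> {\<alpha>\<in>Rp. B x \<alpha> \<noteq> 0}" using B by auto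
  then show ?thesis using finite_Rp inj_W[OF w(1)]
    by (intro endo_inj_surj) auto
qed

lemma weyl_stabilizer_id: "id \<in> weyl_stabilizer B R x"
  using id_in_W by (simp add: weyl_stabilizer_def)

lemma finite_weyl_stabilizer: "finite (weyl_stabilizer B R x)"
  using finite_W by (simp add: weyl_stabilizer_def)

lemma bij_orbit_fibre:
  assumes "u \<in> W"
  shows "bij_betw (\<lambda>v. u \<circ> v) (weyl_stabilizer B R x) {w\<in>W. w x = u x}"
proof (rule bij_betw_byWitness[where f' = "\<lambda>w. inv u \<circ> w"])
  show "\<forall>v\<in>weyl_stabilizer B R x. inv u \<circ> (u \<circ> v) = v"
    using inv_W_eq[OF assms] by (auto simp: fun_eq_iff)
  show "\<forall>w\<in>{w\<in>W. w x = u x}. u \<circ> (inv u \<circ> w) = w"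
    using inv_W_eq[OF assms] by (auto simp: fun_eq_iff)
  show "(\<lambda>v. u \<circ> v) ` weyl_stabilizer B R x \<subseteq> {w\<in>W. w x = u x}"
    using comp_in_W[OF assms] by (auto simp: weyl_stabilizer_def)
  show "(\<lambda>w. inv u \<circ> w) ` {w\<in>W. w x = u x} \<subseteq> weyl_stabilizer B R x"
    using comp_in_W[OF inv_in_W[OF assms]] inv_W_eq[OF assms] by (auto simp: weyl_stabilizer_def)
qed


subsection \<open>Antisymmetric elements\<close>

lemma W_add: "w \<in> W \<Longrightarrow> w (x + y) = w x + w y"
  by (rule W_simps)

lemma inj_W_UNIV: "w \<in> W \<Longrightarrow> inj w"
  by (rule inj_W)

lemma act_mult: "w \<in> W \<Longrightarrow> galg_map_exp w (f * g) = galg_map_exp w f * galg_map_exp w g"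
  for f g :: "('a, 'k::comm_ring_1) galg"
  by (intro galg_map_exp_mult W_simps)

lemma act_prod: "w \<in> W \<Longrightarrow> galg_map_exp w (prod f A) = (\<Prod>i\<in>A. galg_map_exp w (f i))"
  for f :: "'i \<Rightarrow> ('a, 'k::comm_ring_1) galg"
  by (intro galg_map_exp_prod W_simps)

lemma act_one: "w \<in> W \<Longrightarrow> galg_map_exp w (1 :: ('a, 'k::comm_ring_1) galg) = 1"
  by (intro galg_map_exp_one W_simps)

lemma act_const: "w \<in> W \<Longrightarrow> galg_map_exp w (galg_const c :: ('a, 'k::comm_ring_1) galg) = galg_const c"
  by (intro galg_map_exp_const W_simps)

lemma act_sgn: "galg_map_exp u (sgn_W w * f) = sgn_W w * (galg_map_exp u f :: ('a, 'k::comm_ring_1) galg)"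
proof -
  have "galg_map_exp u ((- 1) ^ n * f) = (- 1) ^ n * galg_map_exp u f" for n
    by (induction n) (simp_all add: galg_map_exp_uminus)
  then show ?thesis by (simp add: sgn_W_def)
qed

lemma galg_coeff_sgn: "galg_coeff (sgn_W w * f :: ('a, 'k::comm_ring_1) galg) \<nu> = sgn_W w * galg_coeff f \<nu>"
  by (simp add: sgn_W_def galg_coeff_sign)

lemma galg_coeff_act:
  "w \<in> W \<Longrightarrow> galg_coeff (galg_map_exp w f :: ('a, 'k::comm_ring_1) galg) (w \<mu>) = galg_coeff f \<mu>"
  by (rule galg_coeff_map_exp[OF inj_W_UNIV])

lemma galg_coeff_act_inv:
  "w \<in> W \<Longrightarrow> galg_coeff (galg_map_exp w f :: ('a, 'k::comm_ring_1) galg) \<mu> = galg_coeff f (inv w \<mu>)"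
  using galg_coeff_act[of w f "inv w \<mu>"] by (simp add: inv_W_eq)

lemma galg_on_act: "w \<in> W \<Longrightarrow> f \<in> galg_on \<Lambda> \<Longrightarrow> galg_map_exp w f \<in> galg_on \<Lambda>"
  for f :: "('a, 'k::comm_ring_1) galg"
  unfolding galg_on_iff
  by (metis weights_W galg_coeff_act_inv inv_W_eq(2))

lemma galg_on_sgn: "f \<in> galg_on L \<Longrightarrow> sgn_W w * f \<in> galg_on L"
  for f :: "('a, 'k::comm_ring_1) galg"
  unfolding galg_on_iff by (metis galg_coeff_sgn mult_zero_right)

lemma bij_comp_left: assumes u: "u \<in> W" shows "bij_betw (\<lambda>w. u \<circ> w) W W"
proof (rule bij_betw_byWitness[where f' = "\<lambda>w. inv u \<circ> w"])
  show "\<forall>w\<in>W. inv u \<circ> (u \<circ> w) = w" "\<forall>w\<in>W. u \<circ> (inv u \<circ> w) = w"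
    using inv_W_eq[OF u] by (auto simp: fun_eq_iff)
  show "(\<lambda>w. u \<circ> w) ` W \<subseteq> W" "(\<lambda>w. inv u \<circ> w) ` W \<subseteq> W"
    using comp_in_W u inv_in_W by blast+
qed

lemma bij_comp_right: assumes u: "u \<in> W" shows "bij_betw (\<lambda>w. w \<circ> u) W W"
proof (rule bij_betw_byWitness[where f' = "\<lambda>w. w \<circ> inv u"])
  show "\<forall>w\<in>W. (w \<circ> u) \<circ> inv u = w" "\<forall>w\<in>W. (w \<circ> inv u) \<circ> u = w"
    using inv_W_eq[OF u] by (auto simp: fun_eq_iff)
  show "(\<lambda>w. w \<circ> u) ` W \<subseteq> W" "(\<lambda>w. w \<circ> inv u) ` W \<subseteq> W"
    using comp_in_W u inv_in_W by blast+
qed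

lemma card_W_nonzero: "card W \<noteq> 0"
  using finite_W id_in_W by (metis card_0_eq empty_iff)

definition asym :: "('a, int poly) galg \<Rightarrow> bool" where
  "asym f \<longleftrightarrow> (\<forall>w\<in>W. galg_map_exp w f = sgn_W w * f)"

definition alternate :: "('a, int poly) galg \<Rightarrow> ('a, int poly) galg" where
  "alternate f = (\<Sum>w\<in>W. sgn_W w * galg_map_exp w f)"

lemma act_alternate:
  assumes u: "u \<in> W" shows "galg_map_exp u (alternate f) = sgn_W u * alternate f"
proof -
  have "galg_map_exp u (alternate f) = (\<Sum>w\<in>W. sgn_W w * galg_map_exp (u \<circ> w) f)"
    by (simp add: alternate_def galg_map_exp_sum act_sgn galg_map_exp_comp)
  also have "\<dots> = (\<Sum>w\<in>W. sgn_W u * (sgn_W (u \<circ> w) * galg_map_exp (u \<circ> w) f))"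
    using sgn_comp[OF u, where 'b = "('a, int poly) galg"] sgn_square[of u, where 'b = "('a, int poly) galg"]
    by (intro sum.cong refl) (simp add: mult.assoc[symmetric])
  also have "\<dots> = sgn_W u * (\<Sum>w\<in>W. sgn_W (u \<circ> w) * galg_map_exp (u \<circ> w) f)"
    by (simp add: sum_distrib_left)
  also have "(\<Sum>w\<in>W. sgn_W (u \<circ> w) * galg_map_exp (u \<circ> w) f) = alternate f"
    unfolding alternate_def by (rule sum.reindex_bij_betw[OF bij_comp_left[OF u]])
  finally show ?thesis .
qed

lemma asym_alternate: "asym (alternate f)"
  by (simp add: asym_def act_alternate)

lemma alternate_asym: "asym f \<Longrightarrow> alternate f = of_nat (card W) * f"
  by (simp add: alternate_def asym_def mult.assoc[symmetric] sgn_square)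

lemma asym_diff: "asym f \<Longrightarrow> asym g \<Longrightarrow> asym (f - g)"
  by (simp add: asym_def galg_map_exp_diff algebra_simps)

lemma asym_0: "asym 0"
  by (simp add: asym_def)

lemma asym_add: "asym f \<Longrightarrow> asym g \<Longrightarrow> asym (f + g)"
  by (simp add: asym_def galg_map_exp_add algebra_simps)

lemma asym_sum: "(\<And>i. i \<in> A \<Longrightarrow> asym (f i)) \<Longrightarrow> asym (sum f A)"
  by (induction A rule: infinite_finite_induct) (auto intro: asym_0 asym_add)

lemma asym_mult_invariant:
  assumes "\<And>w. w \<in> W \<Longrightarrow> galg_map_exp w m = m" "asym f" shows "asym (m * f)"
  using assms by (simp add: asym_def act_mult mult.left_commute)

lemma asym_const_mult: "asym f \<Longrightarrow> asym (galg_const c * f)"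
  by (rule asym_mult_invariant) (simp add: act_const)

lemma asym_coeff: "asym f \<Longrightarrow> w \<in> W \<Longrightarrow> galg_coeff f (w \<nu>) = sgn_W w * galg_coeff f \<nu>"
proof -
  assume f: "asym f" and w: "w \<in> W"
  have "galg_coeff f \<nu> = galg_coeff (galg_map_exp w f) (w \<nu>)"
    by (rule galg_coeff_act[OF w, symmetric])
  also have "\<dots> = sgn_W w * galg_coeff f (w \<nu>)" using f w by (simp add: asym_def galg_coeff_sgn)
  finally show ?thesis by (simp add: mult.assoc[symmetric] sgn_square)
qed

text \<open>Any exponent can be moved into the closed chamber at the cost of a sign. On a wall, a
  simple reflection fixes the exponent and negates the coefficient, so twice the coefficient is
  0.\<close>

lemma asym_eqI:
  assumes "asym f" "asym g" "\<And>\<nu>. sdom \<nu> \<Longrightarrow> galg_coeff f \<nu> = galg_coeff g \<nu>"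
  shows "f = g"
proof (rule galg_eqI)
  fix \<mu>
  define d where "d = f - g"
  have d: "asym d" using assms asym_diff by (simp add: d_def)
  obtain w where w: "w \<in> W" "dom (w \<mu>)" using ex_dom by blast
  have "galg_coeff d (w \<mu>) = 0"
  proof (cases "sdom (w \<mu>)")
    case True
    then show ?thesis using assms(3) by (simp add: d_def)
  next
    case False
    then obtain \<alpha> where a: "\<alpha> \<in> \<Delta>" "rf \<alpha> (w \<mu>) = w \<mu>" using dom_not_sdom[OF w(2)] by blast
    have "(sgn_W (rf \<alpha>) :: int poly) = - 1" by (rule sgn_refl_simple[OF a(1)])
    then have "galg_coeff d (w \<mu>) = - galg_coeff d (w \<mu>)"
      using asym_coeff[OF d refl_in_W[OF simple_R[OF a(1)]], of "w \<mu>"] a by simp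
    then have "2 * galg_coeff d (w \<mu>) = 0" by (simp add: eq_neg_iff_add_eq_0 mult_2)
    then show ?thesis by simp
  qed
  then have "sgn_W w * galg_coeff d \<mu> = 0" using asym_coeff[OF d w(1)] by simp
  then have "sgn_W w * (sgn_W w * galg_coeff d \<mu>) = 0" by simp
  then have "galg_coeff d \<mu> = 0" by (simp add: mult.assoc[symmetric] sgn_square)
  then show "galg_coeff f \<mu> = galg_coeff g \<mu>" by (simp add: d_def)
qed

abbreviation "alt \<nu> \<equiv> alternate (galg_monom \<nu> 1)"

lemma alt_eq: "alt \<nu> = (\<Sum>w\<in>W. sgn_W w * galg_monom (w \<nu>) 1)"
  by (simp add: alternate_def galg_map_exp_monom)

lemma alternating_sum_eq: "alternating_sum B R Rp \<nu> = alt \<nu>"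
  by (simp add: alternating_sum_def alt_eq sgn_W_def weyl_length_eq)

text \<open>A strictly dominant vector has trivial stabilizer and its orbit meets the closed chamber
  in one point, so only \<open>w = id\<close> can contribute.\<close>

lemma alt_coeff:
  assumes "sdom \<kappa>" "dom \<nu>"
  shows "galg_coeff (alt \<kappa>) \<nu> = (if \<nu> = \<kappa> then 1 else 0)"
proof -
  have "galg_coeff (alt \<kappa>) \<nu> = (\<Sum>w\<in>W. if w = id then (if \<nu> = \<kappa> then 1 else 0) else 0)"
    unfolding alt_eq galg_coeff_sum
  proof (rule sum.cong[OF refl])
    fix w assume w: "w \<in> W"
    have "\<nu> = w \<kappa> \<longleftrightarrow> w = id \<and> \<nu> = \<kappa>"
      using dom_unique[OF sdom_dom[OF assms(1)] _ w] assms sdom_free[OF assms(1) w] by auto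
    then show "galg_coeff (sgn_W w * galg_monom (w \<kappa>) 1) \<nu> = (if w = id then (if \<nu> = \<kappa> then 1 else 0) else 0)"
      unfolding galg_coeff_sgn galg_coeff_monom by (auto simp: sgn_id simp del: id_apply)
  qed
  then show ?thesis using finite_W id_in_W by simp
qed

lemma asym_expansion:
  assumes "asym f"
  shows "f = (\<Sum>\<nu>\<in>{\<nu>\<in>galg_supp f. sdom \<nu>}. galg_const (galg_coeff f \<nu>) * alt \<nu>)"
proof (rule asym_eqI)
  show "asym f" by fact
  show "asym (\<Sum>\<nu>\<in>{\<nu>\<in>galg_supp f. sdom \<nu>}. galg_const (galg_coeff f \<nu>) * alt \<nu>)"
    by (intro asym_sum asym_const_mult asym_alternate)
  fix \<kappa> assume k: "sdom \<kappa>"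
  have "galg_coeff (\<Sum>\<nu>\<in>{\<nu>\<in>galg_supp f. sdom \<nu>}. galg_const (galg_coeff f \<nu>) * alt \<nu>) \<kappa> =
     (\<Sum>\<nu>\<in>{\<nu>\<in>galg_supp f. sdom \<nu>}. if \<nu> = \<kappa> then galg_coeff f \<kappa> else 0)"
    unfolding galg_coeff_sum using alt_coeff sdom_dom[OF k]
    by (intro sum.cong) (auto simp: galg_coeff_const_mult)
  also have "\<dots> = galg_coeff f \<kappa>"
    using k in_galg_supp[of \<kappa> f] by (subst sum.delta) auto
  finally show "galg_coeff f \<kappa> =
    galg_coeff (\<Sum>\<nu>\<in>{\<nu>\<in>galg_supp f. sdom \<nu>}. galg_const (galg_coeff f \<nu>) * alt \<nu>) \<kappa>" by simp
qed


subsection \<open>Leading terms\<close>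

text \<open>An upper bound for the exponents; \<open>a\<close> itself may have coefficient
  0.\<close>

definition below :: "'a \<Rightarrow> ('a, 'k::comm_ring_1) galg \<Rightarrow> bool" where
  "below a f \<longleftrightarrow> (\<forall>\<mu>. galg_coeff f \<mu> \<noteq> 0 \<longrightarrow> a - \<mu> \<in> poscone)"

text \<open>Since the cone is pointed, the top exponent \<open>a + b\<close> arises only from the
  pair of \<open>a\<close> and \<open>b\<close>, so leading coefficients multiply.\<close>

lemma below_mult:
  fixes f g :: "('a, 'k::comm_ring_1) galg"
  assumes "below a f" "below b g"
  shows "below (a + b) (f * g)" "galg_coeff (f * g) (a + b) = galg_coeff f a * galg_coeff g b"
proof -
  show "below (a + b) (f * g)" unfolding below_def
  proof (intro allI impI)
    fix \<nu> assume "galg_coeff (f * g) \<nu> \<noteq> 0"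
    then obtain \<mu> where "galg_coeff f \<mu> \<noteq> 0" "galg_coeff g (\<nu> - \<mu>) \<noteq> 0" by (rule galg_supp_mult)
    then have "(a - \<mu>) + (b - (\<nu> - \<mu>)) \<in> poscone" using assms by (intro poscone_add) (auto simp: below_def)
    then show "a + b - \<nu> \<in> poscone" by (simp add: algebra_simps)
  qed
  have "galg_coeff f \<mu> * galg_coeff g (a + b - \<mu>) = 0" if "\<mu> \<noteq> a" for \<mu>
  proof (rule ccontr)
    assume "\<not> ?thesis"
    then have "galg_coeff f \<mu> \<noteq> 0" "galg_coeff g (a + b - \<mu>) \<noteq> 0" by auto
    then have "a - \<mu> \<in> poscone" "b - (a + b - \<mu>) \<in> poscone" using assms by (auto simp: below_def)
    then have "a - \<mu> = 0" by (intro poscone_uminus) auto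
    then show False using that by simp
  qed
  then have "galg_coeff (f * g) (a + b) =
      (\<Sum>\<mu>\<in>galg_supp f. if \<mu> = a then galg_coeff f a * galg_coeff g b else 0)"
    unfolding galg_coeff_mult by (intro sum.cong) auto
  also have "\<dots> = galg_coeff f a * galg_coeff g b" by (simp add: in_galg_supp)
  finally show "galg_coeff (f * g) (a + b) = galg_coeff f a * galg_coeff g b" .
qed

lemma below_monom: "below a (galg_monom a c)"
  by (simp add: below_def galg_coeff_monom poscone_0)

lemma below_alt: "dom \<kappa> \<Longrightarrow> below \<kappa> (alt \<kappa>)"
  unfolding below_def
proof (intro allI impI)
  fix \<mu> assume k: "dom \<kappa>" and "galg_coeff (alt \<kappa>) \<mu> \<noteq> 0"
  then obtain w where w: "w \<in> W" "galg_coeff (sgn_W w * galg_monom (w \<kappa>) 1 :: ('a, int poly) galg) \<mu> \<noteq> 0"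
    unfolding alt_eq galg_coeff_sum by (meson sum.not_neutral_contains_not_neutral)
  then have "\<mu> = w \<kappa>" by (auto simp: galg_coeff_sgn galg_coeff_monom split: if_splits)
  then show "\<kappa> - \<mu> \<in> poscone" using dom_diff[OF k w(1)] by simp
qed

lemma euler_prod_expand:
  "finite A \<Longrightarrow> euler_prod A c = (\<Sum>S\<in>Pow A. galg_monom (- \<Sum>S) ((- c) ^ card S))"
  using galg_prod_binomial[of A "\<lambda>_. 1" "\<lambda>_. - c"]
  by (simp add: euler_prod_def galg_one galg_monom_uminus)

lemma euler_prod_lead:
  assumes "A \<subseteq> Rp"
  shows "below 0 (euler_prod A c)" "galg_coeff (euler_prod A c) 0 = 1"
proof -
  have fA: "finite A" using assms finite_Rp finite_subset by blast
  show "below 0 (euler_prod A c)" unfolding below_def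
  proof (intro allI impI)
    fix \<mu> assume "galg_coeff (euler_prod A c) \<mu> \<noteq> 0"
    then obtain S where "S \<in> Pow A" "galg_coeff (galg_monom (- \<Sum>S) ((- c) ^ card S)) \<mu> \<noteq> 0"
      unfolding euler_prod_expand[OF fA] galg_coeff_sum by (meson sum.not_neutral_contains_not_neutral)
    then show "0 - \<mu> \<in> poscone"
      using poscone_sum_roots[of S] assms by (auto simp: galg_coeff_monom split: if_splits)
  qed
  have "galg_coeff (euler_prod A c) 0 = (\<Sum>S\<in>Pow A. if S = {} then 1 else 0)"
    unfolding euler_prod_expand[OF fA] galg_coeff_sum
  proof (rule sum.cong[OF refl])
    fix S assume "S \<in> Pow A"
    then have "\<Sum>S = 0 \<Longrightarrow> S = {}" using sum_roots_eq_0[of S] assms by auto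
    then show "galg_coeff (galg_monom (- \<Sum>S) ((- c) ^ card S)) 0 = (if S = {} then 1 else 0)"
      by (auto simp: galg_coeff_monom)
  qed
  then show "galg_coeff (euler_prod A c) 0 = 1" using fA by simp
qed


subsection \<open>Macdonald's identity and the Weyl denominator formula\<close>

text \<open>The image under \<open>w\<close> of \<open>\<Prod> (1 - c x\<^sup>-\<^sup>\<beta>)\<close> over the positive roots, up to a shift by
  \<open>\<rho> - w \<rho>\<close> that makes all its exponents nonpositive.\<close>

definition twisted_prod :: "('a \<Rightarrow> 'a) \<Rightarrow> int poly \<Rightarrow> ('a, int poly) galg" where
  "twisted_prod w c =
    (\<Prod>\<beta>\<in>Rp. if inv w \<beta> \<in> Rp then 1 - galg_monom (- \<beta>) c else galg_monom (- \<beta>) 1 - galg_monom 0 c)"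

text \<open>The exponent of \<open>w x^\<rho>\<close> is \<open>\<rho>\<close> minus the roots
  \<open>\<beta>\<close> whose factor has become \<open>1 - c x^\<beta>\<close>. Absorbing one such
  \<open>x^-\<beta>\<close> into each of these factors gives \<open>x^-\<beta> - c\<close>.\<close>

lemma act_euler_prod:
  assumes w: "w \<in> W"
  shows "galg_map_exp w (galg_monom \<rho> 1 * euler_prod Rp c) = galg_monom \<rho> 1 * twisted_prod w c"
proof -
  have "galg_map_exp w (euler_prod Rp c) = (\<Prod>\<alpha>\<in>Rp. 1 - galg_monom (- w \<alpha>) c)"
    by (simp add: euler_prod_def act_prod[OF w] galg_map_exp_diff act_one[OF w] galg_map_exp_monom W_simps[OF w])
  also have "\<dots> = (\<Prod>\<beta>\<in>Rp. 1 - galg_monom (- w (signed_perm w \<beta>)) c)"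
    by (rule prod.reindex_bij_betw[OF bij_signed_perm[OF w], symmetric])
  finally have 1: "galg_map_exp w (euler_prod Rp c) = \<dots>" .
  have "w \<rho> = \<rho> + (\<Sum>\<beta>\<in>Rp. if inv w \<beta> \<notin> Rp then - \<beta> else 0)"
    using finite_Rp by (simp add: W_rho[OF w] inversions_def sum_negf flip: sum.inter_filter)
  then have "galg_monom (w \<rho>) 1 = galg_monom \<rho> 1 * (\<Prod>\<beta>\<in>Rp. galg_monom (if inv w \<beta> \<notin> Rp then - \<beta> else 0) (1 :: int poly))"
    using finite_Rp by (simp add: galg_monom_prod galg_monom_mult)
  then have "galg_map_exp w (galg_monom \<rho> 1 * euler_prod Rp c) = galg_monom \<rho> 1 *
      ((\<Prod>\<beta>\<in>Rp. galg_monom (if inv w \<beta> \<notin> Rp then - \<beta> else 0) (1 :: int poly)) *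
       (\<Prod>\<beta>\<in>Rp. 1 - galg_monom (- w (signed_perm w \<beta>)) c))"
    by (simp add: act_mult[OF w] galg_map_exp_monom 1 mult.assoc)
  also have "(\<Prod>\<beta>\<in>Rp. galg_monom (if inv w \<beta> \<notin> Rp then - \<beta> else 0) (1 :: int poly)) *
       (\<Prod>\<beta>\<in>Rp. 1 - galg_monom (- w (signed_perm w \<beta>)) c) = twisted_prod w c"
    unfolding twisted_prod_def prod.distrib[symmetric]
    by (intro prod.cong refl) (auto simp: W_signed_perm[OF w] galg_one galg_monom_mult right_diff_distrib)
  finally show ?thesis .
qed

lemma twisted_prod_expand:
  "twisted_prod w c = (\<Sum>S\<in>Pow Rp. galg_monom (- \<Sum>S)
     ((\<Prod>\<beta>\<in>Rp - S. if inv w \<beta> \<in> Rp then 1 else - c) * (\<Prod>\<beta>\<in>S. if inv w \<beta> \<in> Rp then - c else 1)))"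
proof -
  have "twisted_prod w c = (\<Prod>\<beta>\<in>Rp. galg_monom 0 (if inv w \<beta> \<in> Rp then 1 else - c) +
      galg_monom (- \<beta>) (if inv w \<beta> \<in> Rp then - c else 1))"
    unfolding twisted_prod_def by (intro prod.cong refl) (auto simp: galg_one galg_monom_uminus)
  then show ?thesis unfolding galg_prod_binomial[OF finite_Rp] .
qed

lemma twisted_prod_supp:
  assumes "galg_coeff (twisted_prod w c) \<mu> \<noteq> 0" obtains S where "S \<subseteq> Rp" "\<mu> = - \<Sum>S"
proof -
  from assms obtain S where "S \<in> Pow Rp" "galg_coeff (galg_monom (- \<Sum>S)
     ((\<Prod>\<beta>\<in>Rp - S. if inv w \<beta> \<in> Rp then 1 else - c) * (\<Prod>\<beta>\<in>S. if inv w \<beta> \<in> Rp then - c else 1))) \<mu> \<noteq> 0"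
    unfolding twisted_prod_expand galg_coeff_sum by (meson sum.not_neutral_contains_not_neutral)
  then show ?thesis using that by (auto simp: galg_coeff_monom split: if_splits)
qed

text \<open>Only the empty \<open>S\<close> has sum 0, and it takes the constant term
  \<open>- c\<close> from each factor that has changed sign.\<close>

lemma twisted_prod_coeff_0:
  assumes w: "w \<in> W" shows "galg_coeff (twisted_prod w c) 0 = (- c) ^ card (inversions w)"
proof -
  have "galg_coeff (twisted_prod w c) 0 =
      (\<Sum>S\<in>Pow Rp. if S = {} then \<Prod>\<beta>\<in>Rp. if inv w \<beta> \<in> Rp then 1 else - c else 0)"
    unfolding twisted_prod_expand galg_coeff_sum
    using sum_roots_eq_0 by (intro sum.cong) (auto simp: galg_coeff_monom)
  also have "\<dots> = (\<Prod>\<beta>\<in>Rp. if inv w \<beta> \<notin> Rp then - c else 1)"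
    using finite_Rp by (simp add: if_distrib cong: if_cong prod.cong) (intro prod.cong; simp)
  also have "\<dots> = (- c) ^ card (inversions (inv w))"
    using finite_Rp by (simp add: inversions_def flip: prod.inter_filter)
  finally show ?thesis by (simp add: card_inversions_inv[OF w])
qed

lemma sgn_mult_power: "sgn_W w * (- c) ^ card (inversions w) = (c ^ card (inversions w) :: int poly)"
  by (simp add: sgn_W_def power_mult_distrib[symmetric])

theorem macdonald_identity:
  "alternate (galg_monom \<rho> 1 * euler_prod Rp c) =
    galg_const (\<Sum>w\<in>W. c ^ card (inversions w)) * alt \<rho>"
proof (rule asym_eqI)
  show "asym (alternate (galg_monom \<rho> 1 * euler_prod Rp c))" by (rule asym_alternate)
  show "asym (galg_const (\<Sum>w\<in>W. c ^ card (inversions w)) * alt \<rho>)"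
    by (intro asym_const_mult asym_alternate)
  fix \<nu> assume nu: "sdom \<nu>"
  have L: "galg_coeff (alternate (galg_monom \<rho> 1 * euler_prod Rp c)) \<nu> =
      (\<Sum>w\<in>W. sgn_W w * galg_coeff (twisted_prod w c) (\<nu> - \<rho>))"
    by (simp add: alternate_def act_euler_prod galg_coeff_sgn galg_coeff_monom_mult)
  show "galg_coeff (alternate (galg_monom \<rho> 1 * euler_prod Rp c)) \<nu> =
    galg_coeff (galg_const (\<Sum>w\<in>W. c ^ card (inversions w)) * alt \<rho>) \<nu>"
  proof (cases "\<nu> = \<rho>")
    case True
    then show ?thesis unfolding L
      by (simp add: twisted_prod_coeff_0 sgn_mult_power galg_coeff_const_mult alt_coeff sdom_rho sdom_dom)
  next
    case False
    have "galg_coeff (twisted_prod w c) (\<nu> - \<rho>) = 0" for w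
    proof (rule ccontr)
      assume "\<not> ?thesis"
      then obtain S where S: "S \<subseteq> Rp" "\<nu> - \<rho> = - \<Sum>S" by (rule twisted_prod_supp)
      then have "\<nu> = \<rho> - \<Sum>S" by (simp add: algebra_simps)
      then show False using sdom_rho_minus_sum[OF S(1)] nu False by auto
    qed
    then show ?thesis unfolding L
      using False by (simp add: galg_coeff_const_mult alt_coeff sdom_rho sdom_dom[OF nu])
  qed
qed

text \<open>At \<open>c = 1\<close> the two kinds of factors in \<open>twisted_prod\<close> differ
  only by a sign, and the number of signs is the length.\<close>

lemma act_denominator:
  assumes w: "w \<in> W"
  shows "galg_map_exp w (galg_monom \<rho> 1 * euler_prod Rp 1) = sgn_W w * (galg_monom \<rho> 1 * euler_prod Rp 1)"
proof -
  have "twisted_prod w 1 = (\<Prod>\<beta>\<in>Rp. (if inv w \<beta> \<notin> Rp then - 1 else 1) * (1 - galg_monom (- \<beta>) 1))"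
    unfolding twisted_prod_def by (intro prod.cong refl) (simp add: galg_one[symmetric])
  also have "\<dots> = (\<Prod>\<beta>\<in>Rp. if inv w \<beta> \<notin> Rp then - 1 else 1) * euler_prod Rp 1"
    by (simp add: prod.distrib euler_prod_def)
  also have "(\<Prod>\<beta>\<in>Rp. if inv w \<beta> \<notin> Rp then - 1 else 1) = (sgn_W (inv w) :: ('a, int poly) galg)"
    using finite_Rp by (simp add: sgn_W_def inversions_def flip: prod.inter_filter)
  finally show ?thesis by (simp add: act_euler_prod[OF w] sgn_inv[OF w] mult.left_commute)
qed

text \<open>At \<open>c = 1\<close> the product is already antisymmetric, so alternating it
  multiplies it by |W|; the coefficient in \<open>macdonald_identity\<close> is then |W| as well and
  cancels.\<close>

theorem weyl_denominator: "alt \<rho> = galg_monom \<rho> 1 * euler_prod Rp 1"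
proof -
  let ?D = "galg_monom \<rho> 1 * euler_prod Rp 1"
  have "asym ?D" by (simp add: asym_def act_denominator)
  then have "of_nat (card W) * ?D = galg_const (of_nat (card W)) * alt \<rho>"
    using macdonald_identity[of 1] by (simp add: alternate_asym)
  then have "of_nat (card W) * (alt \<rho> - ?D) = 0"
    unfolding galg_const_of_nat right_diff_distrib by (simp only: diff_self)
  then have "alt \<rho> - ?D = 0" using card_W_nonzero by (rule galg_of_nat_mult_eq_0)
  then show ?thesis by simp
qed

lemma alt_rho_nonzero: "alt \<rho> \<noteq> 0"
  using alt_coeff[OF sdom_rho sdom_dom[OF sdom_rho]] by (metis galg_coeff_arith(4) zero_neq_one)


subsection \<open>Divisibility by the Weyl denominator\<close>

text \<open>Pairing with the sum of the positive coroots, twice the \<open>\<rho>\<close> of the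
  dual system. Unlike \<open>h\<close> it is integral on weights, and it is positive on the cone, so
  it can serve as an induction measure.\<close>

definition height :: "'a \<Rightarrow> real" where "height x = (\<Sum>\<alpha>\<in>Rp. pair x \<alpha>)"

lemma height_sum: "height (\<Sum>i\<in>A. c i *\<^sub>R f i) = (\<Sum>i\<in>A. c i * height (f i))"
  unfolding height_def pair_sum pair_simps by (subst sum.swap) (simp add: sum_distrib_left)

lemma height_diff: "height (x - y) = height x - height y"
  by (simp add: height_def pair_simps sum_subtractf)

text \<open>The reflection \<open>rf \<alpha>\<close> permutes the other positive roots and negates
  \<open>\<alpha>\<close>, so their contribution equals its own negative;
  \<open>pair \<alpha> \<alpha> = 2\<close> is left.\<close>

lemma height_simple: assumes "\<alpha> \<in> \<Delta>" shows "height \<alpha> = 2"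
proof -
  have a: "\<alpha> \<in> R" "\<alpha> \<in> Rp" using assms simple_R simple_Rp by auto
  define T where "T = (\<Sum>\<beta>\<in>Rp - {\<alpha>}. pair \<alpha> \<beta>)"
  have "rf \<alpha> ` (Rp - {\<alpha>}) \<subseteq> Rp - {\<alpha>}"
  proof
    fix \<gamma> assume "\<gamma> \<in> rf \<alpha> ` (Rp - {\<alpha>})"
    then obtain \<beta> where b: "\<beta> \<in> Rp" "\<beta> \<noteq> \<alpha>" "\<gamma> = rf \<alpha> \<beta>" by blast
    have "\<gamma> \<noteq> \<alpha>"
    proof
      assume "\<gamma> = \<alpha>"
      then have "\<beta> = - \<alpha>" using refl_refl[OF a(1), of \<beta>] refl_self[OF a(1)] b by simp
      then show False using b a uminus_in_Rp by auto
    qed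
    then show "\<gamma> \<in> Rp - {\<alpha>}" using simple_refl_Rp[OF assms] b by simp
  qed
  then have "bij_betw (rf \<alpha>) (Rp - {\<alpha>}) (Rp - {\<alpha>})"
    using endo_inj_surj[of "Rp - {\<alpha>}" "rf \<alpha>"] finite_Rp inj_W[OF refl_in_W[OF a(1)]]
    by (auto simp: bij_betw_def)
  then have "T = (\<Sum>\<beta>\<in>Rp - {\<alpha>}. pair \<alpha> (rf \<alpha> \<beta>))"
    unfolding T_def by (rule sum.reindex_bij_betw[symmetric])
  also have "\<dots> = (\<Sum>\<beta>\<in>Rp - {\<alpha>}. - pair \<alpha> \<beta>)"
  proof (rule sum.cong[OF refl])
    fix \<beta>
    have "pair \<alpha> (rf \<alpha> \<beta>) = pair (rf \<alpha> \<alpha>) \<beta>"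
      using pair_W[OF refl_in_W[OF a(1)], of "rf \<alpha> \<alpha>" \<beta>] refl_refl[OF a(1), of \<alpha>] by simp
    then show "pair \<alpha> (rf \<alpha> \<beta>) = - pair \<alpha> \<beta>" by (simp add: refl_self[OF a(1)] pair_simps)
  qed
  also have "\<dots> = - T" by (simp add: T_def sum_negf)
  finally have "T = 0" by simp
  then show ?thesis using a finite_Rp pair_self[OF a(1)]
    by (simp add: height_def sum.remove[of _ \<alpha>] T_def)
qed

lemma height_pos: assumes "x \<in> poscone" "x \<noteq> 0" shows "height x > 0"
proof -
  have pos: "height \<beta> > 0" if b: "\<beta> \<in> Rp" for \<beta>
  proof -
    obtain c where c: "\<And>\<delta>. c \<delta> \<ge> (0::real)" "\<beta> = (\<Sum>\<delta>\<in>\<Delta>. c \<delta> *\<^sub>R \<delta>)"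
      using Rp_simple_combination[OF b] by blast
    obtain \<gamma> where g: "\<gamma> \<in> \<Delta>" "c \<gamma> \<noteq> 0"
      using c(2) root_nonzero[OF Rp_R[OF b]] by (metis (no_types, lifting) scaleR_zero_left sum.neutral)
    have "0 < (\<Sum>\<delta>\<in>\<Delta>. c \<delta> * height \<delta>)"
    proof (rule sum_pos2[OF finite_simple g(1)])
      show "0 < c \<gamma> * height \<gamma>" using g c(1)[of \<gamma>] by (simp add: height_simple)
      show "0 \<le> c i * height i" if "i \<in> \<Delta>" for i using c(1) that by (simp add: height_simple)
    qed
    also have "\<dots> = height \<beta>" using height_sum[of c "\<lambda>\<delta>. \<delta>" \<Delta>] c(2) by simp
    finally show ?thesis .
  qed
  obtain c where c: "\<forall>\<alpha>. c \<alpha> \<ge> (0::real)" "x = (\<Sum>\<alpha>\<in>Rp. c \<alpha> *\<^sub>R \<alpha>)"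
    using assms(1) by (auto simp: poscone_def)
  obtain \<gamma> where g: "\<gamma> \<in> Rp" "c \<gamma> \<noteq> 0"
    using c(2) assms(2) by (metis (no_types, lifting) scaleR_zero_left sum.neutral)
  have "0 < (\<Sum>\<alpha>\<in>Rp. c \<alpha> * height \<alpha>)"
  proof (rule sum_pos2[OF finite_Rp g(1)])
    show "0 < c \<gamma> * height \<gamma>" using g c(1) pos[OF g(1)] by (simp add: order_less_le)
    show "0 \<le> c i * height i" if "i \<in> Rp" for i using c(1) pos[OF that] by simp
  qed
  then show ?thesis by (simp add: c(2) height_sum)
qed

lemma height_int: "x \<in> \<Lambda> \<Longrightarrow> height x \<in> \<int>"
  using Rp_R unfolding height_def weight_lattice_def by (intro Ints_sum) auto

lemma height_dom: "dom x \<Longrightarrow> height x \<ge> 0"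
  using Rp_R pair_nonneg_iff unfolding height_def dom_def by (intro sum_nonneg) auto

section \<open>Orbit sums and division by triangularity\<close>

lemma finite_orbit: "finite ((\<lambda>w. w x) ` W)"
  using finite_W by simp

lemma orbit_sum_coeff: "galg_coeff (orbit_sum B R x) \<mu> = (if \<mu> \<in> (\<lambda>w. w x) ` W then 1 else 0)"
  unfolding orbit_sum_def galg_coeff_sum galg_coeff_monom using finite_orbit[of x] by simp

lemma W_orbit: assumes u: "u \<in> W" shows "bij_betw u ((\<lambda>w. w x) ` W) ((\<lambda>w. w x) ` W)"
proof -
  have "u ` ((\<lambda>w. w x) ` W) \<subseteq> (\<lambda>w. w x) ` W"
  proof (intro image_subsetI)
    fix \<gamma> assume "\<gamma> \<in> (\<lambda>w. w x) ` W"
    then obtain w where "w \<in> W" "\<gamma> = w x" by blast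
    then show "u \<gamma> \<in> (\<lambda>w. w x) ` W"
      using comp_in_W[OF u] by (intro image_eqI[of _ _ "u \<circ> w"]) auto
  qed
  then show ?thesis
    using endo_inj_surj[OF finite_orbit] inj_W[OF u] by (auto simp: bij_betw_def)
qed

lemma act_orbit_sum: assumes u: "u \<in> W" shows "galg_map_exp u (orbit_sum B R x) = orbit_sum B R x"
proof -
  have "galg_map_exp u (orbit_sum B R x) = (\<Sum>\<gamma>\<in>(\<lambda>w. w x) ` W. galg_monom (u \<gamma>) 1)"
    by (simp add: orbit_sum_def galg_map_exp_sum galg_map_exp_monom)
  also have "\<dots> = orbit_sum B R x"
    unfolding orbit_sum_def by (rule sum.reindex_bij_betw[OF W_orbit[OF u]])
  finally show ?thesis .
qed

lemma below_orbit_sum: "dom x \<Longrightarrow> below x (orbit_sum B R x)"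
  by (auto simp: below_def orbit_sum_coeff dom_diff split: if_splits)

lemma galg_on_orbit_sum: "x \<in> \<Lambda> \<Longrightarrow> orbit_sum B R x \<in> galg_on \<Lambda>"
  by (auto simp: galg_on_iff orbit_sum_coeff weights_W split: if_splits)

lemma galg_on_alt: "x \<in> \<Lambda> \<Longrightarrow> alt x \<in> galg_on \<Lambda>"
  unfolding alternate_def by (intro galg_on_sum galg_on_sgn galg_on_act galg_on_monom)

text \<open>Subtracting \<open>m * alt \<rho>\<close>, with \<open>m\<close> the orbit sum of
  \<open>\<kappa> - \<rho>\<close>, cancels the leading term of \<open>alt \<kappa>\<close>. The
  difference is again antisymmetric, hence a combination of \<open>alt \<nu>\<close> with
  \<open>\<nu>\<close> strictly dominant of smaller height.\<close>

lemma alt_divisible: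
  assumes "sdom \<kappa>" "\<kappa> \<in> \<Lambda>"
  shows "\<exists>s\<in>galg_on \<Lambda>. alt \<kappa> = alt \<rho> * s"
  using assms
proof (induction "nat \<lfloor>height \<kappa>\<rfloor>" arbitrary: \<kappa> rule: less_induct)
  case less
  define x where "x = \<kappa> - \<rho>"
  define m :: "('a, int poly) galg" where "m = orbit_sum B R x"
  define g where "g = alt \<kappa> - m * alt \<rho>"
  have x: "dom x" "x \<in> \<Lambda>" using sdom_minus_rho less.prems weights_diff rho_weight by (auto simp: x_def)
  have lead: "below (x + \<rho>) (m * alt \<rho>)" "galg_coeff (m * alt \<rho>) (x + \<rho>) = 1"
    using below_mult[OF below_orbit_sum[OF x(1)] below_alt[OF sdom_dom[OF sdom_rho]]]
      alt_coeff[OF sdom_rho sdom_dom[OF sdom_rho]] image_eqI[of x "\<lambda>w. w x" id W] id_in_W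
    by (simp_all add: m_def orbit_sum_coeff)
  have m: "m \<in> galg_on \<Lambda>" using galg_on_orbit_sum[OF x(2)] by (simp add: m_def)
  have g: "asym g" "g \<in> galg_on \<Lambda>"
    using m less.prems unfolding g_def
    by (auto intro!: asym_diff asym_alternate asym_mult_invariant galg_on_diff galg_on_alt
        galg_on_mult[OF weights_add] rho_weight simp: m_def act_orbit_sum)
  have "\<exists>s\<in>galg_on \<Lambda>. alt \<nu> = alt \<rho> * s" if n: "\<nu> \<in> galg_supp g" "sdom \<nu>" for \<nu>
  proof (rule less.hyps)
    have c: "galg_coeff g \<nu> \<noteq> 0" using n(1) by (simp add: in_galg_supp)
    then show nP: "\<nu> \<in> \<Lambda>" using g(2) unfolding galg_on_iff by blast
    have "\<nu> \<noteq> \<kappa>"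
      using c lead(2) alt_coeff[OF less.prems(1) sdom_dom[OF less.prems(1)]] by (auto simp: g_def x_def)
    moreover have "galg_coeff (m * alt \<rho>) \<nu> \<noteq> 0"
      using c alt_coeff[OF less.prems(1) sdom_dom[OF n(2)]] \<open>\<nu> \<noteq> \<kappa>\<close> by (auto simp: g_def)
    then have "\<kappa> - \<nu> \<in> poscone" using lead(1) by (simp add: below_def x_def)
    ultimately have "height \<nu> < height \<kappa>" using height_pos[of "\<kappa> - \<nu>"] by (simp add: height_diff)
    \<comment> \<open>Both heights are integers and that of \<open>\<nu>\<close> is nonnegative, so
      rounding to a natural number keeps the inequality strict.\<close>
    then show "nat \<lfloor>height \<nu>\<rfloor> < nat \<lfloor>height \<kappa>\<rfloor>"
      using height_int[OF nP] height_int[OF less.prems(2)] height_dom[OF sdom_dom[OF n(2)]]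
      by (auto elim!: Ints_cases)
  qed fact
  then obtain s where s: "\<And>\<nu>. \<nu> \<in> galg_supp g \<Longrightarrow> sdom \<nu> \<Longrightarrow> s \<nu> \<in> galg_on \<Lambda> \<and> alt \<nu> = alt \<rho> * s \<nu>"
    by metis
  define q where "q = (\<Sum>\<nu>\<in>{\<nu>\<in>galg_supp g. sdom \<nu>}. galg_const (galg_coeff g \<nu>) * s \<nu>)"
  have "g = (\<Sum>\<nu>\<in>{\<nu>\<in>galg_supp g. sdom \<nu>}. galg_const (galg_coeff g \<nu>) * alt \<nu>)"
    by (rule asym_expansion[OF g(1)])
  also have "\<dots> = (\<Sum>\<nu>\<in>{\<nu>\<in>galg_supp g. sdom \<nu>}. galg_const (galg_coeff g \<nu>) * (alt \<rho> * s \<nu>))"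
  proof (rule sum.cong[OF refl])
    fix \<nu> assume "\<nu> \<in> {\<nu>\<in>galg_supp g. sdom \<nu>}"
    then have e: "alt \<nu> = alt \<rho> * s \<nu>" using s by blast
    show "galg_const (galg_coeff g \<nu>) * alt \<nu> = galg_const (galg_coeff g \<nu>) * (alt \<rho> * s \<nu>)"
      by (simp only: e)
  qed
  also have "\<dots> = alt \<rho> * q"
    by (simp add: q_def sum_distrib_left mult.left_commute)
  finally have "alt \<kappa> = alt \<rho> * (m + q)" by (simp add: g_def algebra_simps)
  moreover have "m + q \<in> galg_on \<Lambda>"
    using m s unfolding q_def by (intro galg_on_add galg_on_sum galg_on_const_mult) auto
  ultimately show ?case by blast
qed

lemma asym_divisible:
  assumes "asym f" "f \<in> galg_on \<Lambda>"
  shows "\<exists>s\<in>galg_on \<Lambda>. f = alt \<rho> * s"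
proof -
  have "\<exists>s\<in>galg_on \<Lambda>. alt \<nu> = alt \<rho> * s" if "\<nu> \<in> galg_supp f" "sdom \<nu>" for \<nu>
    using alt_divisible that assms(2) by (auto simp: galg_on_def)
  then obtain s where s: "\<And>\<nu>. \<nu> \<in> galg_supp f \<Longrightarrow> sdom \<nu> \<Longrightarrow> s \<nu> \<in> galg_on \<Lambda> \<and> alt \<nu> = alt \<rho> * s \<nu>"
    by metis
  define q where "q = (\<Sum>\<nu>\<in>{\<nu>\<in>galg_supp f. sdom \<nu>}. galg_const (galg_coeff f \<nu>) * s \<nu>)"
  have "f = (\<Sum>\<nu>\<in>{\<nu>\<in>galg_supp f. sdom \<nu>}. galg_const (galg_coeff f \<nu>) * alt \<nu>)"
    by (rule asym_expansion[OF assms(1)])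
  also have "\<dots> = (\<Sum>\<nu>\<in>{\<nu>\<in>galg_supp f. sdom \<nu>}. galg_const (galg_coeff f \<nu>) * (alt \<rho> * s \<nu>))"
  proof (rule sum.cong[OF refl])
    fix \<nu> assume "\<nu> \<in> {\<nu>\<in>galg_supp f. sdom \<nu>}"
    then have e: "alt \<nu> = alt \<rho> * s \<nu>" using s by blast
    show "galg_const (galg_coeff f \<nu>) * alt \<nu> = galg_const (galg_coeff f \<nu>) * (alt \<rho> * s \<nu>)"
      by (simp only: e)
  qed
  also have "\<dots> = alt \<rho> * q"
    by (simp add: q_def sum_distrib_left mult.left_commute)
  finally have "f = alt \<rho> * q" .
  moreover have "q \<in> galg_on \<Lambda>"
    using s unfolding q_def by (intro galg_on_sum galg_on_const_mult) auto
  ultimately show ?thesis by blast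
qed

lemma dominant_weights_iff: "x \<in> dominant_weights B R Rp \<longleftrightarrow> x \<in> \<Lambda> \<and> dom x"
  using pair_nonneg_iff[OF Rp_R] by (auto simp: dominant_weights_def dom_def)

lemma weyl_character_mult_denominator:
  assumes "x \<in> \<Lambda>" "dom x"
  shows "weyl_character B R Rp x * alt \<rho> = alt (x + \<rho>)"
proof -
  have "\<exists>s\<in>galg_on \<Lambda>. alt (x + \<rho>) = alt \<rho> * s"
    using assms by (intro alt_divisible dom_sdom_add sdom_rho weights_add rho_weight)
  then obtain s where s: "s \<in> galg_on \<Lambda>" "alt (x + \<rho>) = alt \<rho> * s" by blast
  have "weyl_character B R Rp x = s"
    unfolding weyl_character_def alternating_sum_eq
    by (rule integral_fract_eqI[OF s(1)]) (simp_all add: s(2) alt_rho_nonzero)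
  then show ?thesis using s(2) by (simp add: mult.commute)
qed


subsection \<open>Reduction to the stabilizer\<close>

lemma euler_prod_Un:
  "finite A \<Longrightarrow> finite C \<Longrightarrow> A \<inter> C = {} \<Longrightarrow> euler_prod (A \<union> C) c = euler_prod A c * euler_prod C c"
  unfolding euler_prod_def by (rule prod.union_disjoint)

text \<open>What remains of \<open>x^(x+\<rho>) \<Prod> (1 - c x^-\<alpha>)\<close> after
  alternating over the stabilizer of \<open>x\<close> and dividing by \<open>W_x(c)\<close>: at the
  roots orthogonal to \<open>x\<close> the parameter has become 1.\<close>

definition numerator :: "'a \<Rightarrow> int poly \<Rightarrow> ('a, int poly) galg" where
  "numerator x c = galg_monom (x + \<rho>) 1 *
     (euler_prod {\<alpha>\<in>Rp. B x \<alpha> \<noteq> 0} c * euler_prod {\<alpha>\<in>Rp. B x \<alpha> = 0} 1)"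

text \<open>Let \<open>N\<close> and \<open>Z\<close> be the positive roots not orthogonal and
  orthogonal to \<open>x\<close>. Then \<open>\<rho> = rho N + rho Z\<close>, and the factor
  \<open>G\<close> built from \<open>x\<close> and \<open>N\<close> is fixed by the stabilizer,
  which permutes \<open>N\<close>. The other factor is the product treated by
  \<open>macdonald_identity\<close> and \<open>act_denominator\<close> for the subsystem.\<close>

lemma
  assumes x: "dom x"
  shows sum_stabilizer: "(\<Sum>v\<in>weyl_stabilizer B R x.
        sgn_W v * galg_map_exp v (galg_monom (x + \<rho>) 1 * euler_prod Rp c)) =
      galg_const (\<Sum>v\<in>weyl_stabilizer B R x. c ^ card (inversions v)) * numerator x c"
    and act_numerator: "v \<in> weyl_stabilizer B R x \<Longrightarrow>
      galg_map_exp v (numerator x c) = sgn_W v * numerator x c"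
proof -
  interpret S: euclidean_root_system B "R_perp x" h by (rule R_perp_root_system)
  define N where "N = {\<alpha>\<in>Rp. B x \<alpha> \<noteq> 0}"
  define Z where "Z = {\<alpha>\<in>Rp. B x \<alpha> = 0}"
  have NZ: "Rp = N \<union> Z" "N \<inter> Z = {}" "finite N" "finite Z" using finite_Rp by (auto simp: N_def Z_def)
  have SRp: "S.Rp = Z" by (simp add: Rp_R_perp Z_def)
  have SW: "weyl_group B (R_perp x) = weyl_stabilizer B R x" by (rule weyl_group_R_perp[OF x])
  have sgn: "S.sgn_W v = sgn_W v" if "v \<in> weyl_stabilizer B R x" for v
    by (simp add: S.sgn_W_def sgn_W_def inversions_R_perp[OF x that])
  have rho: "\<rho> = rho N + rho Z"
    using NZ by (simp add: rho_def sum.union_disjoint scaleR_add_right)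
  define G where "G = galg_monom (x + rho N) (1 :: int poly) * euler_prod N c"
  have G: "galg_map_exp v G = G" if v: "v \<in> weyl_stabilizer B R x" for v
  proof -
    have vW: "v \<in> W" "v x = x" using v by (auto simp: weyl_stabilizer_def)
    have bij: "bij_betw v N N"
      using stabilizer_image_non_perp[OF x v] inj_W[OF vW(1)] by (auto simp: bij_betw_def N_def)
    have "v (rho N) = rho N"
      using sum.reindex_bij_betw[OF bij, of "\<lambda>a. a"] by (simp add: rho_def W_simps[OF vW(1)])
    moreover have "galg_map_exp v (euler_prod N c) = euler_prod N c"
      using prod.reindex_bij_betw[OF bij, of "\<lambda>a. 1 - galg_monom (- a) c"]
      by (simp add: euler_prod_def act_prod[OF vW(1)] galg_map_exp_diff act_one[OF vW(1)]
          galg_map_exp_monom W_simps[OF vW(1)])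
    ultimately show ?thesis
      by (simp add: G_def act_mult[OF vW(1)] galg_map_exp_monom W_simps[OF vW(1)] vW(2))
  qed
  have split: "galg_monom (x + \<rho>) 1 * (euler_prod N c * euler_prod Z e) =
      G * (galg_monom (rho Z) 1 * euler_prod Z e)" for e
    by (simp add: G_def rho galg_monom_mult mult.assoc[symmetric] mult.left_commute[of _ "euler_prod N c"]
        add.assoc[symmetric])
  have num: "numerator x c = G * (galg_monom (rho Z) 1 * euler_prod Z 1)"
    using split[of 1] by (simp add: numerator_def N_def Z_def)
  have act: "galg_map_exp v (G * f) = G * galg_map_exp v f" if "v \<in> weyl_stabilizer B R x" for v f
    using G[OF that] act_mult[of v G f] that by (simp add: weyl_stabilizer_def)
  show "galg_map_exp v (numerator x c) = sgn_W v * numerator x c" if v: "v \<in> weyl_stabilizer B R x"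
    using S.act_denominator[of v] v unfolding num SRp SW
    by (simp add: act sgn mult.left_commute)
  have "(\<Sum>v\<in>weyl_stabilizer B R x. sgn_W v * galg_map_exp v (galg_monom (x + \<rho>) 1 * euler_prod Rp c))
      = (\<Sum>v\<in>weyl_stabilizer B R x. G * (S.sgn_W v * galg_map_exp v (galg_monom (rho Z) 1 * euler_prod Z c)))"
  proof (rule sum.cong[OF refl])
    fix v assume v: "v \<in> weyl_stabilizer B R x"
    have "galg_monom (x + \<rho>) 1 * euler_prod Rp c = G * (galg_monom (rho Z) 1 * euler_prod Z c)"
      using split[of c] NZ by (simp add: euler_prod_Un)
    then show "sgn_W v * galg_map_exp v (galg_monom (x + \<rho>) 1 * euler_prod Rp c) =
        G * (S.sgn_W v * galg_map_exp v (galg_monom (rho Z) 1 * euler_prod Z c))"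
      by (simp add: act[OF v] sgn[OF v] mult.left_commute)
  qed
  also have "\<dots> = G * S.alternate (galg_monom (rho Z) 1 * euler_prod Z c)"
    by (simp add: S.alternate_def SW sum_distrib_left)
  also have "S.alternate (galg_monom (rho Z) 1 * euler_prod Z c) =
      galg_const (\<Sum>v\<in>weyl_stabilizer B R x. c ^ card (inversions v)) * (galg_monom (rho Z) 1 * euler_prod Z 1)"
    using S.macdonald_identity[of c] S.weyl_denominator
    by (simp add: SRp SW inversions_R_perp[OF x])
  finally show "(\<Sum>v\<in>weyl_stabilizer B R x.
        sgn_W v * galg_map_exp v (galg_monom (x + \<rho>) 1 * euler_prod Rp c)) =
      galg_const (\<Sum>v\<in>weyl_stabilizer B R x. c ^ card (inversions v)) * numerator x c"
    unfolding num by (simp only: mult.left_commute)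
qed

lemma galg_on_numerator: assumes "x \<in> \<Lambda>" shows "numerator x c \<in> galg_on \<Lambda>"
proof -
  have "euler_prod A d \<in> galg_on \<Lambda>" if "A \<subseteq> Rp" for A d
    unfolding euler_prod_def using that Rp_R
    by (intro galg_on_prod weights_0 weights_add galg_on_diff)
      (auto simp: galg_one intro!: galg_on_monom weights_0 weights_root uminus_R)
  then show ?thesis unfolding numerator_def
    using assms by (intro galg_on_mult[OF weights_add] galg_on_monom weights_add rho_weight) auto
qed

text \<open>Averaging over the stabilizer shows that \<open>|W\<^sub>x|\<close> times the left-hand side is the alternating
  sum of the numerator times \<open>W\<^sub>x(c)\<close>; the summands of that alternating sum only depend on
  \<open>w x\<close>, so the factor \<open>|W\<^sub>x|\<close> cancels.\<close>

lemma alternate_numerator: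
  assumes x: "dom x" and xP: "x \<in> \<Lambda>"
  obtains X where "X \<in> galg_on \<Lambda>" "asym X"
    "alternate (galg_monom (x + \<rho>) 1 * euler_prod Rp c) =
      galg_const (\<Sum>v\<in>weyl_stabilizer B R x. c ^ card (inversions v)) * X"
proof -
  let ?St = "weyl_stabilizer B R x"
  let ?n = "of_nat (card ?St) :: ('a, int poly) galg"
  define f where "f = galg_monom (x + \<rho>) (1 :: int poly) * euler_prod Rp c"
  define Y where "Y = numerator x c"
  define C where "C = (\<Sum>v\<in>?St. c ^ card (inversions v))"
  define g where "g w = sgn_W w * galg_map_exp w Y" for w
  \<comment> \<open>One coset representative of the stabilizer for each point of the orbit;
    \<open>X\<close> is the resulting sum over cosets.\<close>
  define r where "r \<gamma> = (SOME w. w \<in> W \<and> w x = \<gamma>)" for \<gamma>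
  define X where "X = (\<Sum>\<gamma>\<in>(\<lambda>w. w x) ` W. g (r \<gamma>))"
  have r: "r \<gamma> \<in> W \<and> r \<gamma> x = \<gamma>" if "\<gamma> \<in> (\<lambda>w. w x) ` W" for \<gamma>
  proof -
    have "\<exists>w. w \<in> W \<and> w x = \<gamma>" using that by blast
    then show ?thesis unfolding r_def by (rule someI_ex)
  qed
  have StW: "v \<in> W" if "v \<in> ?St" for v using that by (simp add: weyl_stabilizer_def)
  have card0: "card ?St \<noteq> 0"
    using finite_weyl_stabilizer weyl_stabilizer_id by (metis card_0_eq empty_iff)
  have gcomp: "g (u \<circ> v) = g u" if "u \<in> W" "v \<in> ?St" for u v
  proof -
    have "g (u \<circ> v) = sgn_W (u \<circ> v) * galg_map_exp u (galg_map_exp v Y)"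
      by (simp add: g_def galg_map_exp_comp)
    also have "\<dots> = sgn_W u * sgn_W v * (sgn_W v * galg_map_exp u Y)"
      using act_numerator[OF x that(2), of c] by (simp add: sgn_comp[OF that(1) StW[OF that(2)]] Y_def act_sgn)
    also have "\<dots> = sgn_W u * (sgn_W v * sgn_W v) * galg_map_exp u Y" by (simp only: mult.assoc)
    finally show ?thesis by (simp add: sgn_square g_def)
  qed
  have altY: "alternate Y = ?n * X"
  proof -
    have "alternate Y = (\<Sum>w\<in>W. g w)" by (simp add: alternate_def g_def)
    also have "\<dots> = (\<Sum>\<gamma>\<in>(\<lambda>w. w x) ` W. \<Sum>w\<in>{w\<in>W. w x = \<gamma>}. g w)"
      by (rule sum.image_gen[OF finite_W])
    also have "\<dots> = (\<Sum>\<gamma>\<in>(\<lambda>w. w x) ` W. ?n * g (r \<gamma>))"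
    proof (rule sum.cong[OF refl])
      fix \<gamma> assume "\<gamma> \<in> (\<lambda>w. w x) ` W"
      note rg = r[OF this]
      have "bij_betw (\<lambda>v. r \<gamma> \<circ> v) ?St {w\<in>W. w x = \<gamma>}"
        using bij_orbit_fibre[of "r \<gamma>" x] rg by simp
      then have "(\<Sum>w\<in>{w\<in>W. w x = \<gamma>}. g w) = (\<Sum>v\<in>?St. g (r \<gamma> \<circ> v))"
        by (rule sum.reindex_bij_betw[symmetric])
      then show "(\<Sum>w\<in>{w\<in>W. w x = \<gamma>}. g w) = ?n * g (r \<gamma>)" using rg by (simp add: gcomp)
    qed
    also have "\<dots> = ?n * X" by (simp add: X_def sum_distrib_left)
    finally show ?thesis .
  qed
  have "?n * alternate f = (\<Sum>v\<in>?St. \<Sum>w\<in>W. sgn_W w * galg_map_exp w f)"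
    by (simp add: alternate_def)
  also have "\<dots> = (\<Sum>v\<in>?St. \<Sum>w\<in>W. sgn_W w * galg_map_exp w (sgn_W v * galg_map_exp v f))"
  proof (rule sum.cong[OF refl])
    fix v assume "v \<in> ?St"
    note v = StW[OF this]
    have "(\<Sum>w\<in>W. sgn_W w * galg_map_exp w f) = (\<Sum>w\<in>W. sgn_W (w \<circ> v) * galg_map_exp (w \<circ> v) f)"
      by (rule sum.reindex_bij_betw[OF bij_comp_right[OF v], symmetric])
    also have "\<dots> = (\<Sum>w\<in>W. sgn_W w * galg_map_exp w (sgn_W v * galg_map_exp v f))"
      by (intro sum.cong refl) (simp add: sgn_comp[OF _ v] act_sgn galg_map_exp_comp mult.assoc)
    finally show "(\<Sum>w\<in>W. sgn_W w * galg_map_exp w f) =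
      (\<Sum>w\<in>W. sgn_W w * galg_map_exp w (sgn_W v * galg_map_exp v f))" .
  qed
  also have "\<dots> = (\<Sum>w\<in>W. sgn_W w * galg_map_exp w (\<Sum>v\<in>?St. sgn_W v * galg_map_exp v f))"
    by (subst sum.swap) (simp add: galg_map_exp_sum sum_distrib_left)
  also have "\<dots> = (\<Sum>w\<in>W. galg_const C * (sgn_W w * galg_map_exp w Y))"
    using sum_stabilizer[OF x, of c]
    by (intro sum.cong refl) (simp add: f_def Y_def C_def act_mult act_const mult.left_commute)
  also have "\<dots> = galg_const C * alternate Y" by (simp add: alternate_def sum_distrib_left)
  finally have nA: "?n * alternate f = galg_const C * (?n * X)" by (simp only: altY)
  have "?n * (alternate f - galg_const C * X) = 0"
    by (simp only: right_diff_distrib nA) (simp add: mult.left_commute)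
  then have "alternate f - galg_const C * X = 0" using card0 by (rule galg_of_nat_mult_eq_0)
  then have A: "alternate f = galg_const C * X" by simp
  \<comment> \<open>The choice of representatives hides the antisymmetry of \<open>X\<close>; it is
    inherited from \<open>alternate Y\<close>, which is \<open>?n * X\<close>, by cancelling
    \<open>?n\<close>.\<close>
  have "asym X" unfolding asym_def
  proof
    fix w assume w: "w \<in> W"
    have "galg_map_exp w (?n * X) = sgn_W w * (?n * X)" using act_alternate[OF w, of Y] altY by simp
    moreover have "galg_map_exp w ?n = ?n"
      unfolding galg_const_of_nat[symmetric] by (rule act_const[OF w])
    then have "galg_map_exp w (?n * X) = ?n * galg_map_exp w X" by (simp add: act_mult[OF w])
    ultimately have "?n * galg_map_exp w X = ?n * (sgn_W w * X)" by (metis mult.left_commute)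
    then have "?n * (galg_map_exp w X - sgn_W w * X) = 0" by (simp only: right_diff_distrib diff_self)
    then have "galg_map_exp w X - sgn_W w * X = 0" using card0 by (rule galg_of_nat_mult_eq_0)
    then show "galg_map_exp w X = sgn_W w * X" by simp
  qed
  moreover have "X \<in> galg_on \<Lambda>"
    unfolding X_def g_def Y_def using r
    by (intro galg_on_sum galg_on_sgn galg_on_act galg_on_numerator xP) auto
  ultimately show ?thesis using that A by (simp add: f_def C_def)
qed


subsection \<open>Macdonald spherical functions\<close>

lemma stabilizer_poly_eq:
  "stabilizer_poly B R Rp x = (\<Sum>v\<in>weyl_stabilizer B R x. t_poly ^ card (inversions v))"
  unfolding stabilizer_poly_def t_poly_def
  by (intro sum.cong refl) (simp add: weyl_length_eq weyl_stabilizer_def monom_power)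

text \<open>Its value at \<open>t = 1\<close> is the order of the stabilizer.\<close>

lemma stabilizer_poly_nonzero: "stabilizer_poly B R Rp x \<noteq> 0"
proof
  assume "stabilizer_poly B R Rp x = 0"
  then have "poly (stabilizer_poly B R Rp x) 1 = 0" by simp
  then have "card (weyl_stabilizer B R x) = 0" by (simp add: stabilizer_poly_def poly_sum poly_monom)
  then show False using finite_weyl_stabilizer weyl_stabilizer_id by (metis card_0_eq empty_iff)
qed

lemma galg_monom_nonzero: "galg_monom a (1 :: 'k::comm_ring_1) \<noteq> 0"
proof
  assume "galg_monom a (1 :: 'k) = 0"
  then have "galg_coeff (galg_monom a (1 :: 'k)) a = 0" by (metis galg_coeff_arith(4))
  then show False by (simp add: galg_coeff_monom)
qed

text \<open>Extending each fraction by \<open>x^\<rho>\<close> turns its denominator into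
  \<open>alt \<rho>\<close>, which \<open>w\<close> changes only by a sign. So all summands share
  one denominator, and the plain sum becomes an alternating one.\<close>

lemma spherical_fract_sum:
  "(\<Sum>w\<in>W. fract_map_exp w (to_fract (galg_monom x 1) *
      (\<Prod>\<alpha>\<in>Rp. to_fract (1 - galg_monom (- \<alpha>) c) / to_fract (1 - galg_monom (- \<alpha>) 1)))) =
    to_fract (alternate (galg_monom (x + \<rho>) 1 * euler_prod Rp c)) / to_fract (alt \<rho>)"
proof -
  let ?f = "galg_monom (x + \<rho>) 1 * euler_prod Rp c"
  have ne: "to_fract (euler_prod Rp 1 :: ('a, int poly) galg) \<noteq> 0"
    using alt_rho_nonzero by (auto simp: weyl_denominator)
  have "to_fract (galg_monom x 1) *
      (\<Prod>\<alpha>\<in>Rp. to_fract (1 - galg_monom (- \<alpha>) c) / to_fract (1 - galg_monom (- \<alpha>) 1))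
      = to_fract (galg_monom x 1) * to_fract (euler_prod Rp c) / to_fract (euler_prod Rp 1)"
    by (simp add: prod_dividef euler_prod_def to_fract_prod)
  also have "\<dots> = to_fract ?f / to_fract (alt \<rho>)"
    using ne galg_monom_nonzero[of \<rho>, where 'k = "int poly"]
    by (simp add: weyl_denominator galg_monom_mult[of x 1 \<rho> 1, simplified, symmetric] field_simps)
  finally have "(\<Sum>w\<in>W. fract_map_exp w (to_fract (galg_monom x 1) *
      (\<Prod>\<alpha>\<in>Rp. to_fract (1 - galg_monom (- \<alpha>) c) / to_fract (1 - galg_monom (- \<alpha>) 1)))) =
      (\<Sum>w\<in>W. fract_map_exp w (to_fract ?f / to_fract (alt \<rho>)))" by simp
  also have "\<dots> = (\<Sum>w\<in>W. to_fract (sgn_W w * galg_map_exp w ?f) / to_fract (alt \<rho>))"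
  proof (rule sum.cong[OF refl])
    fix w assume w: "w \<in> W"
    have "fract_map_exp w (to_fract ?f / to_fract (alt \<rho>)) =
        to_fract (galg_map_exp w ?f) / to_fract (sgn_W w * alt \<rho>)"
      using fract_map_exp_divide[OF W_add[OF w] inj_W_UNIV[OF w] alt_rho_nonzero, of ?f]
      by (simp only: act_alternate[OF w])
    also have "to_fract (sgn_W w * alt \<rho>) = to_fract (sgn_W w) * to_fract (alt \<rho>)" by simp
    also have "to_fract (galg_map_exp w ?f) / (to_fract (sgn_W w) * to_fract (alt \<rho>)) =
        to_fract (sgn_W w * galg_map_exp w ?f) / to_fract (alt \<rho>)"
    proof -
      have s: "to_fract (sgn_W w :: ('a, int poly) galg) * to_fract (sgn_W w) = 1"
        by (simp only: to_fract_mult[symmetric] sgn_square to_fract_1)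
      then have "to_fract (sgn_W w :: ('a, int poly) galg) \<noteq> 0" by auto
      then show ?thesis using s alt_rho_nonzero
        by (simp add: frac_eq_eq)
    qed
    finally show "fract_map_exp w (to_fract ?f / to_fract (alt \<rho>)) =
        to_fract (sgn_W w * galg_map_exp w ?f) / to_fract (alt \<rho>)" .
  qed
  also have "\<dots> = to_fract (alternate ?f) / to_fract (alt \<rho>)"
    by (simp only: alternate_def to_fract_sum sum_divide_distrib)
  finally show ?thesis .
qed

text \<open>The quotient \<open>X\<close> by \<open>W_x(t)\<close> is antisymmetric, hence divisible
  by \<open>alt \<rho>\<close>; the result is the witness for the definite description. Later facts
  about the spherical function are drawn from this equation.\<close>

lemma macdonald_spherical_mult_denominator:
  assumes "x \<in> \<Lambda>" "dom x"
  shows "galg_const (stabilizer_poly B R Rp x) * (alt \<rho> * macdonald_spherical B R Rp x) =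
    alternate (galg_monom (x + \<rho>) 1 * euler_prod Rp t_poly)"
proof -
  let ?C = "galg_const (stabilizer_poly B R Rp x) :: ('a, int poly) galg"
  let ?A = "alternate (galg_monom (x + \<rho>) 1 * euler_prod Rp t_poly)"
  obtain X where X: "X \<in> galg_on \<Lambda>" "asym X" "?A = ?C * X"
    using alternate_numerator[OF assms(2,1), of t_poly] unfolding stabilizer_poly_eq[symmetric] by blast
  obtain s where s: "s \<in> galg_on \<Lambda>" "X = alt \<rho> * s" using asym_divisible X by blast
  have "?C \<noteq> 0" using stabilizer_poly_nonzero galg_const_eq_0 by blast
  have "macdonald_spherical B R Rp x = integral_fract \<Lambda> (to_fract ?A / to_fract (?C * alt \<rho>))"
    unfolding macdonald_spherical_def spherical_fract_sum by simp
  also have "\<dots> = s"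
  proof (rule integral_fract_eqI[OF s(1)])
    show "to_fract s * to_fract (?C * alt \<rho>) = to_fract ?A"
      unfolding X(3) s(2) to_fract_mult by (simp only: mult_ac)
    show "?C * alt \<rho> \<noteq> 0" using \<open>?C \<noteq> 0\<close> alt_rho_nonzero by simp
  qed
  finally show ?thesis using X(3) s(2) by simp
qed

lemma act_macdonald_spherical:
  assumes "x \<in> \<Lambda>" "dom x" "w \<in> W"
  shows "galg_map_exp w (macdonald_spherical B R Rp x) = macdonald_spherical B R Rp x"
proof -
  let ?C = "galg_const (stabilizer_poly B R Rp x) :: ('a, int poly) galg"
  let ?P = "macdonald_spherical B R Rp x"
  have "?C * (sgn_W w * (alt \<rho> * galg_map_exp w ?P)) = sgn_W w * (?C * (alt \<rho> * ?P))"
    using act_alternate[OF assms(3), of "galg_monom (x + \<rho>) 1 * euler_prod Rp t_poly"]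
    unfolding macdonald_spherical_mult_denominator[OF assms(1,2), symmetric]
    by (simp add: act_mult assms(3) act_const act_alternate mult.assoc)
  then have "sgn_W w * sgn_W w * (?C * alt \<rho>) * galg_map_exp w ?P = sgn_W w * sgn_W w * (?C * alt \<rho>) * ?P"
    by (metis (no_types, lifting) mult.assoc mult.left_commute)
  then show ?thesis using stabilizer_poly_nonzero alt_rho_nonzero
    by (simp add: sgn_square galg_const_eq_0)
qed

lemma below_sum: "(\<And>i. i \<in> A \<Longrightarrow> below a (f i)) \<Longrightarrow> below a (sum f A)"
  unfolding below_def galg_coeff_sum by (metis (no_types, lifting) sum.neutral)

text \<open>Take an offending exponent \<open>\<kappa>\<close> of \<open>f\<close> with
  \<open>h \<kappa>\<close> maximal. Other contributions to the coefficient of the product at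
  \<open>\<kappa>\<close> come from exponents \<open>\<kappa> + \<Sum>S\<close> of \<open>f\<close>;
  these are not offending, which would put \<open>\<kappa>\<close> itself below \<open>x\<close>. So
  \<open>\<kappa>\<close> survives in the product, a contradiction.\<close>

lemma below_euler_prod_cancel:
  assumes "below x (euler_prod Rp c * f)"
  shows "below x f" "galg_coeff f x = galg_coeff (euler_prod Rp c * f) x"
proof -
  show b: "below x f"
  proof (rule ccontr)
    assume "\<not> below x f"
    define T where "T = {\<kappa>\<in>galg_supp f. x - \<kappa> \<notin> poscone}"
    have "finite T" unfolding T_def by simp
    moreover have "T \<noteq> {}" using \<open>\<not> below x f\<close> by (auto simp: T_def below_def in_galg_supp)
    ultimately have "finite (h ` T)" "h ` T \<noteq> {}" by auto
    then obtain \<kappa> where k: "\<kappa> \<in> T" "\<And>\<mu>. \<mu> \<in> T \<Longrightarrow> h \<mu> \<le> h \<kappa>"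
      using Max_in[of "h ` T"] Max_ge[of "h ` T"] by fastforce
    have "galg_coeff f (\<kappa> + \<Sum>S) = 0" if S: "S \<subseteq> Rp" "S \<noteq> {}" for S
    proof (rule ccontr)
      assume nz: "\<not> ?thesis"
      have K: "\<Sum>S \<in> poscone" using poscone_sum_roots[OF S(1)] .
      have "\<Sum>S \<noteq> 0" using sum_roots_eq_0[OF S(1)] S(2) by blast
      then have "h (\<Sum>S) > 0" using poscone_pointed[OF K] by (meson not_le)
      then have "\<kappa> + \<Sum>S \<notin> T" using k(2) by (force simp: h_simps)
      then have "x - (\<kappa> + \<Sum>S) \<in> poscone" using nz by (simp add: T_def in_galg_supp)
      then have "x - \<kappa> \<in> poscone" using poscone_add[OF _ K] by fastforce
      then show False using k(1) by (simp add: T_def)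
    qed
    then have "galg_coeff (euler_prod Rp c * f) \<kappa> = (\<Sum>S\<in>Pow Rp. if S = {} then galg_coeff f \<kappa> else 0)"
      unfolding euler_prod_expand[OF finite_Rp] sum_distrib_right galg_coeff_sum galg_coeff_monom_mult
      by (intro sum.cong refl) auto
    then have "galg_coeff (euler_prod Rp c * f) \<kappa> \<noteq> 0"
      using k(1) finite_Rp by (simp add: T_def in_galg_supp)
    then have "x - \<kappa> \<in> poscone" using assms by (simp add: below_def)
    then show False using k(1) by (simp add: T_def)
  qed
  show "galg_coeff f x = galg_coeff (euler_prod Rp c * f) x"
    using below_mult(2)[OF euler_prod_lead(1)[OF order_refl] b, of c] euler_prod_lead(2)[OF order_refl, of c]
    by simp
qed

text \<open>After removing \<open>x^\<rho>\<close>, the alternating sum is \<open>Q\<close>, whose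
  exponents lie below \<open>x\<close>. At \<open>x\<close> only the elements of the stabilizer
  contribute, each with \<open>t\<close> to its length, and the total is the normalizing factor
  \<open>W_x(t)\<close>.\<close>

lemma macdonald_spherical_lead:
  assumes "x \<in> \<Lambda>" "dom x"
  shows "below x (macdonald_spherical B R Rp x)" "galg_coeff (macdonald_spherical B R Rp x) x = 1"
proof -
  let ?P = "macdonald_spherical B R Rp x"
  let ?C = "stabilizer_poly B R Rp x"
  have trm: "galg_map_exp w (galg_monom (x + \<rho>) 1 * euler_prod Rp t_poly) =
      galg_monom \<rho> 1 * (galg_monom (w x) 1 * twisted_prod w t_poly)" if w: "w \<in> W" for w
  proof -
    have e: "galg_monom (x + \<rho>) 1 * euler_prod Rp t_poly =
        galg_monom x 1 * (galg_monom \<rho> 1 * euler_prod Rp t_poly)"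
      by (simp add: mult.assoc[symmetric] galg_monom_mult)
    show ?thesis unfolding e
      by (simp add: act_mult[OF w, of "galg_monom x 1"] galg_map_exp_monom act_euler_prod[OF w] mult.left_commute)
  qed
  have tw: "below 0 (twisted_prod w t_poly)" for w
    unfolding below_def using twisted_prod_supp poscone_sum_roots by (metis diff_0 minus_minus)
  have bw: "below x (galg_monom (w x) (1 :: int poly))" if "w \<in> W" for w
    using dom_diff[OF assms(2) that] by (auto simp: below_def galg_coeff_monom)
  define Q where "Q = (\<Sum>w\<in>W. sgn_W w * (galg_monom (w x) 1 * twisted_prod w t_poly))"
  have "below x (sgn_W w * (galg_monom (w x) 1 * twisted_prod w t_poly))" if "w \<in> W" for w
    using below_mult(1)[OF bw[OF that] tw] by (auto simp: below_def galg_coeff_sgn)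
  then have Q: "below x Q" unfolding Q_def by (rule below_sum)
  have "galg_coeff Q x = (\<Sum>w\<in>W. if w x = x then t_poly ^ card (inversions w) else 0)"
    unfolding Q_def galg_coeff_sum
  proof (rule sum.cong[OF refl])
    fix w assume w: "w \<in> W"
    show "galg_coeff (sgn_W w * (galg_monom (w x) 1 * twisted_prod w t_poly)) x =
        (if w x = x then t_poly ^ card (inversions w) else 0)"
      using below_mult(2)[OF bw[OF w] tw]
      by (simp add: galg_coeff_sgn galg_coeff_monom twisted_prod_coeff_0[OF w] sgn_mult_power eq_commute)
  qed
  also have "\<dots> = ?C"
    unfolding stabilizer_poly_eq weyl_stabilizer_def using finite_W by (rule sum.inter_filter[symmetric])
  finally have Qx: "galg_coeff Q x = ?C" .
  have "alternate (galg_monom (x + \<rho>) 1 * euler_prod Rp t_poly) = galg_monom \<rho> 1 * Q"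
    unfolding alternate_def Q_def by (simp add: trm sum_distrib_left mult.left_commute)
  then have "galg_monom \<rho> 1 * (galg_const ?C * (euler_prod Rp 1 * ?P)) = galg_monom \<rho> 1 * Q"
    using macdonald_spherical_mult_denominator[OF assms]
    by (simp add: weyl_denominator mult.assoc mult.left_commute[of _ "galg_const ?C"])
  then have eq: "galg_const ?C * (euler_prod Rp 1 * ?P) = Q"
    using galg_monom_nonzero[of \<rho>, where 'k = "int poly"] by simp
  have b: "below x (euler_prod Rp 1 * ?P)"
    using Q stabilizer_poly_nonzero unfolding eq[symmetric] below_def galg_coeff_const_mult by simp
  show "below x ?P" by (rule below_euler_prod_cancel(1)[OF b])
  have "?C * galg_coeff ?P x = ?C * 1"
    using Qx unfolding below_euler_prod_cancel(2)[OF b] eq[symmetric] galg_coeff_const_mult by simp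
  then show "galg_coeff ?P x = 1" using stabilizer_poly_nonzero by simp
qed

end


subsection \<open>Power series over the group algebra\<close>

lemma galg_coeff_mult_superset:
  fixes f g :: "('a::ab_group_add, 'k::comm_ring_1) galg"
  assumes "finite A" "galg_supp f \<subseteq> A"
  shows "galg_coeff (f * g) \<nu> = (\<Sum>\<mu>\<in>A. galg_coeff f \<mu> * galg_coeff g (\<nu> - \<mu>))"
  unfolding galg_coeff_mult using assms
  by (intro sum.mono_neutral_left) (auto simp: in_galg_supp)

lemma galg_coeff_to_fps: "galg_coeff (fps_nth (galg_to_fps f) n) \<mu> = coeff (galg_coeff f \<mu>) n"
proof -
  have "galg_coeff (fps_nth (galg_to_fps f) n) \<mu> =
      (\<Sum>\<nu>\<in>galg_supp f. if \<nu> = \<mu> then coeff (galg_coeff f \<mu>) n else 0)"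
    unfolding galg_to_fps_def fps_nth_Abs_fps galg_coeff_sum
    by (intro sum.cong) (auto simp: galg_coeff_monom)
  then show ?thesis by (simp add: in_galg_supp)
qed

lemma fps_galg_eqI:
  fixes F G :: "('a, 'k::zero) galg fps"
  assumes "\<And>n \<mu>. galg_coeff (fps_nth F n) \<mu> = galg_coeff (fps_nth G n) \<mu>"
  shows "F = G"
  using assms by (intro fps_ext galg_eqI)

lemma galg_to_fps_add: "galg_to_fps (f + g) = galg_to_fps f + galg_to_fps g"
  and galg_to_fps_diff: "galg_to_fps (f - g) = galg_to_fps f - galg_to_fps g"
  and galg_to_fps_0: "galg_to_fps 0 = 0"
  by (rule fps_galg_eqI; simp add: galg_coeff_to_fps)+

lemma galg_to_fps_sum: "galg_to_fps (sum f A) = (\<Sum>i\<in>A. galg_to_fps (f i))"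
  by (induction A rule: infinite_finite_induct) (auto simp: galg_to_fps_add galg_to_fps_0)

lemma galg_to_fps_monom_nth: "fps_nth (galg_to_fps (galg_monom a c)) n = galg_monom a (coeff c n)"
  by (rule galg_eqI) (simp add: galg_coeff_to_fps galg_coeff_monom)

lemma galg_to_fps_monom: "galg_to_fps (galg_monom a 1) = fps_const (galg_monom a 1)"
  by (rule fps_ext) (simp add: galg_to_fps_monom_nth one_poly.rep_eq coeff_pCons split: nat.splits)

lemma galg_to_fps_one: "galg_to_fps 1 = 1"
  by (simp add: galg_one galg_to_fps_monom flip: fps_const_1_eq_1)

lemma galg_to_fps_mult:
  fixes f g :: "('a::ab_group_add, int poly) galg"
  shows "galg_to_fps (f * g) = galg_to_fps f * galg_to_fps g"
proof (rule fps_galg_eqI)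
  fix n \<nu>
  have sub: "galg_supp (fps_nth (galg_to_fps f) i) \<subseteq> galg_supp f" for i
    by (auto simp: in_galg_supp galg_coeff_to_fps)
  have "galg_coeff (fps_nth (galg_to_fps f * galg_to_fps g) n) \<nu> =
      (\<Sum>i=0..n. \<Sum>\<mu>\<in>galg_supp f. coeff (galg_coeff f \<mu>) i * coeff (galg_coeff g (\<nu> - \<mu>)) (n - i))"
    by (simp add: fps_mult_nth galg_coeff_mult_superset[OF finite_galg_supp sub] galg_coeff_to_fps)
  also have "\<dots> = (\<Sum>\<mu>\<in>galg_supp f. coeff (galg_coeff f \<mu> * galg_coeff g (\<nu> - \<mu>)) n)"
    by (subst sum.swap) (simp add: coeff_mult atMost_atLeast0)
  also have "\<dots> = galg_coeff (fps_nth (galg_to_fps (f * g)) n) \<nu>"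
    by (simp add: galg_coeff_to_fps galg_coeff_mult coeff_sum)
  finally show "galg_coeff (fps_nth (galg_to_fps (f * g)) n) \<nu> =
    galg_coeff (fps_nth (galg_to_fps f * galg_to_fps g) n) \<nu>" by simp
qed

lemma galg_to_fps_prod:
  fixes f :: "'i \<Rightarrow> ('a::ab_group_add, int poly) galg"
  shows "galg_to_fps (prod f A) = (\<Prod>i\<in>A. galg_to_fps (f i))"
  by (induction A rule: infinite_finite_induct) (auto simp: galg_to_fps_mult galg_to_fps_one)

text \<open>Telescoping: multiplication by \<open>t x^a\<close> shifts the series by one
  term.\<close>

lemma geometric_fps_inverse:
  "galg_to_fps (1 - galg_monom a t_poly) * geometric_fps a = 1"
proof (rule fps_ext)
  fix n
  have t: "galg_to_fps (galg_monom a t_poly) = fps_X * fps_const (galg_monom a 1)"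
    by (rule fps_ext) (simp add: galg_to_fps_monom_nth t_poly_def coeff_monom)
  have e: "galg_to_fps (1 - galg_monom a t_poly) * geometric_fps a =
      geometric_fps a - fps_X * (fps_const (galg_monom a 1) * geometric_fps a)"
    by (simp add: galg_to_fps_diff galg_to_fps_one t left_diff_distrib mult.assoc)
  show "fps_nth (galg_to_fps (1 - galg_monom a t_poly) * geometric_fps a) n = fps_nth 1 n"
    unfolding e by (cases n) (simp_all add: geometric_fps_def galg_monom_mult galg_one algebra_simps)
qed

definition fps_map_exp ::
    "('a \<Rightarrow> 'a) \<Rightarrow> ('a::comm_monoid_add, 'k::comm_ring_1) galg fps \<Rightarrow> ('a, 'k) galg fps" where
  "fps_map_exp u F = Abs_fps (\<lambda>n. galg_map_exp u (fps_nth F n))"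

lemma fps_map_exp_mult:
  fixes F G :: "('a::comm_monoid_add, 'k::comm_ring_1) galg fps"
  assumes "\<And>x y. u (x + y) = u x + u y"
  shows "fps_map_exp u (F * G) = fps_map_exp u F * fps_map_exp u G"
  by (rule fps_ext) (simp add: fps_map_exp_def fps_mult_nth galg_map_exp_sum galg_map_exp_mult[OF assms])

lemma fps_map_exp_one:
  "u 0 = 0 \<Longrightarrow> fps_map_exp u (1 :: ('a::comm_monoid_add, 'k::comm_ring_1) galg fps) = 1"
  by (rule fps_ext) (simp add: fps_map_exp_def galg_map_exp_one)

lemma fps_map_exp_prod:
  fixes F :: "'i \<Rightarrow> ('a::comm_monoid_add, 'k::comm_ring_1) galg fps"
  assumes "\<And>x y. u (x + y) = u x + u y" "u 0 = 0"
  shows "fps_map_exp u (prod F A) = (\<Prod>i\<in>A. fps_map_exp u (F i))"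
  by (induction A rule: infinite_finite_induct)
    (auto simp: fps_map_exp_mult[OF assms(1)] fps_map_exp_one assms(2))

lemma fps_map_exp_galg_to_fps:
  "fps_map_exp u (galg_to_fps f) = galg_to_fps (galg_map_exp u f)"
proof (rule fps_ext)
  fix n
  have "fps_nth (galg_to_fps (galg_map_exp u f)) n =
      (\<Sum>\<mu>\<in>galg_supp f. galg_monom (u \<mu>) (coeff (galg_coeff f \<mu>) n))"
    by (simp add: galg_map_exp_def galg_to_fps_sum fps_sum_nth galg_to_fps_monom_nth)
  also have "\<dots> = fps_nth (fps_map_exp u (galg_to_fps f)) n"
    by (simp add: fps_map_exp_def galg_to_fps_def galg_map_exp_sum galg_map_exp_monom)
  finally show "fps_nth (fps_map_exp u (galg_to_fps f)) n = fps_nth (galg_to_fps (galg_map_exp u f)) n"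
    by simp
qed

lemma fps_map_exp_geometric: "linear u \<Longrightarrow> fps_map_exp u (geometric_fps a) = geometric_fps (u a)"
  by (rule fps_ext) (simp add: fps_map_exp_def geometric_fps_def galg_map_exp_monom linear_scale)

definition fps_galg_coeff :: "'a \<Rightarrow> ('a, 'k::zero) galg fps \<Rightarrow> 'k fps" where
  "fps_galg_coeff a F = Abs_fps (\<lambda>n. galg_coeff (fps_nth F n) a)"

lemma fps_galg_coeff_map_exp:
  fixes F :: "('a::comm_monoid_add, 'k::comm_ring_1) galg fps"
  assumes "inj u" "u 0 = 0"
  shows "fps_galg_coeff 0 (fps_map_exp u F) = fps_galg_coeff 0 F"
  using galg_coeff_map_exp[OF assms(1), of _ 0]
  by (intro fps_ext) (simp add: fps_galg_coeff_def fps_map_exp_def assms(2))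

lemma fps_galg_coeff_sum:
  fixes F :: "'i \<Rightarrow> ('a::comm_monoid_add, 'k::comm_ring_1) galg fps"
  shows "fps_galg_coeff a (sum F A) = (\<Sum>i\<in>A. fps_galg_coeff a (F i))"
  by (rule fps_ext) (simp add: fps_galg_coeff_def fps_sum_nth)

lemma fps_galg_coeff_const_mult:
  fixes F :: "('a::ab_group_add, int) galg fps"
  shows "fps_galg_coeff a (galg_to_fps (galg_const c) * F) = fps_of_poly c * fps_galg_coeff a F"
  by (rule fps_ext)
    (simp add: fps_galg_coeff_def fps_mult_nth galg_const_def galg_to_fps_monom_nth galg_coeff_monom_mult)

lemma galg_bar_bar: "galg_bar (galg_bar f) = f"
  by (simp add: galg_bar_def galg_map_exp_comp comp_def galg_map_exp_id[unfolded id_def])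

lemma galg_bar_mult:
  fixes f g :: "('a::ab_group_add, 'k::comm_ring_1) galg"
  shows "galg_bar (f * g) = galg_bar f * galg_bar g"
  unfolding galg_bar_def by (rule galg_map_exp_mult) simp

lemma galg_bar_monom: "galg_bar (galg_monom a c) = galg_monom (- a) (c :: 'k::comm_ring_1)"
  by (simp add: galg_bar_def galg_map_exp_monom)

lemma galg_bar_euler_prod: "galg_bar (euler_prod A c) = (\<Prod>\<alpha>\<in>A. 1 - galg_monom \<alpha> c)"
  by (simp add: euler_prod_def galg_bar_def galg_map_exp_prod galg_map_exp_diff galg_map_exp_one
      galg_map_exp_monom)


context euclidean_root_system
begin

text \<open>One bound for all powers of \<open>t\<close>: the series of a negative root has
  exponents unbounded downwards but never above 0.\<close>

definition fps_below :: "'a \<Rightarrow> ('a, 'k::comm_ring_1) galg fps \<Rightarrow> bool" where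
  "fps_below a F \<longleftrightarrow> (\<forall>n. below a (fps_nth F n))"

lemma fps_below_mult:
  fixes F G :: "('a, 'k::comm_ring_1) galg fps"
  assumes "fps_below a F" "fps_below b G"
  shows "fps_below (a + b) (F * G)"
    "fps_galg_coeff (a + b) (F * G) = fps_galg_coeff a F * fps_galg_coeff b G"
proof -
  have b: "below a (fps_nth F i)" "below b (fps_nth G i)" for i
    using assms by (auto simp: fps_below_def)
  show "fps_below (a + b) (F * G)"
    unfolding fps_below_def fps_mult_nth by (intro allI below_sum below_mult b)
  show "fps_galg_coeff (a + b) (F * G) = fps_galg_coeff a F * fps_galg_coeff b G"
    by (rule fps_ext) (simp add: fps_galg_coeff_def fps_mult_nth below_mult(2)[OF b])
qed

lemma fps_below_one: "fps_below 0 (1 :: ('a, 'k::comm_ring_1) galg fps)"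
    "fps_galg_coeff 0 (1 :: ('a, 'k::comm_ring_1) galg fps) = 1"
  by (auto simp: fps_below_def below_def fps_one_def galg_coeff_one poscone_0 split: if_splits)
    (rule fps_ext, simp add: fps_galg_coeff_def fps_one_def galg_coeff_one)

lemma fps_below_prod:
  fixes F :: "'i \<Rightarrow> ('a, 'k::comm_ring_1) galg fps"
  assumes "\<And>i. i \<in> A \<Longrightarrow> fps_below 0 (F i)" "\<And>i. i \<in> A \<Longrightarrow> fps_galg_coeff 0 (F i) = 1"
  shows "fps_below 0 (prod F A) \<and> fps_galg_coeff 0 (prod F A) = 1"
  using assms
proof (induction A rule: infinite_finite_induct)
  case (insert i A)
  then show ?case using fps_below_mult[of 0 "F i" 0 "prod F A"] by simp
qed (simp_all add: fps_below_one)

lemma fps_below_geometric: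
  assumes "\<alpha> \<in> Rp"
  shows "fps_below 0 (geometric_fps (- \<alpha>))" "fps_galg_coeff 0 (geometric_fps (- \<alpha>)) = 1"
proof -
  show "fps_below 0 (geometric_fps (- \<alpha>))"
    using poscone_root[OF assms] by (auto simp: fps_below_def below_def geometric_fps_def galg_coeff_monom)
  show "fps_galg_coeff 0 (geometric_fps (- \<alpha>)) = 1"
    using root_nonzero[OF Rp_R[OF assms]]
    by (intro fps_ext) (simp add: fps_galg_coeff_def geometric_fps_def galg_coeff_monom fps_one_def)
qed

lemma fps_below_galg_to_fps:
  shows "below a f \<Longrightarrow> fps_below a (galg_to_fps f)"
    and "fps_galg_coeff a (galg_to_fps f) = fps_of_poly (galg_coeff f a)"
proof -
  show "below a f \<Longrightarrow> fps_below a (galg_to_fps f)"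
    by (auto simp: fps_below_def below_def galg_coeff_to_fps) (metis coeff_0)
  show "fps_galg_coeff a (galg_to_fps f) = fps_of_poly (galg_coeff f a)"
    by (rule fps_ext) (simp add: fps_galg_coeff_def galg_coeff_to_fps)
qed


subsection \<open>Orthogonality\<close>

lemma prod_R: "prod f R = prod f Rp * (\<Prod>\<alpha>\<in>Rp. f (- \<alpha>))"
proof -
  have "prod f R = prod f Rp * prod f (uminus ` Rp)"
    by (subst R_eq_Rp_Un) (rule prod.union_disjoint, use finite_Rp Rp_disjoint_uminus in auto)
  also have "prod f (uminus ` Rp) = (\<Prod>\<alpha>\<in>Rp. f (- \<alpha>))"
    by (subst prod.reindex) auto
  finally show ?thesis .
qed

text \<open>By the denominator formula \<open>alt \<rho>\<close> supplies the factors of the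
  negative roots and its conjugate those of the positive ones; \<open>x^\<rho>\<close>
  cancels.\<close>

lemma denominator_mult_bar:
  "alt \<rho> * galg_bar (alt \<rho>) = (\<Prod>\<alpha>\<in>R. 1 - galg_monom \<alpha> 1)"
proof -
  have "alt \<rho> * galg_bar (alt \<rho>) =
      (galg_monom \<rho> 1 * galg_monom (- \<rho>) 1) * (galg_bar (euler_prod Rp 1) * euler_prod Rp 1)"
    by (simp add: weyl_denominator galg_bar_mult galg_bar_monom mult_ac)
  also have "\<dots> = (\<Prod>\<alpha>\<in>R. 1 - galg_monom \<alpha> 1)"
    unfolding prod_R galg_bar_euler_prod by (simp add: galg_monom_mult euler_prod_def flip: galg_one)
  finally show ?thesis .
qed

lemma act_bar: "w \<in> W \<Longrightarrow> galg_map_exp w (galg_bar f) = galg_bar (galg_map_exp w f :: ('a, 'k::comm_ring_1) galg)"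
  by (simp add: galg_bar_def galg_map_exp_comp comp_def W_simps)

abbreviation "geom \<equiv> (\<Prod>\<alpha>\<in>R. geometric_fps \<alpha>)"

lemma fps_map_exp_geom:
  assumes "linear u" "bij_betw u R R" shows "fps_map_exp u geom = geom"
proof -
  have "fps_map_exp u geom = (\<Prod>\<alpha>\<in>R. geometric_fps (u \<alpha>))"
    using assms(1) by (simp add: fps_map_exp_prod linear_add linear_0 fps_map_exp_geometric)
  also have "\<dots> = geom" by (rule prod.reindex_bij_betw[OF assms(2)])
  finally show ?thesis .
qed

lemma bij_uminus_R: "bij_betw uminus R R"
  by (rule bij_betw_byWitness[where f' = uminus]) (auto simp: uminus_R)

text \<open>Constant term of \<open>f\<close> divided by all \<open>1 - t x^\<alpha>\<close>. The
  factors \<open>1 - x^\<alpha>\<close> of the weight function stay in \<open>f\<close>, where they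
  can meet the denominators of the arguments.\<close>

definition ct :: "('a, int poly) galg \<Rightarrow> int fps" where
  "ct f = fps_galg_coeff 0 (galg_to_fps f * geom)"

lemma ct_map_exp:
  assumes "linear u" "inj u" "bij_betw u R R"
  shows "ct (galg_map_exp u f) = ct f"
proof -
  have "galg_to_fps (galg_map_exp u f) * geom = fps_map_exp u (galg_to_fps f * geom)"
    using assms(1) by (simp add: fps_map_exp_mult linear_add fps_map_exp_geom[OF assms(1,3)] fps_map_exp_galg_to_fps)
  then show ?thesis
    unfolding ct_def using fps_galg_coeff_map_exp[OF assms(2) linear_0[OF assms(1)]] by simp
qed

lemma ct_act: "w \<in> W \<Longrightarrow> ct (galg_map_exp w f) = ct f"
  using W_image_R inj_W by (intro ct_map_exp linear_W) (auto simp: bij_betw_def)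

lemma ct_bar: "ct (galg_bar f) = ct f"
  unfolding galg_bar_def by (rule ct_map_exp) (auto simp: linear_iff bij_uminus_R inj_def)

lemma ct_sum: "ct (sum f A) = (\<Sum>i\<in>A. ct (f i))"
  by (simp add: ct_def galg_to_fps_sum sum_distrib_right fps_galg_coeff_sum)

lemma ct_const_mult: "ct (galg_const c * f) = fps_of_poly c * ct f"
  by (simp add: ct_def galg_to_fps_mult mult.assoc fps_galg_coeff_const_mult)

text \<open>The factors \<open>1 - x^\<alpha>\<close> give one \<open>alt \<rho>\<close> to each
  argument. The second argument thereby becomes the antisymmetric \<open>g\<close>, which absorbs
  the signs in the expansion of the first.\<close>

lemma ct_macdonald_spherical:
  assumes x: "x \<in> \<Lambda>" "dom x" and Q: "\<And>w. w \<in> W \<Longrightarrow> galg_map_exp w Q = Q"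
  shows "fps_of_poly (stabilizer_poly B R Rp x) *
      ct (macdonald_spherical B R Rp x * galg_bar Q * (\<Prod>\<alpha>\<in>R. 1 - galg_monom \<alpha> 1)) =
    of_nat (card W) * fps_galg_coeff 0
      (galg_to_fps (galg_monom (- x) 1 * Q * euler_prod Rp 1) * (\<Prod>\<alpha>\<in>Rp. geometric_fps (- \<alpha>)))"
proof -
  let ?C = "galg_const (stabilizer_poly B R Rp x) :: ('a, int poly) galg"
  let ?P = "macdonald_spherical B R Rp x"
  define f where "f = galg_monom (x + \<rho>) 1 * euler_prod Rp t_poly"
  define g where "g = galg_bar Q * galg_bar (alt \<rho>)"
  have g: "galg_map_exp w g = sgn_W w * g" if w: "w \<in> W" for w
  proof -
    have "galg_map_exp w g = galg_bar (sgn_W w * (Q * alt \<rho>))"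
      unfolding g_def galg_bar_mult[symmetric] act_bar[OF w]
      by (simp add: act_mult[OF w] Q[OF w] act_alternate[OF w] mult.left_commute)
    also have "\<dots> = sgn_W w * galg_bar (Q * alt \<rho>)" unfolding galg_bar_def by (rule act_sgn)
    finally show ?thesis by (simp add: g_def galg_bar_mult)
  qed
  have gb: "galg_bar g = Q * (galg_monom \<rho> 1 * euler_prod Rp 1)"
    unfolding g_def galg_bar_mult galg_bar_bar weyl_denominator ..
  have "?C * (?P * galg_bar Q * (\<Prod>\<alpha>\<in>R. 1 - galg_monom \<alpha> 1)) = (?C * (alt \<rho> * ?P)) * g"
    unfolding denominator_mult_bar[symmetric] g_def by (simp only: mult_ac)
  also have "\<dots> = (\<Sum>w\<in>W. sgn_W w * galg_map_exp w f) * g"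
    unfolding macdonald_spherical_mult_denominator[OF x] f_def[symmetric] by (simp only: alternate_def)
  also have "\<dots> = (\<Sum>w\<in>W. galg_map_exp w (f * g))"
    unfolding sum_distrib_right by (intro sum.cong refl) (simp add: act_mult g mult_ac)
  finally have "fps_of_poly (stabilizer_poly B R Rp x) *
      ct (?P * galg_bar Q * (\<Prod>\<alpha>\<in>R. 1 - galg_monom \<alpha> 1)) = of_nat (card W) * ct (f * g)"
    by (simp add: ct_const_mult[symmetric] ct_sum ct_act)
  \<comment> \<open>Conjugation turns exponents bounded from below into exponents bounded from
    above, the direction that \<open>below\<close> describes.\<close>
  also have "ct (f * g) = ct (galg_bar (f * g))" by (rule ct_bar[symmetric])
  also have "galg_bar (f * g) = (galg_monom (- x - \<rho>) 1 * galg_monom \<rho> 1) * Q * euler_prod Rp 1 *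
      (\<Prod>\<alpha>\<in>Rp. 1 - galg_monom \<alpha> t_poly)"
    by (simp add: f_def galg_bar_mult gb galg_bar_monom galg_bar_euler_prod mult_ac)
  also have "\<dots> = galg_monom (- x) 1 * Q * euler_prod Rp 1 * (\<Prod>\<alpha>\<in>Rp. 1 - galg_monom \<alpha> t_poly)"
    by (simp add: galg_monom_mult)
  also have "ct \<dots> = fps_galg_coeff 0
      (galg_to_fps (galg_monom (- x) 1 * Q * euler_prod Rp 1) *
       ((\<Prod>\<alpha>\<in>Rp. galg_to_fps (1 - galg_monom \<alpha> t_poly) * geometric_fps \<alpha>) *
        (\<Prod>\<alpha>\<in>Rp. geometric_fps (- \<alpha>))))"
    unfolding ct_def prod_R galg_to_fps_mult galg_to_fps_prod prod.distrib by (simp only: mult.assoc)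
  also have "(\<Prod>\<alpha>\<in>Rp. galg_to_fps (1 - galg_monom \<alpha> t_poly) * geometric_fps \<alpha>) = 1"
    by (simp add: geometric_fps_inverse)
  finally show ?thesis by simp
qed

lemma ct_macdonald_spherical_eq:
  assumes x: "x \<in> \<Lambda>" "dom x" and y: "y \<in> \<Lambda>" "dom y"
  defines "c \<equiv> ct (macdonald_spherical B R Rp x * galg_bar (macdonald_spherical B R Rp y) *
      (\<Prod>\<alpha>\<in>R. 1 - galg_monom \<alpha> 1))"
  shows "y - x \<notin> poscone \<Longrightarrow> c = 0"
    and "x = y \<Longrightarrow> fps_of_poly (stabilizer_poly B R Rp x) * c = of_nat (card W)"
proof -
  let ?Q = "macdonald_spherical B R Rp y"
  let ?F = "galg_to_fps (galg_monom (- x) 1 * ?Q * euler_prod Rp 1)"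
  let ?G = "\<Prod>\<alpha>\<in>Rp. geometric_fps (- \<alpha>)"
  have b: "below (- x + y + 0) (galg_monom (- x) 1 * ?Q * euler_prod Rp 1)"
    "galg_coeff (galg_monom (- x) 1 * ?Q * euler_prod Rp 1) (- x + y + 0) = 1"
    using below_mult[OF below_mult(1)[OF below_monom macdonald_spherical_lead(1)[OF y]]
        euler_prod_lead(1)[OF order_refl], of "- x" 1 1]
      below_mult(2)[OF below_monom macdonald_spherical_lead(1)[OF y], of "- x" 1]
      macdonald_spherical_lead(2)[OF y] euler_prod_lead(2)[OF order_refl, of 1]
    by (simp_all add: galg_coeff_monom)
  have G: "fps_below 0 ?G" "fps_galg_coeff 0 ?G = 1"
    using fps_below_prod[of Rp "\<lambda>\<alpha>. geometric_fps (- \<alpha>)"] fps_below_geometric by auto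
  have FG: "fps_below (y - x) (?F * ?G)" "fps_galg_coeff (y - x) (?F * ?G) = 1"
    using fps_below_mult[OF fps_below_galg_to_fps(1)[OF b(1)] G(1)] b(2) G(2)
    by (simp_all add: fps_below_galg_to_fps(2))
  have eq: "fps_of_poly (stabilizer_poly B R Rp x) * c = of_nat (card W) * fps_galg_coeff 0 (?F * ?G)"
    unfolding c_def by (rule ct_macdonald_spherical[OF x act_macdonald_spherical[OF y]])
  show "fps_of_poly (stabilizer_poly B R Rp x) * c = of_nat (card W)" if "x = y"
    using eq FG(2) that by simp
  show "c = 0" if "y - x \<notin> poscone"
  proof -
    have "galg_coeff (fps_nth (?F * ?G) n) 0 = 0" for n
      using FG(1) that unfolding fps_below_def below_def by (metis diff_zero)
    then have "fps_galg_coeff 0 (?F * ?G) = 0" by (intro fps_ext) (simp add: fps_galg_coeff_def)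
    then show ?thesis using eq stabilizer_poly_nonzero by simp
  qed
qed

section \<open>The three orthogonality relations\<close>

definition fps_rat :: "int fps \<Rightarrow> rat fps" where
  "fps_rat F = Abs_fps (\<lambda>n. of_int (fps_nth F n))"

lemma fps_rat_of_poly_mult: "fps_rat (fps_of_poly p * F) = fps_of_poly (map_poly of_int p) * fps_rat F"
  by (rule fps_ext) (simp add: fps_rat_def fps_mult_nth coeff_map_poly)

lemma form_t_eq: "form_t B R f g = fps_const (1 / of_nat (card W)) *
    fps_rat (ct (f * galg_bar g * (\<Prod>\<alpha>\<in>R. 1 - galg_monom \<alpha> 1)))"
proof -
  have "(\<Prod>\<alpha>\<in>R. fps_const (1 - galg_monom \<alpha> 1) * geometric_fps \<alpha>) =
      galg_to_fps (\<Prod>\<alpha>\<in>R. 1 - galg_monom \<alpha> 1) * geom"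
    by (simp add: prod.distrib galg_to_fps_prod galg_to_fps_diff galg_to_fps_one galg_to_fps_monom
        flip: fps_const_sub)
  then show ?thesis
    by (simp add: form_t_def fps_rat_def ct_def fps_galg_coeff_def galg_to_fps_mult mult.assoc)
qed

lemma form_t_commute: "form_t B R f g = form_t B R g f"
proof -
  have "galg_bar (\<Prod>\<alpha>\<in>R. 1 - galg_monom \<alpha> 1 :: ('a, int poly) galg) = (\<Prod>\<alpha>\<in>R. 1 - galg_monom \<alpha> 1)"
    unfolding denominator_mult_bar[symmetric] by (simp add: galg_bar_mult galg_bar_bar mult.commute)
  then have "galg_bar (f * galg_bar g * (\<Prod>\<alpha>\<in>R. 1 - galg_monom \<alpha> 1)) =
      g * galg_bar f * (\<Prod>\<alpha>\<in>R. 1 - galg_monom \<alpha> 1)"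
    by (simp add: galg_bar_mult galg_bar_bar mult.commute)
  then show ?thesis unfolding form_t_eq by (metis ct_bar)
qed

theorem form_t_macdonald_spherical:
  assumes x: "x \<in> \<Lambda>" "dom x" and y: "y \<in> \<Lambda>" "dom y"
  shows "form_t B R (macdonald_spherical B R Rp x) (macdonald_spherical B R Rp y) =
    (if x = y then 1 / fps_of_poly (map_poly of_int (stabilizer_poly B R Rp x)) else 0)"
proof (cases "x = y")
  case True
  let ?C = "fps_of_poly (map_poly of_int (stabilizer_poly B R Rp x)) :: rat fps"
  let ?f = "form_t B R (macdonald_spherical B R Rp x) (macdonald_spherical B R Rp y)"
  have "map_poly of_int (stabilizer_poly B R Rp x) \<noteq> (0 :: rat poly)"
    using stabilizer_poly_nonzero by (simp add: map_poly_eq_0_iff)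
  then have C0: "?C \<noteq> 0" by simp
  have "?C * ?f = fps_const (1 / of_nat (card W)) * fps_rat (of_nat (card W))"
    unfolding form_t_eq using ct_macdonald_spherical_eq(2)[OF x y True]
    by (simp add: mult.left_commute fps_rat_of_poly_mult[symmetric])
  also have "fps_rat (of_nat (card W)) = fps_const (of_nat (card W))"
    by (rule fps_ext) (simp add: fps_rat_def fps_of_nat[symmetric])
  also have "fps_const (1 / of_nat (card W)) * fps_const (of_nat (card W)) = (1 :: rat fps)"
    using card_W_nonzero by simp
  finally have "?C * ?f = 1" .
  then have "?f = 1 / ?C" using nonzero_mult_div_cancel_left[OF C0, of ?f] by simp
  then show ?thesis using True by simp
next
  case False
  have zero: "form_t B R (macdonald_spherical B R Rp u) (macdonald_spherical B R Rp v) = 0"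
    if "u \<in> \<Lambda>" "dom u" "v \<in> \<Lambda>" "dom v" "v - u \<notin> poscone" for u v
    unfolding form_t_eq ct_macdonald_spherical_eq(1)[OF that]
    by (simp add: fps_rat_def fps_eq_iff)
  \<comment> \<open>The cone is pointed, so for distinct weights at least one order of the arguments
    is covered by \<open>zero\<close>.\<close>
  have "y - x \<notin> poscone \<or> x - y \<notin> poscone"
    using poscone_uminus[of "y - x"] False by auto
  then show ?thesis
    using zero[OF x y] zero[OF y x] form_t_commute False by (metis (full_types))
qed

theorem form_0_weyl_character:
  assumes x: "x \<in> \<Lambda>" "dom x" and y: "y \<in> \<Lambda>" "dom y"
  shows "form_0 B R (weyl_character B R Rp x) (weyl_character B R Rp y) = (if x = y then 1 else 0)"
proof -
  have xr: "sdom (x + \<rho>)" "sdom (y + \<rho>)" using x y dom_sdom_add sdom_rho by auto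
  have "weyl_character B R Rp x * galg_bar (weyl_character B R Rp y) * (\<Prod>\<alpha>\<in>R. 1 - galg_monom \<alpha> 1) =
      (weyl_character B R Rp x * alt \<rho>) * galg_bar (weyl_character B R Rp y * alt \<rho>)"
    unfolding denominator_mult_bar[symmetric] galg_bar_mult by (simp only: mult_ac)
  also have "\<dots> = alt (x + \<rho>) * galg_bar (alt (y + \<rho>))"
    by (simp add: weyl_character_mult_denominator x y)
  also have "galg_coeff \<dots> 0 = (\<Sum>w\<in>W. sgn_W w * galg_coeff (galg_bar (alt (y + \<rho>))) (- w (x + \<rho>)))"
    unfolding alt_eq[of "x + \<rho>"] sum_distrib_right galg_coeff_sum mult.assoc galg_coeff_sgn
    by (simp add: galg_coeff_monom_mult)
  also have "\<dots> = (\<Sum>w\<in>W. sgn_W w * galg_coeff (alt (y + \<rho>)) (w (x + \<rho>)))"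
    using galg_coeff_map_exp[of uminus "alt (y + \<rho>)"]
    by (simp add: galg_bar_def inj_def)
  \<comment> \<open>Antisymmetry moves every evaluation to the dominant point
    \<open>x + \<rho>\<close>, where \<open>alt_coeff\<close> applies.\<close>
  also have "\<dots> = (\<Sum>w\<in>W. sgn_W w * (sgn_W w * galg_coeff (alt (y + \<rho>)) (x + \<rho>)))"
    by (intro sum.cong refl) (simp only: asym_coeff[OF asym_alternate])
  also have "\<dots> = of_nat (card W) * (if x = y then 1 else 0)"
    by (simp add: mult.assoc[symmetric] sgn_square alt_coeff[OF xr(2) sdom_dom[OF xr(1)]])
  finally show ?thesis
    using card_W_nonzero by (simp add: form_0_def of_nat_poly map_poly_pCons one_pCons)
qed

text \<open>Conjugation pairs equal exponents, so the constant term counts common orbit points. By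
  \<open>dom_unique\<close> orbits of distinct dominant vectors are disjoint, and the orbit of
  \<open>x\<close> has |W| / |W_x| points.\<close>

theorem form_1_orbit_sum:
  assumes x: "dom x" and y: "dom y"
  shows "form_1 B R (orbit_sum B R x) (orbit_sum B R y) =
    (if x = y then [:1 / of_nat (card (weyl_stabilizer B R x)):] else 0)"
proof -
  let ?O = "(\<lambda>w. w x) ` W"
  have "galg_coeff (orbit_sum B R x * galg_bar (orbit_sum B R y)) 0 =
      (\<Sum>\<gamma>\<in>?O. galg_coeff (galg_bar (orbit_sum B R y)) (- \<gamma>))"
    unfolding orbit_sum_def[of B R x] sum_distrib_right galg_coeff_sum
    by (simp add: galg_coeff_monom_mult)
  also have "\<dots> = (\<Sum>\<gamma>\<in>?O. galg_coeff (orbit_sum B R y) \<gamma>)"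
    using galg_coeff_map_exp[of uminus "orbit_sum B R y"] by (simp add: galg_bar_def inj_def)
  also have "\<dots> = (\<Sum>\<gamma>\<in>?O. if x = y then 1 else 0)"
  proof (rule sum.cong[OF refl])
    fix \<gamma> assume "\<gamma> \<in> ?O"
    then obtain u where u: "u \<in> W" "\<gamma> = u x" by blast
    have "x = y" if g: "\<gamma> \<in> (\<lambda>w. w y) ` W"
    proof -
      obtain v where v: "\<gamma> = v y" "v \<in> W" using g by (rule imageE)
      then have e: "(inv u \<circ> v) y = x" using inv_W_eq(1)[OF u(1), of x] u(2) by simp
      have "inv u \<circ> v \<in> W" using u v by (intro comp_in_W inv_in_W)
      then show ?thesis using dom_unique[OF y, of "inv u \<circ> v"] x unfolding e by simp
    qed
    then show "galg_coeff (orbit_sum B R y) \<gamma> = (if x = y then 1 else 0)"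
      using u by (auto simp: orbit_sum_coeff)
  qed
  finally have ct: "galg_coeff (orbit_sum B R x * galg_bar (orbit_sum B R y)) 0 =
      of_nat (card ?O) * (if x = y then 1 else 0)" by simp
  have "card W = (\<Sum>\<gamma>\<in>?O. card {w\<in>W. w x = \<gamma>})"
    using sum.image_gen[OF finite_W, of "\<lambda>_. 1::nat" "\<lambda>w. w x"] by simp
  also have "\<dots> = (\<Sum>\<gamma>\<in>?O. card (weyl_stabilizer B R x))"
    using bij_betw_same_card[OF bij_orbit_fibre, symmetric] by (intro sum.cong) auto
  finally have card: "card W = card ?O * card (weyl_stabilizer B R x)" by simp
  then have "(of_nat (card ?O) :: rat) / of_nat (card W) = 1 / of_nat (card (weyl_stabilizer B R x))"
    using card_W_nonzero by (simp add: field_simps)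
  then show ?thesis
    unfolding form_1_def ct by (cases "x = y") (simp_all add: of_nat_poly map_poly_pCons)
qed

end


subsection \<open>The canonical positive definite form\<close>

text \<open>The given form may be negative definite. This one is positive definite and
  has the same pairing with coroots, and all objects in the theorem depend on the
  form only through that pairing.\<close>

definition canonical_form :: "('a::real_vector \<Rightarrow> 'a \<Rightarrow> real) \<Rightarrow> 'a set \<Rightarrow> 'a \<Rightarrow> 'a \<Rightarrow> real" where
  "canonical_form B R x y = (\<Sum>\<alpha>\<in>R. B x (coroot B \<alpha>) * B y (coroot B \<alpha>))"

context
  fixes B :: "'a::real_vector \<Rightarrow> 'a \<Rightarrow> real" and R :: "'a set"
  assumes nsb: "nondegenerate_symmetric_bilinear B" and rs: "root_system B R"
begin

private lemma bil: "bilinear B" and Bsym: "B x y = B y x"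
  using nsb by (auto simp: nondegenerate_symmetric_bilinear_def)

private lemmas Bs = bilinear_ladd[OF bil] bilinear_radd[OF bil]
  bilinear_lsub[OF bil] bilinear_rsub[OF bil]
  bilinear_lmul[OF bil] bilinear_rmul[OF bil]
  bilinear_lzero[OF bil] bilinear_rzero[OF bil]

private lemma nonisotropic: "\<alpha> \<in> R \<Longrightarrow> B \<alpha> \<alpha> \<noteq> 0"
  using rs by (auto simp: root_system_def)

lemma canonical_form_bilinear: "bilinear (canonical_form B R)"
  unfolding bilinear_def linear_iff canonical_form_def
  by (auto simp: Bs sum.distrib sum_distrib_left algebra_simps)

lemma canonical_form_sym: "canonical_form B R x y = canonical_form B R y x"
  by (simp add: canonical_form_def mult.commute)

text \<open>A sum of squares; if it vanishes, \<open>x\<close> is \<open>B\<close>-orthogonal to all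
  roots, hence to their span, and nondegeneracy gives \<open>x = 0\<close>.\<close>

lemma canonical_form_pos:
  assumes "x \<noteq> 0" shows "canonical_form B R x x > 0"
proof -
  have fin: "finite R" and sp: "span R = UNIV" using rs by (auto simp: root_system_def)
  have "canonical_form B R x x \<noteq> 0"
  proof
    assume "canonical_form B R x x = 0"
    then have "\<forall>\<alpha>\<in>R. B x (coroot B \<alpha>) = 0"
      unfolding canonical_form_def using fin by (subst (asm) sum_nonneg_eq_0_iff) auto
    then have "\<forall>\<alpha>\<in>R. B x \<alpha> = 0" using nonisotropic by (auto simp: coroot_def Bs)
    then have "B x y = 0" if "y \<in> span R" for y
      using linear_eq_0_on_span[of "B x" R y] bil that by (auto simp: bilinear_def)
    then have "x = 0" using nsb sp by (auto simp: nondegenerate_symmetric_bilinear_def)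
    then show False using assms by simp
  qed
  moreover have "canonical_form B R x x \<ge> 0" unfolding canonical_form_def by (simp add: sum_nonneg)
  ultimately show ?thesis by simp
qed

private lemma reflection_isometry: "\<beta> \<in> R \<Longrightarrow> B (reflection B \<beta> x) (reflection B \<beta> y) = B x y"
  using nonisotropic[of \<beta>]
  by (simp add: reflection_def coroot_def Bs Bsym[of \<beta> y] Bsym[of \<beta> x] field_simps)

private lemma reflection_reflection: "\<beta> \<in> R \<Longrightarrow> reflection B \<beta> (reflection B \<beta> x) = x"
  using nonisotropic[of \<beta>] by (simp add: reflection_def coroot_def Bs algebra_simps)

private lemma coroot_reflection:
  "\<beta> \<in> R \<Longrightarrow> coroot B (reflection B \<beta> \<alpha>) = reflection B \<beta> (coroot B \<alpha>)"
  using reflection_isometry[of \<beta> \<alpha> \<alpha>]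
  by (simp add: coroot_def) (simp add: reflection_def coroot_def Bs algebra_simps)

lemma canonical_form_isometry:
  assumes "\<beta> \<in> R"
  shows "canonical_form B R (reflection B \<beta> x) (reflection B \<beta> y) = canonical_form B R x y"
proof -
  have bij: "bij_betw (reflection B \<beta>) R R"
    using rs assms reflection_reflection
    by (intro bij_betw_byWitness[where f' = "reflection B \<beta>"]) (auto simp: root_system_def)
  have "canonical_form B R (reflection B \<beta> x) (reflection B \<beta> y) =
      (\<Sum>\<alpha>\<in>R. B (reflection B \<beta> x) (coroot B (reflection B \<beta> \<alpha>)) *
        B (reflection B \<beta> y) (coroot B (reflection B \<beta> \<alpha>)))"
    unfolding canonical_form_def by (rule sum.reindex_bij_betw[OF bij, symmetric])
  also have "\<dots> = canonical_form B R x y"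
    by (simp add: canonical_form_def coroot_reflection[OF assms] reflection_isometry[OF assms])
  finally show ?thesis .
qed

text \<open>Invariance under the reflection in \<open>\<beta>\<close> already fixes the pairing:
  comparing the form at \<open>(x, \<beta>)\<close> and at the reflected pair, whose second entry is
  \<open>- \<beta>\<close>, gives \<open>2 * ?c x \<beta> = B x (coroot B \<beta>) * ?c \<beta>
  \<beta>\<close>.\<close>

lemma canonical_form_coroot:
  assumes "\<beta> \<in> R"
  shows "canonical_form B R x (coroot (canonical_form B R) \<beta>) = B x (coroot B \<beta>)"
proof -
  let ?c = "canonical_form B R"
  note cs = bilinear_ladd[OF canonical_form_bilinear] bilinear_lsub[OF canonical_form_bilinear]
    bilinear_lmul[OF canonical_form_bilinear] bilinear_rmul[OF canonical_form_bilinear]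
    bilinear_rneg[OF canonical_form_bilinear]
  have "\<beta> \<noteq> 0" using nonisotropic[OF assms] by (auto simp: Bs)
  then have p: "?c \<beta> \<beta> > 0" by (rule canonical_form_pos)
  have "reflection B \<beta> \<beta> = - \<beta>"
    using nonisotropic[OF assms] by (simp add: reflection_def coroot_def Bs scaleR_2)
  then have "?c x \<beta> = ?c (x - B x (coroot B \<beta>) *\<^sub>R \<beta>) (- \<beta>)"
    using canonical_form_isometry[OF assms, of x \<beta>] by (simp add: reflection_def)
  then have "2 * ?c x \<beta> = B x (coroot B \<beta>) * ?c \<beta> \<beta>" by (simp add: cs algebra_simps)
  then show ?thesis using p by (simp add: coroot_def[of ?c] cs field_simps)
qed

end

section \<open>Transfer between forms with the same pairing\<close>

lemma weyl_group_subset: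
  assumes "\<And>\<alpha>. \<alpha> \<in> R \<Longrightarrow> reflection B \<alpha> = reflection C \<alpha>"
  shows "weyl_group B R \<subseteq> weyl_group C R"
proof
  fix w assume "w \<in> weyl_group B R"
  then show "w \<in> weyl_group C R"
  proof (induction rule: weyl_group.induct)
    case weyl_id
    show ?case by (rule weyl_group.weyl_id)
  next
    case (weyl_refl w \<alpha>)
    show ?case unfolding assms[OF weyl_refl.hyps(2)]
      by (rule weyl_group.weyl_refl[OF weyl_refl.IH weyl_refl.hyps(2)])
  qed
qed

lemma root_data_cong:
  assumes "\<And>\<alpha> x. \<alpha> \<in> R \<Longrightarrow> B x (coroot B \<alpha>) = C x (coroot C \<alpha>)"
  shows "weyl_group B R = weyl_group C R" "weight_lattice B R = weight_lattice C R"
    "Rp \<subseteq> R \<Longrightarrow> dominant_weights B R Rp = dominant_weights C R Rp"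
    "Rp \<subseteq> R \<Longrightarrow> weyl_length B Rp = weyl_length C Rp"
proof -
  have r: "reflection B \<alpha> = reflection C \<alpha>" if "\<alpha> \<in> R" for \<alpha>
    by (simp add: fun_eq_iff reflection_def assms[OF that])
  show "weyl_group B R = weyl_group C R"
    using weyl_group_subset[of R B C] weyl_group_subset[of R C B] r by auto
  show P: "weight_lattice B R = weight_lattice C R" by (auto simp: weight_lattice_def assms)
  show "dominant_weights B R Rp = dominant_weights C R Rp" if "Rp \<subseteq> R"
  proof -
    have "B x (coroot B \<alpha>) = C x (coroot C \<alpha>)" if "\<alpha> \<in> Rp" for \<alpha> x
      using assms that \<open>Rp \<subseteq> R\<close> by blast
    then show ?thesis by (simp add: dominant_weights_def P)
  qed
  show "weyl_length B Rp = weyl_length C Rp" if "Rp \<subseteq> R"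
  proof
    fix w
    have "foldr (\<lambda>\<alpha> u. reflection B \<alpha> \<circ> u) as id = foldr (\<lambda>\<alpha> u. reflection C \<alpha> \<circ> u) as id"
      if "set as \<subseteq> simple_roots Rp" for as
      using that \<open>Rp \<subseteq> R\<close> r by (intro foldr_cong) (auto simp: simple_roots_def)
    then have "(\<exists>as. length as = n \<and> set as \<subseteq> simple_roots Rp \<and> w = foldr (\<lambda>\<alpha> u. reflection B \<alpha> \<circ> u) as id)
      \<longleftrightarrow> (\<exists>as. length as = n \<and> set as \<subseteq> simple_roots Rp \<and> w = foldr (\<lambda>\<alpha> u. reflection C \<alpha> \<circ> u) as id)" for n
      by metis
    then show "weyl_length B Rp w = weyl_length C Rp w" by (simp add: weyl_length_def)
  qed
qed

theorem proposition3p4: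
  fixes B :: "'a::real_vector \<Rightarrow> 'a \<Rightarrow> real"
    and R Rp :: "'a set"
    and lam mu :: 'a
  assumes "nondegenerate_symmetric_bilinear B"
    and "root_system B R"
    and "reduced_roots R"
    and "irreducible_roots B R"
    and "positive_roots B R Rp"
    and "lam \<in> dominant_weights B R Rp"
    and "mu \<in> dominant_weights B R Rp"
  shows "form_1 B R (orbit_sum B R lam) (orbit_sum B R mu)
           = (if lam = mu then [:1 / of_nat (card (weyl_stabilizer B R lam)):] else 0) \<and>
         form_0 B R (weyl_character B R Rp lam) (weyl_character B R Rp mu)
           = (if lam = mu then 1 else 0) \<and>
         form_t B R (macdonald_spherical B R Rp lam) (macdonald_spherical B R Rp mu)
           = (if lam = mu
              then 1 / fps_of_poly (map_poly of_int (stabilizer_poly B R Rp lam))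
              else 0)"
proof -
  define C where "C = canonical_form B R"
  note B = assms(1,2)
  have bil: "bilinear C" unfolding C_def by (rule canonical_form_bilinear[OF B])
  have pair: "B x (coroot B \<alpha>) = C x (coroot C \<alpha>)" if "\<alpha> \<in> R" for \<alpha> x
    using canonical_form_coroot[OF B that] by (simp add: C_def)
  obtain v where v: "\<And>\<alpha>. \<alpha> \<in> R \<Longrightarrow> B v (coroot B \<alpha>) \<noteq> 0" "Rp = {\<alpha>\<in>R. B v (coroot B \<alpha>) > 0}"
    using assms(5) unfolding positive_roots_def by blast
  have nz: "0 \<notin> R" using B by (auto simp: root_system_def nondegenerate_symmetric_bilinear_def bilinear_lzero)
  have Cpos: "C x x > 0" if "x \<noteq> 0" for x
    unfolding C_def by (rule canonical_form_pos[OF B that])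
  have pairC: "C v (coroot C \<alpha>) = 2 / C \<alpha> \<alpha> * C v \<alpha>" for \<alpha>
    by (simp add: coroot_def bilinear_rmul[OF bil])
  \<comment> \<open>The vector \<open>v\<close> of the chamber becomes the functional
    \<open>C v\<close>; as \<open>C \<alpha> \<alpha> > 0\<close>, it has the same sign at
    \<open>\<alpha>\<close> as the pairing with the coroot, so it selects the same positive
    roots.\<close>
  interpret E: euclidean_root_system C R "C v"
  proof
    show "C x y = C y x" for x y unfolding C_def by (rule canonical_form_sym[OF B])
    show "reflection C \<alpha> \<beta> \<in> R" "C \<beta> (coroot C \<alpha>) \<in> \<int>" if "\<alpha> \<in> R" "\<beta> \<in> R" for \<alpha> \<beta>
      using B(2) that unfolding root_system_def reflection_def pair[OF that(1), symmetric] by blast+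
    show "C v \<alpha> \<noteq> 0" if "\<alpha> \<in> R" for \<alpha>
      using v(1)[OF that] pair[OF that, of v] pairC[of \<alpha>] by auto
    show "C v (x + y) = C v x + C v y" "C v (r *\<^sub>R x) = r *\<^sub>R C v x" for x y r
      by (simp_all add: bilinear_radd[OF bil] bilinear_rmul[OF bil])
  qed (use B bil Cpos nz assms(3) in \<open>auto simp: root_system_def\<close>)
  have Rp: "Rp = E.Rp"
    unfolding v(2) E.Rp_def
    using pair Cpos nz by (intro Collect_cong) (metis E.pair_pos_iff)
  have sub: "Rp \<subseteq> R" by (simp add: v(2))
  have W: "weyl_group B R = weyl_group C R" and L: "weight_lattice B R = weight_lattice C R"
    and D: "dominant_weights B R Rp = dominant_weights C R Rp" and len: "weyl_length B Rp = weyl_length C Rp"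
    using root_data_cong[of R B C] pair sub by blast+
  have st: "weyl_stabilizer B R = weyl_stabilizer C R" by (simp add: fun_eq_iff weyl_stabilizer_def W)
  have dom: "lam \<in> weight_lattice C R" "E.dom lam" "mu \<in> weight_lattice C R" "E.dom mu"
    using assms(6,7) E.dominant_weights_iff by (simp_all add: D flip: Rp)
  have "form_1 B R = form_1 C R" "form_0 B R = form_0 C R" "form_t B R = form_t C R"
    "orbit_sum B R = orbit_sum C R" "stabilizer_poly B R Rp = stabilizer_poly C R Rp"
    "alternating_sum B R Rp = alternating_sum C R Rp"
    by (simp_all add: fun_eq_iff form_1_def form_0_def form_t_def orbit_sum_def stabilizer_poly_def
        alternating_sum_def W st len)
  moreover from this have "weyl_character B R Rp = weyl_character C R Rp"
    "macdonald_spherical B R Rp = macdonald_spherical C R Rp"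
    by (simp_all add: fun_eq_iff weyl_character_def macdonald_spherical_def W L)
  ultimately show ?thesis
    using E.form_1_orbit_sum[OF dom(2,4)] E.form_0_weyl_character[OF dom] E.form_t_macdonald_spherical[OF dom]
    by (simp add: st flip: Rp)
qed

end
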